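(* Let $0\le q\le 1$, let $\eta,\theta\in\mathbb{R}$ with $\eta\theta\ge 0$, let $\tau\ge 0$, and let $0\le s\le t$. Then for every $x$ in the support of the orthogonality measure $\mu_s$ there exists a unique probability measure $\nu_x=\nu_{x,t,s}$ on $\mathbb{R}$ (depending also on $\eta,\theta,\tau,q$) such that for all $n\ge 0$ $$\overline{p}_n(x;s)=\int_{\mathbb{R}} \overline{p}_n(y;t)\,\nu_x(dy).$$
   Context: Notation: $[n]_q=1+q+\dots+q^{n-1}$ for $n\ge1$, $[0]_q=0$, and $0^0=1$; a term containing a factor $[0]_q$ is $0$. For given parameters $\eta,\theta,\tau,q$ and $t\ge 0$, the monic polynomials $\overline{p}_n(y;t)=\overline{p}_n^{(\eta,\theta,\tau,q)}(y;t)$ in $y$ are defined by $\overline{p}_{-1}=0$, $\overline{p}_0=1$ and, for $n\ge 0$, $$y\,\overline{p}_n(y;t)=\overline{p}_{n+1}(y;t)+b_n(t)\,\overline{p}_n(y;t)+a_{n-1}c_n(t)\,\overline{p}_{n-1}(y;t),$$ where $b_n(t)=\left(t\eta+\theta+([n]_q+[n-1]_q)\eta\tau\right)[n]_q$ and, for $\eta\neq0$, $$a_n=\eta^{-1}+\theta[n]_q+[n]_q^2\eta\tau,\qquad c_n(t)=\eta\,(t+\tau[n-1]_q)[n]_q .$$ For $\eta=0$ the product $a_{n-1}c_n(t)$ is interpreted as $(t+\tau[n-1]_q)[n]_q$. $\mu_t$ denotes the orthogonality measure of $\{\overline{p}_n(\cdot;t)\}_{n\ge0}$: the probability measure on $\mathbb{R}$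 with all moments finite such that $\int\overline{p}_m(y;t)\overline{p}_n(y;t)\,\mu_t(dy)=0$ for $m\ne n$ and $\int\overline{p}_n(y;t)^2\,\mu_t(dy)=\prod_{j=1}^n a_{j-1}c_j(t)$. (When $t=0$ this is the point mass at $0$.) *)

theory Defs
  imports "HOL-Probability.Probability" "HOL-Computational_Algebra.Polynomial"
begin

definition qnum :: "real \<Rightarrow> nat \<Rightarrow> real" where
  "qnum q n = (\<Sum>k<n. q ^ k)"

(* For n = 0 the truncated n - 1 is harmless here and in c_coeff and ac_coeff:
   it only occurs next to the factor qnum q 0 = 0. *)

definition b_coeff :: "real \<Rightarrow> real \<Rightarrow> real \<Rightarrow> real \<Rightarrow> real \<Rightarrow> nat \<Rightarrow> real" where
  "b_coeff \<eta> \<theta> \<tau> q t n =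
     (t * \<eta> + \<theta> + (qnum q n + qnum q (n - 1)) * \<eta> * \<tau>) * qnum q n"

definition a_coeff :: "real \<Rightarrow> real \<Rightarrow> real \<Rightarrow> real \<Rightarrow> nat \<Rightarrow> real" where
  "a_coeff \<eta> \<theta> \<tau> q n = inverse \<eta> + \<theta> * qnum q n + (qnum q n)\<^sup>2 * \<eta> * \<tau>"

definition c_coeff :: "real \<Rightarrow> real \<Rightarrow> real \<Rightarrow> real \<Rightarrow> nat \<Rightarrow> real" where
  "c_coeff \<eta> \<tau> q t n = \<eta> * (t + \<tau> * qnum q (n - 1)) * qnum q n"

(* The product a_(n-1) c_n(t), with its conventional value at \<eta> = 0. *)
definition ac_coeff :: "real \<Rightarrow> real \<Rightarrow> real \<Rightarrow> real \<Rightarrow> real \<Rightarrow> nat \<Rightarrow> real" where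
  "ac_coeff \<eta> \<theta> \<tau> q t n =
     (if \<eta> = 0 then (t + \<tau> * qnum q (n - 1)) * qnum q n
      else a_coeff \<eta> \<theta> \<tau> q (n - 1) * c_coeff \<eta> \<tau> q t n)"

(* The second equation is the recurrence at n = 0, where the p_(-1) term vanishes. *)
fun pbar :: "real \<Rightarrow> real \<Rightarrow> real \<Rightarrow> real \<Rightarrow> real \<Rightarrow> nat \<Rightarrow> real poly" where
  "pbar \<eta> \<theta> \<tau> q t 0 = 1"
| "pbar \<eta> \<theta> \<tau> q t (Suc 0) = [:- b_coeff \<eta> \<theta> \<tau> q t 0, 1:]"
| "pbar \<eta> \<theta> \<tau> q t (Suc (Suc n)) =
     [:- b_coeff \<eta> \<theta> \<tau> q t (Suc n), 1:] * pbar \<eta> \<theta> \<tau> q t (Suc n)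
     - smult (ac_coeff \<eta> \<theta> \<tau> q t (Suc n)) (pbar \<eta> \<theta> \<tau> q t n)"

definition orthogonality_measure ::
    "real \<Rightarrow> real \<Rightarrow> real \<Rightarrow> real \<Rightarrow> real \<Rightarrow> real measure \<Rightarrow> bool" where
  "orthogonality_measure \<eta> \<theta> \<tau> q t M \<longleftrightarrow>
     real_distribution M \<and>
     (\<forall>n::nat. integrable M (\<lambda>y. y ^ n)) \<and>
     (\<forall>m n. m \<noteq> n \<longrightarrow>
        (\<integral>y. poly (pbar \<eta> \<theta> \<tau> q t m) y * poly (pbar \<eta> \<theta> \<tau> q t n) y \<partial>M) = 0) \<and>
     (\<forall>n. (\<integral>y. (poly (pbar \<eta> \<theta> \<tau> q t n) y)\<^sup>2 \<partial>M) = (\<Prod>j=1..n. ac_coeff \<eta> \<theta> \<tau> q t j))"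

definition measure_support :: "real measure \<Rightarrow> real set" where
  "measure_support M = {x. \<forall>U. open U \<and> x \<in> U \<longrightarrow> 0 < emeasure M U}"

end

theory Submission
  imports Defs "HOL-Computational_Algebra.Fundamental_Theorem_Algebra"
begin

text \<open>
  Write \<open>Q\<^sub>n\<close> for the monic polynomials that should be orthogonal for \<open>\<nu>\<^sub>x\<close>. Their recurrence
  coefficients \<open>B\<close> and \<open>\<Lambda>\<close> are explicit, and a connection formula
  (\<open>pbar_connection\<close>) expands the polynomials at time \<open>t\<close> in the \<open>Q\<^sub>k\<close> with constant coefficient
  equal to the polynomial at time \<open>s\<close> at \<open>x\<close>. Hence the required integrals hold exactly if the \<open>Q\<^sub>n\<close>
  with \<open>n \<ge> 1\<close> have mean zero (\<open>pbar_martingale_iff\<close>), and the theorem becomes existence and uniqueness of a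
  measure with prescribed recurrence coefficients.

  Existence (\<open>Favard\<close>) needs the squared norms of the \<open>Q\<^sub>n\<close> to be nonnegative. They are a
  nonnegative constant times \<open>W\<^sub>n(x) = \<alpha>\<^sub>0(x) \<dots> \<alpha>\<^sub>n\<^sub>-\<^sub>1(x)\<close> with affine \<open>\<alpha>\<^sub>k\<close>. The factors
  may change sign, so the point is that every \<open>W\<^sub>n\<close> is nonnegative on the support of \<open>\<mu>\<^sub>s\<close>. If \<open>\<alpha>\<^sub>0\<close> is not constant, the Jacobi
  matrix of \<open>\<mu>\<^sub>s\<close> has an LU factorisation with base point the zero of \<open>\<alpha>\<^sub>0\<close>. Therefore all zeros of
  the orthogonal polynomials lie where \<open>\<alpha>\<^sub>0 \<ge> 0\<close>, Gauss quadrature puts a measure with the same moments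
  there, and determinacy identifies it with \<open>\<mu>\<^sub>s\<close>. Multiplying \<open>\<mu>\<^sub>s\<close> by \<open>\<alpha>\<^sub>0\<close> gives a positive
  measure of the same kind, now with base point the zero of \<open>\<alpha>\<^sub>1\<close>, and the argument repeats
  (\<open>AE_\<alpha>_prod_nonneg\<close>). The polynomials of these transformed measures are also the ones that occur in
  the connection coefficients.

  Determinacy is thus used twice, for \<open>\<mu>\<^sub>s\<close> with its transforms and for \<open>\<nu>\<^sub>x\<close>. It suffices to find one nonreal \<open>w\<close> and
  polynomials with value \<open>1\<close> at \<open>w\<close> and arbitrarily small quadratic mean: then the resolvent at \<open>w\<close>,
  and with it every continuous function of compact support, is a limit of polynomials
  (\<open>determinate\<close>). Such polynomials exist as soon as the reproducing kernel at \<open>w\<close> is unbounded.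
  For off-diagonal coefficients of at most quadratic growth this is Carleman's criterion. In the remaining case,
  \<open>q = 1\<close> with \<open>\<eta>\<close> and \<open>\<tau>\<close> nonzero, they grow like \<open>n\<^sup>4\<close>, and the LU factorisation shows that the polynomials
  grow fast enough far beyond the base point (\<open>jkernel_unbounded_LU\<close>).
\<close>

section \<open>Polynomials from a three-term recurrence and their zeros\<close>

text \<open>The polynomials are generic in the field because their zeros are located in the complex plane
while the measures live on the real line.\<close>

fun jpoly :: "(nat \<Rightarrow> real) \<Rightarrow> (nat \<Rightarrow> real) \<Rightarrow> nat \<Rightarrow> 'a::real_normed_field poly" where
  "jpoly b l 0 = 1"
| "jpoly b l (Suc 0) = [:- of_real (b 0), 1:]"
| "jpoly b l (Suc (Suc n)) =
     [:- of_real (b (Suc n)), 1:] * jpoly b l (Suc n) - smult (of_real (l (Suc n))) (jpoly b l n)"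

definition jnorm :: "(nat \<Rightarrow> real) \<Rightarrow> nat \<Rightarrow> real" where
  "jnorm l n = (\<Prod>j=1..n. l j)"

lemma jnorm_0 [simp]: "jnorm l 0 = 1"
  by (simp add: jnorm_def)

lemma jnorm_Suc [simp]: "jnorm l (Suc n) = jnorm l n * l (Suc n)"
  by (simp add: jnorm_def mult.commute)

lemma poly_jpoly_Suc_Suc:
  "poly (jpoly b l (Suc (Suc n))) z =
     (z - of_real (b (Suc n))) * poly (jpoly b l (Suc n)) z - of_real (l (Suc n)) * poly (jpoly b l n) z"
  by (simp add: algebra_simps)

lemma times_jpoly:
  "z * poly (jpoly b l n) z =
     poly (jpoly b l (Suc n)) z + of_real (b n) * poly (jpoly b l n) z
     + (if n = 0 then 0 else of_real (l n) * poly (jpoly b l (n - 1)) z)"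
  by (cases n) (simp_all add: algebra_simps)

lemma poly_jpoly_of_real:
  "poly (jpoly b l n) (of_real x) = (of_real (poly (jpoly b l n) x) :: 'a::real_normed_field)"
  by (induction n rule: induct_nat_012) (simp_all del: jpoly.simps(3) add: poly_jpoly_Suc_Suc)

lemma poly_jpoly_cnj: "poly (jpoly b l n) (cnj z) = cnj (poly (jpoly b l n) z)"
  by (induction n rule: induct_nat_012) (simp_all del: jpoly.simps(3) add: poly_jpoly_Suc_Suc)

lemma degree_jpoly: "degree (jpoly b l n :: 'a::real_normed_field poly) = n"
  and lead_coeff_jpoly: "coeff (jpoly b l n :: 'a poly) n = 1"
proof -
  have "degree (jpoly b l n :: 'a poly) = n \<and> coeff (jpoly b l n :: 'a poly) n = 1"
  proof (induction n rule: induct_nat_012)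
    case (ge2 n)
    let ?p = "[:- of_real (b (Suc n)), 1:] * jpoly b l (Suc n) :: 'a poly"
    let ?r = "smult (of_real (l (Suc n))) (jpoly b l n) :: 'a poly"
    have nz: "jpoly b l (Suc n) \<noteq> (0 :: 'a poly)" using ge2 by auto
    have dp: "degree ?p = Suc (Suc n)"
      using ge2 nz by (subst degree_mult_eq) auto
    have cp: "coeff ?p (Suc (Suc n)) = 1"
      using ge2 by (simp add: coeff_eq_0)
    have dr: "degree ?r < Suc (Suc n)"
      using ge2 degree_smult_le[of "of_real (l (Suc n))" "jpoly b l n :: 'a poly"] by linarith
    have c: "coeff (jpoly b l (Suc (Suc n)) :: 'a poly) (Suc (Suc n)) = 1"
      unfolding jpoly.simps coeff_diff cp coeff_eq_0[OF dr] by simp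
    have "degree (jpoly b l (Suc (Suc n)) :: 'a poly) \<le> Suc (Suc n)"
      unfolding jpoly.simps by (rule degree_diff_le) (use dp dr in auto)
    with c show ?case
      by (metis le_antisym le_degree zero_neq_one)
  qed auto
  then show "degree (jpoly b l n :: 'a poly) = n" "coeff (jpoly b l n :: 'a poly) n = 1" by auto
qed

lemma jpoly_neq_0 [simp]: "jpoly b l n \<noteq> (0 :: 'a::real_normed_field poly)"
  using lead_coeff_jpoly[of b l n, where 'a = 'a] by auto

lemma jpoly_coeffs_unique:
  fixes c :: "nat \<Rightarrow> 'a::real_normed_field"
  assumes "(\<Sum>k<N. smult (c k) (jpoly b l k)) = 0" "k < N"
  shows "c k = 0"
  using assms
proof (induction N)
  case (Suc N)
  have "coeff (\<Sum>k<N. smult (c k) (jpoly b l k)) N = 0"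
    by (simp add: coeff_sum coeff_eq_0 degree_jpoly)
  then have "c N = 0"
    using arg_cong[OF Suc.prems(1), of "\<lambda>p. coeff p N"] by (simp add: lead_coeff_jpoly)
  then show ?case using Suc by (cases "k = N") auto
qed simp

text \<open>Multiplying out one step of the recurrence turns the left side for \<^term>\<open>Suc n\<close> into
\<^term>\<open>l (Suc n)\<close> times the left side for \<^term>\<open>n\<close> plus the new diagonal term. Taken at complex
conjugate arguments it locates the zeros, at two zeros it gives the quadrature weights.\<close>

lemma Christoffel_Darboux:
  fixes x y :: "'a::real_normed_field"
  assumes "\<And>k. k \<le> n \<Longrightarrow> jnorm l k \<noteq> 0"
  shows "poly (jpoly b l (Suc n)) x * poly (jpoly b l n) y - poly (jpoly b l n) x * poly (jpoly b l (Suc n)) y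
    = (x - y) * of_real (jnorm l n) *
      (\<Sum>k\<le>n. poly (jpoly b l k) x * poly (jpoly b l k) y / of_real (jnorm l k))"
  using assms
proof (induction n)
  case (Suc n)
  have IH: "poly (jpoly b l (Suc n)) x * poly (jpoly b l n) y - poly (jpoly b l n) x * poly (jpoly b l (Suc n)) y
    = (x - y) * of_real (jnorm l n) *
      (\<Sum>k\<le>n. poly (jpoly b l k) x * poly (jpoly b l k) y / of_real (jnorm l k))"
    using Suc by simp
  have nz: "of_real (jnorm l (Suc n)) \<noteq> (0::'a)" using Suc.prems[of "Suc n"] by (simp del: jnorm_Suc)
  have "poly (jpoly b l (Suc (Suc n))) x * poly (jpoly b l (Suc n)) y - poly (jpoly b l (Suc n)) x * poly (jpoly b l (Suc (Suc n))) y
    = (x - y) * (poly (jpoly b l (Suc n)) x * poly (jpoly b l (Suc n)) y) + of_real (l (Suc n)) *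
     (poly (jpoly b l (Suc n)) x * poly (jpoly b l n) y - poly (jpoly b l n) x * poly (jpoly b l (Suc n)) y)"
    unfolding poly_jpoly_Suc_Suc by (simp add: algebra_simps del: jpoly.simps)
  also have "\<dots> = (x - y) * of_real (jnorm l (Suc n)) *
      (\<Sum>k\<le>Suc n. poly (jpoly b l k) x * poly (jpoly b l k) y / of_real (jnorm l k))"
    unfolding IH sum.atMost_Suc ring_distribs using nz
    by (simp add: algebra_simps del: jpoly.simps)
  finally show ?case .
qed simp

lemma confluent_Christoffel_Darboux:
  fixes x :: "'a::real_normed_field"
  assumes "\<And>k. k \<le> n \<Longrightarrow> jnorm l k \<noteq> 0"
  shows "poly (pderiv (jpoly b l (Suc n))) x * poly (jpoly b l n) x - poly (pderiv (jpoly b l n)) x * poly (jpoly b l (Suc n)) x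
    = of_real (jnorm l n) * (\<Sum>k\<le>n. (poly (jpoly b l k) x)\<^sup>2 / of_real (jnorm l k))"
  using assms
proof (induction n)
  case 0
  then show ?case by (simp add: pderiv_pCons)
next
  case (Suc n)
  have IH: "poly (pderiv (jpoly b l (Suc n))) x * poly (jpoly b l n) x - poly (pderiv (jpoly b l n)) x * poly (jpoly b l (Suc n)) x
    = of_real (jnorm l n) * (\<Sum>k\<le>n. (poly (jpoly b l k) x)\<^sup>2 / of_real (jnorm l k))"
    using Suc by simp
  have nz: "of_real (jnorm l (Suc n)) \<noteq> (0::'a)" using Suc.prems[of "Suc n"] by (simp del: jnorm_Suc)
  have d: "poly (pderiv (jpoly b l (Suc (Suc n)))) x = poly (jpoly b l (Suc n)) x
     + (x - of_real (b (Suc n))) * poly (pderiv (jpoly b l (Suc n))) x - of_real (l (Suc n)) * poly (pderiv (jpoly b l n)) x"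
    by (simp only: jpoly.simps pderiv_mult pderiv_diff pderiv_smult) (simp add: pderiv_pCons algebra_simps)
  have "poly (pderiv (jpoly b l (Suc (Suc n)))) x * poly (jpoly b l (Suc n)) x - poly (pderiv (jpoly b l (Suc n))) x * poly (jpoly b l (Suc (Suc n))) x
    = (poly (jpoly b l (Suc n)) x)\<^sup>2 + of_real (l (Suc n)) *
     (poly (pderiv (jpoly b l (Suc n))) x * poly (jpoly b l n) x - poly (pderiv (jpoly b l n)) x * poly (jpoly b l (Suc n)) x)"
    unfolding poly_jpoly_Suc_Suc d by (simp add: algebra_simps power2_eq_square del: jpoly.simps)
  also have "\<dots> = of_real (jnorm l (Suc n)) * (\<Sum>k\<le>Suc n. (poly (jpoly b l k) x)\<^sup>2 / of_real (jnorm l k))"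
    unfolding IH sum.atMost_Suc ring_distribs using nz
    by (simp add: algebra_simps del: jpoly.simps)
  finally show ?case .
qed

text \<open>The reciprocal of this number is the least value of the integral of \<open>|f|\<^sup>2\<close> over
polynomials \<open>f\<close> of degree at most \<open>n\<close> with \<open>f(z) = 1\<close>; its growth in \<open>n\<close> decides determinacy.\<close>

definition jkernel :: "(nat \<Rightarrow> real) \<Rightarrow> (nat \<Rightarrow> real) \<Rightarrow> nat \<Rightarrow> complex \<Rightarrow> real" where
  "jkernel b l n z = (\<Sum>k\<le>n. (cmod (poly (jpoly b l k) z))\<^sup>2 / jnorm l k)"

lemma jkernel_ge_1:
  assumes "\<And>k. k \<le> n \<Longrightarrow> jnorm l k > 0"
  shows "1 \<le> jkernel b l n z"
proof -
  have "(\<Sum>k\<in>{0}. (cmod (poly (jpoly b l k) z))\<^sup>2 / jnorm l k) \<le> jkernel b l n z"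
    unfolding jkernel_def by (rule sum_mono2) (use assms in \<open>auto intro!: divide_nonneg_pos\<close>)
  then show ?thesis by simp
qed

text \<open>The Christoffel-Darboux identity at \<open>z\<close> and its conjugate. It shows that all zeros are real,
and later it bounds the kernel from below.\<close>

lemma Christoffel_Darboux_Im:
  assumes "\<And>k. k \<le> n \<Longrightarrow> jnorm l k > 0"
  shows "Im (poly (jpoly b l (Suc n)) z * cnj (poly (jpoly b l n) z)) = Im z * jnorm l n * jkernel b l n z"
proof -
  have im: "2 * \<i> * of_real (Im w) = w - cnj w" for w
    by (simp add: complex_eq_iff)
  have "2 * \<i> * of_real (Im (poly (jpoly b l (Suc n)) z * cnj (poly (jpoly b l n) z)))
     = poly (jpoly b l (Suc n)) z * cnj (poly (jpoly b l n) z) - cnj (poly (jpoly b l (Suc n)) z * cnj (poly (jpoly b l n) z))"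
    by (rule im)
  also have "\<dots> = poly (jpoly b l (Suc n)) z * poly (jpoly b l n) (cnj z) - poly (jpoly b l n) z * poly (jpoly b l (Suc n)) (cnj z)"
    by (simp add: poly_jpoly_cnj mult.commute del: jpoly.simps)
  also have "\<dots> = (z - cnj z) * of_real (jnorm l n) *
      (\<Sum>k\<le>n. poly (jpoly b l k) z * poly (jpoly b l k) (cnj z) / of_real (jnorm l k))"
    using assms by (intro Christoffel_Darboux) (force)
  also have "(\<Sum>k\<le>n. poly (jpoly b l k) z * poly (jpoly b l k) (cnj z) / of_real (jnorm l k)) = of_real (jkernel b l n z)"
    unfolding jkernel_def poly_jpoly_cnj complex_norm_square[symmetric] by simp
  also have "(z - cnj z) * of_real (jnorm l n) * of_real (jkernel b l n z) = 2 * \<i> * of_real (Im z * jnorm l n * jkernel b l n z)"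
    by (simp add: im[symmetric])
  finally show ?thesis by (simp only: mult_cancel_left of_real_eq_iff) simp
qed

lemma jpoly_nonreal_nonzero:
  assumes "\<And>k. k < n \<Longrightarrow> jnorm l k > 0" "Im z \<noteq> 0"
  shows "poly (jpoly b l n) z \<noteq> 0"
proof (cases n)
  case (Suc m)
  have "Im z * jnorm l m * jkernel b l m z \<noteq> 0"
    using assms Suc jkernel_ge_1[of m l b z] by fastforce
  then show ?thesis using Christoffel_Darboux_Im[of m l b z] assms Suc by fastforce
qed simp

lemma rsquarefree_jpoly:
  assumes "\<And>k. k < n \<Longrightarrow> jnorm l k > 0"
  shows "rsquarefree (jpoly b l n :: complex poly)"
proof (cases n)
  case 0
  then show ?thesis by (simp add: rsquarefree_roots)
next
  case (Suc m)
  show ?thesis unfolding rsquarefree_roots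
  proof (intro allI notI, elim conjE)
    fix z :: complex
    assume z: "poly (jpoly b l n) z = 0" "poly (pderiv (jpoly b l n)) z = 0"
    then have "Im z = 0" using jpoly_nonreal_nonzero[of n l z b] assms by blast
    then obtain x where x: "z = of_real x" by (metis complex_is_Real_iff Reals_cases)
    have pos: "0 < jnorm l k" if "k \<le> m" for k using assms that Suc by auto
    have "of_real (jnorm l m) * (\<Sum>k\<le>m. (poly (jpoly b l k) z)\<^sup>2 / of_real (jnorm l k)) = 0"
      using confluent_Christoffel_Darboux[of m l b z] z Suc pos by fastforce
    then have "(\<Sum>k\<le>m. (poly (jpoly b l k) z)\<^sup>2 / of_real (jnorm l k)) = 0"
      using pos[of m] by auto
    also have "(\<Sum>k\<le>m. (poly (jpoly b l k) z)\<^sup>2 / of_real (jnorm l k)) = complex_of_real (jkernel b l m z)"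
      unfolding jkernel_def x poly_jpoly_of_real by simp
    finally show False using jkernel_ge_1[of m l b z] pos by auto
  qed
qed

text \<open>Zeros are real by the previous identity, and simple because the confluent identity expresses the
derivative at a zero by a positive sum; over the complex numbers there are then exactly \<open>n\<close> of them.\<close>

lemma jpoly_real_rooted:
  assumes "\<And>k. k < n \<Longrightarrow> jnorm l k > 0"
  obtains R where "finite R" "card R = n" "R = {x::real. poly (jpoly b l n) x = 0}"
    "\<And>z::complex. poly (jpoly b l n) z = (\<Prod>r\<in>R. z - of_real r)"
proof -
  define R where "R = {x::real. poly (jpoly b l n) x = 0}"
  have finR: "finite R" unfolding R_def by (rule poly_roots_finite) simp
  let ?C = "{z::complex. poly (jpoly b l n) z = 0}"
  have C: "?C = of_real ` R"
  proof (intro set_eqI iffI)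
    fix z assume z: "z \<in> ?C"
    then have "Im z = 0" using jpoly_nonreal_nonzero[of n l z b] assms by blast
    then obtain x where x: "z = of_real x" by (metis complex_is_Real_iff Reals_cases)
    with z show "z \<in> of_real ` R" by (auto simp: R_def poly_jpoly_of_real)
  qed (auto simp: R_def poly_jpoly_of_real)
  have eq: "jpoly b l n = (\<Prod>z\<in>?C. [:- z, 1:] :: complex poly)"
    using complex_poly_decompose_rsquarefree[OF rsquarefree_jpoly[of n l b]] assms
    by (simp add: degree_jpoly lead_coeff_jpoly)
  have "n = degree (\<Prod>z\<in>?C. [:- z, 1:] :: complex poly)"
    using arg_cong[OF eq, of degree] by (simp add: degree_jpoly)
  also have "\<dots> = card ?C" by (subst degree_prod_sum_eq) auto
  also have "\<dots> = card R" unfolding C by (rule card_image) (simp add: inj_on_def)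
  finally have "card R = n" by simp
  moreover have "poly (jpoly b l n) z = (\<Prod>r\<in>R. z - of_real r)" for z :: complex
    by (subst eq) (simp add: C poly_prod prod.reindex inj_on_def)
  ultimately show ?thesis using that finR R_def by blast
qed

section \<open>Measures of orthogonality and Gauss quadrature\<close>

text \<open>Vanishing of the means already forces orthogonality with squared norms \<^term>\<open>jnorm l n\<close>, see
\<open>jacobi_measure_orthogonal\<close>. In this form the condition is linear in the measure.\<close>

definition jacobi_measure :: "(nat \<Rightarrow> real) \<Rightarrow> (nat \<Rightarrow> real) \<Rightarrow> real measure \<Rightarrow> bool" where
  "jacobi_measure b l \<nu> \<longleftrightarrow> real_distribution \<nu> \<and> (\<forall>n. integrable \<nu> (\<lambda>y. y ^ n)) \<and>
     (\<forall>n>0. (\<integral>y. poly (jpoly b l n) y \<partial>\<nu>) = 0)"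

lemma integrable_poly:
  assumes "\<And>n. integrable \<nu> (\<lambda>y::real. y ^ n)"
  shows "integrable \<nu> (\<lambda>y. poly p y)"
  unfolding poly_altdef by (intro Bochner_Integration.integrable_sum integrable_mult_right assms)

lemma jacobi_measure_integrable:
  assumes "jacobi_measure b l \<nu>"
  shows "integrable \<nu> (\<lambda>y. poly p y)"
  using assms integrable_poly unfolding jacobi_measure_def by blast

text \<open>Both ways of moving a factor \<open>y\<close> across the product of two polynomials give the same integral,
which determines row \<open>m + 1\<close> of the Gram matrix from the rows \<open>m\<close> and \<open>m - 1\<close>.\<close>

lemma jacobi_measure_orthogonal:
  assumes \<nu>: "jacobi_measure b l \<nu>"
  shows "(\<integral>y. poly (jpoly b l m) y * poly (jpoly b l n) y \<partial>\<nu>) = (if m = n then jnorm l n else 0)"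
proof -
  interpret real_distribution \<nu> using \<nu> by (simp add: jacobi_measure_def)
  define E where "E p = (\<integral>y. poly p y \<partial>\<nu>)" for p
  have one: "poly (1 :: real poly) = (\<lambda>y. 1)" by (rule ext) simp
  have E_add: "E (p + r) = E p + E r" and E_diff: "E (p - r) = E p - E r" and E_smult: "E (smult c p) = c * E p" for p r c
    unfolding E_def poly_add poly_diff poly_smult by (simp_all add: jacobi_measure_integrable[OF \<nu>])
  let ?J = "jpoly b l :: nat \<Rightarrow> real poly"
  have E_0: "E 0 = 0" using E_smult[of 0 0] by simp
  have E_J: "E (?J n) = (if n = 0 then 1 else 0)" for n
  proof (cases "n = 0")
    case True
    then show ?thesis using prob_space by (simp add: E_def one del: jpoly.simps(2,3))
  next
    case False
    then show ?thesis using \<nu> unfolding E_def jacobi_measure_def by auto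
  qed
  have X: "[:0, 1:] * ?J n = ?J (Suc n) + smult (b n) (?J n) + (if n = 0 then 0 else smult (l n) (?J (n - 1)))" for n
    by (cases n) (simp_all add: algebra_simps)
  have X': "[:- c, 1:] * ?J n = ?J (Suc n) + smult (b n - c) (?J n) + (if n = 0 then 0 else smult (l n) (?J (n - 1)))" for n c
  proof -
    have "[:- c, 1:] * ?J n = [:0, 1:] * ?J n - smult c (?J n)" by simp
    then show ?thesis unfolding X by (simp add: smult_diff_left)
  qed
  have "\<forall>n. E (?J m * ?J n) = (if m = n then jnorm l n else 0)"
  proof (induction m rule: induct_nat_012)
    case 0
    then show ?case by (simp add: E_J)
  next
    case 1
    show ?case
    proof
      fix n
      have "E (?J (Suc 0) * ?J n) = E ([:- b 0, 1:] * ?J n)" by simp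
      also have "\<dots> = (if Suc 0 = n then jnorm l n else 0)"
        unfolding X' by (cases n) (auto simp: E_add E_smult E_J simp del: jpoly.simps(2,3))
      finally show "E (?J (Suc 0) * ?J n) = (if Suc 0 = n then jnorm l n else 0)" .
    qed
  next
    case (ge2 m)
    show ?case
    proof
      fix n
      have eq: "?J (Suc (Suc m)) * ?J n = ?J (Suc m) * ([:- b (Suc m), 1:] * ?J n) - smult (l (Suc m)) (?J m * ?J n)"
        by (simp add: algebra_simps)
      have "E (?J (Suc (Suc m)) * ?J n) = E (?J (Suc m) * ?J (Suc n)) + (b n - b (Suc m)) * E (?J (Suc m) * ?J n)
           + (if n = 0 then 0 else l n * E (?J (Suc m) * ?J (n - 1))) - l (Suc m) * E (?J m * ?J n)"
        unfolding eq X' ring_distribs by (auto simp: E_0 E_add E_smult E_diff algebra_simps simp del: jpoly.simps)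
      also have "\<dots> = (if Suc (Suc m) = n then jnorm l n else 0)"
        using ge2 by (cases n) (auto simp del: jpoly.simps)
      finally show "E (?J (Suc (Suc m)) * ?J n) = (if Suc (Suc m) = n then jnorm l n else 0)" .
    qed
  qed
  then show ?thesis by (simp add: E_def)
qed

lemma finite_support_distribution:
  fixes R :: "real set" and w :: "real \<Rightarrow> real"
  assumes "finite R" "\<And>r. r \<in> R \<Longrightarrow> 0 \<le> w r" "(\<Sum>r\<in>R. w r) = 1"
  obtains \<nu> where "real_distribution \<nu>"
    "\<And>f :: real \<Rightarrow> real. f \<in> borel_measurable borel \<Longrightarrow> integrable \<nu> f \<and> (\<integral>y. f y \<partial>\<nu>) = (\<Sum>r\<in>R. w r * f r)"
proof -
  let ?w = "\<lambda>r. if r \<in> R then w r else 0"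
  have "(\<integral>\<^sup>+ r. ennreal (?w r) \<partial>count_space UNIV) = (\<integral>\<^sup>+ r. ennreal (w r) * indicator R r \<partial>count_space UNIV)"
    by (intro nn_integral_cong) (auto simp: indicator_def)
  also have "\<dots> = (\<integral>\<^sup>+ r. ennreal (w r) \<partial>count_space R)"
    by (subst nn_integral_count_space_indicator) auto
  also have "\<dots> = 1"
    using assms by (simp add: nn_integral_count_space_finite)
  finally have nn: "(\<integral>\<^sup>+ r. ennreal (?w r) \<partial>count_space UNIV) = 1" .
  define p where "p = embed_pmf ?w"
  have pmf: "pmf p r = ?w r" for r
    unfolding p_def using assms nn by (subst pmf_embed_pmf) auto
  have sub: "set_pmf p \<subseteq> R" by (auto simp: set_pmf_eq pmf split: if_splits)
  define \<nu> where "\<nu> = distr (measure_pmf p) borel (\<lambda>x. x)"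
  have "real_distribution \<nu>"
    unfolding \<nu>_def real_distribution_def real_distribution_axioms_def
    by (simp add: prob_space.prob_space_distr measure_pmf.prob_space_axioms)
  moreover have "integrable \<nu> f \<and> (\<integral>y. f y \<partial>\<nu>) = (\<Sum>r\<in>R. w r * f r)"
    if "f \<in> borel_measurable borel" for f :: "real \<Rightarrow> real"
  proof -
    have "(\<integral>y. f y \<partial>measure_pmf p) = (\<Sum>r\<in>R. f r * pmf p r)"
      using assms sub by (intro integral_measure_pmf_real) auto
    moreover have "integrable (measure_pmf p) f"
      using assms sub finite_subset by (intro integrable_measure_pmf_finite) auto
    ultimately show ?thesis
      using that unfolding \<nu>_def by (simp add: integrable_distr_eq integral_distr pmf mult.commute)
  qed
  ultimately show ?thesis using that by blast
qed

text \<open>The nodes are the zeros of the \<open>N\<close>-th polynomial and the weights are the reciprocals of the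
diagonal Christoffel-Darboux kernel. By the Christoffel-Darboux identity the kernel vanishes at two different
nodes, so the kernel sum built from the weights interpolates the constant \<open>1\<close> at \<open>N\<close> points; having
degree below \<open>N\<close> it is constant, and its coefficients are the quadrature sums of the lower polynomials.\<close>

lemma Gauss_quadrature:
  assumes pos: "\<And>k. k < N \<Longrightarrow> jnorm l k > 0" and N: "N > 0"
  shows "\<exists>\<nu>. real_distribution \<nu> \<and>
    (\<forall>f :: real \<Rightarrow> real. f \<in> borel_measurable borel \<longrightarrow> integrable \<nu> f \<and>
      ((\<forall>y. poly (jpoly b l N) y = 0 \<longrightarrow> f y = 0) \<longrightarrow> (\<integral>y. f y \<partial>\<nu>) = 0)) \<and>
    (\<forall>k. 0 < k \<longrightarrow> k < N \<longrightarrow> (\<integral>y. poly (jpoly b l k) y \<partial>\<nu>) = 0)"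
proof -
  obtain m where m: "N = Suc m" using N by (cases N) auto
  obtain R where R: "finite R" "card R = N" "R = {x::real. poly (jpoly b l N) x = 0}"
    using jpoly_real_rooted[of N l b] pos by metis
  define w where "w r = 1 / (\<Sum>k\<le>m. (poly (jpoly b l k) r)\<^sup>2 / jnorm l k)" for r :: real
  have S: "(\<Sum>k\<le>m. (poly (jpoly b l k) r)\<^sup>2 / jnorm l k) = jkernel b l m (of_real r)" for r :: real
    unfolding jkernel_def poly_jpoly_of_real by simp
  have wpos: "0 < w r" for r
    unfolding w_def S using jkernel_ge_1[of m l b "of_real r"] pos m by auto
  have ortho: "(\<Sum>k\<le>m. poly (jpoly b l k) r * poly (jpoly b l k) s / jnorm l k) = 0"
    if "r \<in> R" "s \<in> R" "r \<noteq> s" for r s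
  proof -
    have "0 = (r - s) * jnorm l m * (\<Sum>k\<le>m. poly (jpoly b l k) r * poly (jpoly b l k) s / jnorm l k)"
      using Christoffel_Darboux[of m l b r s] that R(3) m pos by (simp del: jpoly.simps) (metis less_Suc_eq_le less_irrefl)
    then show ?thesis using that pos[of m] m by simp
  qed
  \<comment> \<open>Coefficients of the kernel sum minus the constant 1.\<close>
  define c where "c k = (\<Sum>r\<in>R. w r * poly (jpoly b l k) r) / jnorm l k - (if k = 0 then 1 else 0)" for k
  define F :: "real poly" where "F = (\<Sum>k<N. smult (c k) (jpoly b l k))"
  have "poly F s = 0" if s: "s \<in> R" for s
  proof -
    have "poly F s = (\<Sum>k\<le>m. (\<Sum>r\<in>R. w r * poly (jpoly b l k) r) / jnorm l k * poly (jpoly b l k) s) - (\<Sum>k\<le>m. if k = 0 then 1 else 0)"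
      unfolding F_def c_def m lessThan_Suc_atMost poly_sum sum_subtractf[symmetric]
      by (intro sum.cong) (auto simp: algebra_simps)
    also have "(\<Sum>k\<le>m. (\<Sum>r\<in>R. w r * poly (jpoly b l k) r) / jnorm l k * poly (jpoly b l k) s)
      = (\<Sum>r\<in>R. w r * (\<Sum>k\<le>m. poly (jpoly b l k) r * poly (jpoly b l k) s / jnorm l k))"
      unfolding sum_distrib_left sum_divide_distrib sum_distrib_right
      by (subst sum.swap) (simp add: algebra_simps)
    also have "\<dots> = (\<Sum>r\<in>R. if r = s then 1 else 0)"
    proof (intro sum.cong refl)
      fix r assume "r \<in> R"
      have "w s * (\<Sum>k\<le>m. poly (jpoly b l k) s * poly (jpoly b l k) s / jnorm l k) = 1"
        using wpos[of s] unfolding w_def by (simp add: power2_eq_square)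
      then show "w r * (\<Sum>k\<le>m. poly (jpoly b l k) r * poly (jpoly b l k) s / jnorm l k) = (if r = s then 1 else 0)"
        using ortho[OF \<open>r \<in> R\<close> s] by auto
    qed
    finally show ?thesis using R s by simp
  qed
  then have sub: "R \<subseteq> {x. poly F x = 0}" by auto
  have "F = 0"
  proof (rule ccontr)
    assume "F \<noteq> 0"
    then have "N \<le> degree F"
      using card_mono[OF poly_roots_finite sub] card_poly_roots_bound[of F] R by simp
    moreover have "degree F \<le> m"
      unfolding F_def m
      by (intro degree_sum_le) (auto intro!: order.trans[OF degree_smult_le] simp: degree_jpoly)
    ultimately show False using m by simp
  qed
  then have "c k = 0" if "k < N" for k
    using jpoly_coeffs_unique[where N = N and c = c and b = b and l = l and k = k] that unfolding F_def by auto
  then have c0: "c k = 0" if "k < N" for k using that by blast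
  have mom: "(\<Sum>r\<in>R. w r * poly (jpoly b l k) r) = (if k = 0 then 1 else 0)" if "k < N" for k
    using c0[OF that] pos[OF that] unfolding c_def by (cases "k = 0") auto
  from finite_support_distribution[of R w] obtain \<nu> where \<nu>: "real_distribution \<nu>"
    "\<And>f :: real \<Rightarrow> real. f \<in> borel_measurable borel \<Longrightarrow> integrable \<nu> f \<and> (\<integral>y. f y \<partial>\<nu>) = (\<Sum>r\<in>R. w r * f r)"
    using R(1) mom[OF N] wpos by (auto simp: less_imp_le)
  show ?thesis
  proof (intro exI[of _ \<nu>] conjI allI impI \<nu>(1))
    show "(\<integral>y. poly (jpoly b l k) y \<partial>\<nu>) = 0" if "0 < k" "k < N" for k
      using \<nu>(2)[of "poly (jpoly b l k)"] mom[OF that(2)] that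
      by (simp add: borel_measurable_continuous_onI continuous_on_poly)
    show "(\<integral>y. f y \<partial>\<nu>) = 0"
      if "f \<in> borel_measurable borel" "\<forall>y. poly (jpoly b l N) y = 0 \<longrightarrow> f y = 0" for f :: "real \<Rightarrow> real"
      using \<nu>(2)[OF that(1)] that(2) R(3) by (simp add: sum.neutral)
  qed (use \<nu>(2) in blast)
qed

section \<open>Convergence of moments\<close>

text \<open>Weak convergence controls only bounded functions. The moment of order \<open>2 k\<close>, uniformly bounded along
the sequence, makes the error of truncating the power of order \<open>k\<close> at height \<open>M\<close> at most of order \<open>1/M\<close>.\<close>

lemma weak_conv_moments:
  fixes \<nu> :: "nat \<Rightarrow> real measure" and m :: "nat \<Rightarrow> real"
  assumes rd: "\<And>n. real_distribution (\<nu> n)" and rd': "real_distribution \<nu>'"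
    and wc: "weak_conv_m \<nu> \<nu>'"
    and int: "\<And>n k. integrable (\<nu> n) (\<lambda>y. y ^ k)"
    and mom: "\<And>n k. k \<le> n \<Longrightarrow> (\<integral>y. y ^ k \<partial>\<nu> n) = m k"
  shows "integrable \<nu>' (\<lambda>y. y ^ k)" "(\<integral>y. y ^ k \<partial>\<nu>') = m k"
proof -
  interpret rd': real_distribution \<nu>' by fact
  have bdd: "(\<lambda>n. \<integral>y. f y \<partial>\<nu> n) \<longlonglongrightarrow> (\<integral>y. f y \<partial>\<nu>')"
    if "continuous_on UNIV f" "\<And>x. norm (f x) \<le> B" for f :: "real \<Rightarrow> real" and B
    using weak_conv_imp_integral_bdd_continuous_conv[OF rd rd' wc, of f B] that
    by (auto simp: continuous_on_eq_continuous_at)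
  have int_bdd: "integrable N f" if "real_distribution N" "continuous_on UNIV f" "\<And>x. norm (f x) \<le> B"
    for N and f :: "real \<Rightarrow> real" and B
  proof -
    interpret N: real_distribution N by fact
    have "f \<in> borel_measurable borel" using that by (intro borel_measurable_continuous_onI)
    then show ?thesis using that by (intro N.integrable_const_bound[of _ B]) auto
  qed
  have even_moments: "integrable \<nu>' (\<lambda>y. y ^ (2 * k)) \<and> (\<integral>y. y ^ (2 * k) \<partial>\<nu>') \<le> m (2 * k)" for k
  proof -
    \<comment> \<open>Even powers truncated from above: their integrals stay below the limit moment.\<close>
    define f where "f i y = min (real i) (y ^ (2 * k))" for i :: nat and y :: real
    have fc: "continuous_on UNIV (f i)" for i unfolding f_def by (intro continuous_intros)
    have f0: "0 \<le> f i y" for i y unfolding f_def by (auto simp: zero_le_even_power)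
    have fB: "norm (f i y) \<le> real i" for i y using f0[of i y] by (auto simp: f_def)
    have le: "(\<integral>y. f i y \<partial>\<nu>') \<le> m (2 * k)" for i
    proof (rule LIMSEQ_le_const2[OF bdd[OF fc fB]])
      show "\<exists>N. \<forall>n\<ge>N. (\<integral>y. f i y \<partial>\<nu> n) \<le> m (2 * k)"
      proof (intro exI allI impI)
        fix n assume n: "n \<ge> 2 * k"
        have "(\<integral>y. f i y \<partial>\<nu> n) \<le> (\<integral>y. y ^ (2 * k) \<partial>\<nu> n)"
          by (intro integral_mono int int_bdd[OF rd fc fB]) (auto simp: f_def)
        then show "(\<integral>y. f i y \<partial>\<nu> n) \<le> m (2 * k)" using mom[OF n] by simp
      qed
    qed
    have mono: "mono (\<lambda>i. \<integral>y. f i y \<partial>\<nu>')"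
      by (intro monoI integral_mono int_bdd[OF rd' fc fB]) (auto simp: f_def)
    then obtain L where L: "(\<lambda>i. \<integral>y. f i y \<partial>\<nu>') \<longlonglongrightarrow> L"
      using incseq_convergent[of "\<lambda>i. \<integral>y. f i y \<partial>\<nu>'" "m (2 * k)"] le by blast
    have lim: "(\<lambda>i. f i y) \<longlonglongrightarrow> y ^ (2 * k)" for y
    proof (rule tendsto_eventually)
      obtain N where "y ^ (2 * k) \<le> real N" using real_arch_simple by blast
      then show "\<forall>\<^sub>F i in sequentially. f i y = y ^ (2 * k)"
        unfolding f_def eventually_sequentially
        by (intro exI[of _ N]) (auto simp: min_def)
    qed
    have inc: "AE y in \<nu>'. mono (\<lambda>i. f i y)" by (auto simp: mono_def f_def)
    have lim': "AE y in \<nu>'. (\<lambda>i. f i y) \<longlonglongrightarrow> y ^ (2 * k)" using lim by simp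
    have "integrable \<nu>' (\<lambda>y. y ^ (2 * k))"
      by (rule integrable_monotone_convergence[OF int_bdd[OF rd' fc fB] inc lim' L]) simp
    moreover have "(\<integral>y. y ^ (2 * k) \<partial>\<nu>') = L"
      by (rule integral_monotone_convergence[OF int_bdd[OF rd' fc fB] inc lim' L]) simp
    moreover have "L \<le> m (2 * k)" using LIMSEQ_le_const2[OF L] le by blast
    ultimately show ?thesis by simp
  qed
  show intk: "integrable \<nu>' (\<lambda>y. y ^ k)" for k
  proof (rule Bochner_Integration.integrable_bound)
    show "integrable \<nu>' (\<lambda>y. 1 + y ^ (2 * k))" using even_moments by simp
    have "\<bar>y ^ k\<bar> \<le> 1 + y ^ (2 * k)" for y :: real
    proof -
      have "0 \<le> (\<bar>y ^ k\<bar> - 1)\<^sup>2 + \<bar>y ^ k\<bar>" by simp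
      then have "\<bar>y ^ k\<bar> \<le> 1 + \<bar>y ^ k\<bar>\<^sup>2" by (simp add: power2_eq_square algebra_simps)
      then show ?thesis by (simp add: power_mult[symmetric] mult.commute)
    qed
    then show "AE y in \<nu>'. norm (y ^ k) \<le> norm (1 + y ^ (2 * k))"
      by (auto simp: zero_le_even_power intro!: AE_I2 order.trans[OF _ abs_ge_self])
  qed simp
  show "(\<integral>y. y ^ k \<partial>\<nu>') = m k"
  proof -
    \<comment> \<open>Beyond the height M the truncation error of the power of order k is at most its square divided by M.\<close>
    define g where "g M y = max (- M) (min M (y ^ k))" for M y :: real
    have gc: "continuous_on UNIV (g M)" for M unfolding g_def by (intro continuous_intros)
    have gB: "norm (g M y) \<le> \<bar>M\<bar>" for M y by (auto simp: g_def)
    have gd: "\<bar>y ^ k - g M y\<bar> \<le> y ^ (2 * k) / M" if "M > 0" for M y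
    proof (cases "\<bar>y ^ k\<bar> \<le> M")
      case True
      then show ?thesis using that by (auto simp: g_def zero_le_even_power)
    next
      case False
      have "\<bar>y ^ k - g M y\<bar> \<le> \<bar>y ^ k\<bar>" using that False by (auto simp: g_def)
      also have "\<dots> = \<bar>y ^ k\<bar> * 1" by simp
      also have "\<dots> \<le> \<bar>y ^ k\<bar> * (\<bar>y ^ k\<bar> / M)"
        by (rule mult_left_mono) (use that False in auto)
      also have "\<dots> = y ^ (2 * k) / M" by (simp add: power_mult power2_eq_square mult.commute[of 2 k])
      finally show ?thesis .
    qed
    have diff: "\<bar>(\<integral>y. y ^ k \<partial>N) - (\<integral>y. g M y \<partial>N)\<bar> \<le> (\<integral>y. y ^ (2 * k) \<partial>N) / M"
      if "M > 0" "real_distribution N" "\<And>k. integrable N (\<lambda>y. y ^ k)" for M N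
    proof -
      have ig: "integrable N (g M)" by (rule int_bdd[OF that(2) gc gB])
      have "\<bar>(\<integral>y. y ^ k \<partial>N) - (\<integral>y. g M y \<partial>N)\<bar> = \<bar>\<integral>y. y ^ k - g M y \<partial>N\<bar>"
        using ig that(3) by simp
      also have "\<dots> \<le> (\<integral>y. \<bar>y ^ k - g M y\<bar> \<partial>N)" by (rule integral_abs_bound)
      also have "\<dots> \<le> (\<integral>y. y ^ (2 * k) / M \<partial>N)"
        by (intro integral_mono integrable_abs Bochner_Integration.integrable_diff ig that(3) gd that(1))
          (use that(3)[of "2 * k"] in auto)
      finally show ?thesis by simp
    qed
    have bound: "\<bar>(\<integral>y. y ^ k \<partial>\<nu>') - m k\<bar> \<le> 2 * m (2 * k) / M" if M: "M > 0" for M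
    proof -
      have "(\<lambda>n. \<bar>(\<integral>y. g M y \<partial>\<nu> n) - m k\<bar>) \<longlonglongrightarrow> \<bar>(\<integral>y. g M y \<partial>\<nu>') - m k\<bar>"
        by (intro tendsto_intros bdd[OF gc gB])
      then have "\<bar>(\<integral>y. g M y \<partial>\<nu>') - m k\<bar> \<le> m (2 * k) / M"
      proof (rule LIMSEQ_le_const2, intro exI[of _ "2 * k"] allI impI)
        fix n assume n: "2 * k \<le> n"
        then show "\<bar>(\<integral>y. g M y \<partial>\<nu> n) - m k\<bar> \<le> m (2 * k) / M"
          using diff[OF M rd int, of n] mom[of k n] mom[OF n] by (simp add: abs_minus_commute)
      qed
      moreover have "(\<integral>y. y ^ (2 * k) \<partial>\<nu>') / M \<le> m (2 * k) / M"
        using even_moments[of k] M by (simp add: divide_right_mono)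
      ultimately show ?thesis using diff[OF M rd' intk] by (simp add: field_simps)
    qed
    show ?thesis
    proof (rule ccontr)
      assume "(\<integral>y. y ^ k \<partial>\<nu>') \<noteq> m k"
      then have d: "0 < \<bar>(\<integral>y. y ^ k \<partial>\<nu>') - m k\<bar>" (is "0 < ?d") by simp
      have m0: "0 \<le> m (2 * k)"
        unfolding mom[of "2 * k" "2 * k", symmetric, OF order.refl]
        by (rule Bochner_Integration.integral_nonneg) (simp add: zero_le_even_power)
      \<comment> \<open>M chosen so that the bound becomes less than the assumed distance.\<close>
      have "?d \<le> 2 * m (2 * k) / ((2 * m (2 * k) + 1) / ?d)"
        using d m0 by (intro bound) (auto intro!: divide_pos_pos)
      then have "?d * (2 * m (2 * k) + 1) \<le> 2 * m (2 * k) * ?d"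
        using d m0 by (simp add: field_simps)
      then show False using d by (simp add: algebra_simps)
    qed
  qed
qed

text \<open>The second moments give tightness by Chebyshev's inequality; Helly's theorem then yields the limit.
The index is shifted by two so that the second moment is fixed along the whole sequence.\<close>

lemma moment_compactness:
  fixes \<nu> :: "nat \<Rightarrow> real measure" and m :: "nat \<Rightarrow> real"
  assumes rd: "\<And>n. real_distribution (\<nu> n)"
    and int: "\<And>n k. integrable (\<nu> n) (\<lambda>y. y ^ k)"
    and mom: "\<And>n k. k \<le> n \<Longrightarrow> (\<integral>y. y ^ k \<partial>\<nu> n) = m k"
  obtains r \<nu>' where "strict_mono (r :: nat \<Rightarrow> nat)" "real_distribution \<nu>'" "weak_conv_m (\<nu> \<circ> r) \<nu>'"
    "\<And>k. integrable \<nu>' (\<lambda>y. y ^ k)" "\<And>k. (\<integral>y. y ^ k \<partial>\<nu>') = m k"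
proof -
  have tight: "tight (\<lambda>n. \<nu> (n + 2))"
    unfolding tight_def
  proof (intro conjI allI impI)
    fix \<epsilon> :: real assume \<epsilon>: "0 < \<epsilon>"
    have m0: "0 \<le> m 2" unfolding mom[of 2 2, symmetric, OF order.refl]
      by (rule Bochner_Integration.integral_nonneg) simp
    define a where "a = sqrt (m 2 / \<epsilon> + 1)"
    have a2: "a\<^sup>2 = m 2 / \<epsilon> + 1" and a: "0 < a"
      using m0 \<epsilon> by (auto simp: a_def intro!: add_nonneg_pos)
    have "1 - \<epsilon> < measure (\<nu> n) {- a<..a}" if n: "2 \<le> n" for n
    proof -
      interpret real_distribution "\<nu> n" by (rule rd)
      have "prob (UNIV - {- a<..a}) = (\<integral>y. indicator (UNIV - {- a<..a}) y \<partial>\<nu> n)"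
        by simp
      also have "\<dots> \<le> (\<integral>y. y ^ 2 / a\<^sup>2 \<partial>\<nu> n)"
      proof (intro integral_mono)
        fix y :: real
        have "a\<^sup>2 \<le> y\<^sup>2" if "y \<notin> {- a<..a}"
          using that a by (intro abs_le_square_iff[THEN iffD1]) auto
        then show "indicator (UNIV - {- a<..a}) y \<le> y ^ 2 / a\<^sup>2"
          using a by (auto simp: indicator_def divide_simps)
      qed (use int[of n 2] in \<open>auto intro!: integrable_const_bound[of _ 1]\<close>)
      also have "\<dots> = m 2 / a\<^sup>2" using mom[OF n] by simp
      also have "\<dots> < \<epsilon>" unfolding a2 using m0 \<epsilon> by (simp add: field_simps add_nonneg_pos)
      finally show ?thesis using prob_compl[of "{- a<..a}"] by simp
    qed
    then show "\<exists>a b. a < b \<and> (\<forall>n. 1 - \<epsilon> < measure (\<nu> (n + 2)) {a<..b})"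
      using a by (intro exI[of _ "- a"] exI[of _ a]) auto
  qed (rule rd)
  obtain r' \<nu>' where r': "strict_mono r'" "real_distribution \<nu>'" "weak_conv_m ((\<lambda>n. \<nu> (n + 2)) \<circ> id \<circ> r') \<nu>'"
    using tight_imp_convergent_subsubsequence[OF tight strict_mono_id] by blast
  define r where "r n = r' n + 2" for n
  have r: "strict_mono r" using r'(1) by (auto simp: strict_mono_def r_def)
  have wc: "weak_conv_m (\<nu> \<circ> r) \<nu>'" using r'(3) by (simp add: r_def comp_def)
  have "k \<le> n \<Longrightarrow> (\<integral>y. y ^ k \<partial>(\<nu> \<circ> r) n) = m k" for k n
    using mom[of k "r n"] seq_suble[OF r, of n] by simp
  note lim = weak_conv_moments[of "\<nu> \<circ> r" \<nu>' m, OF _ r'(2) wc _ this]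
  show ?thesis
    by (rule that[OF r r'(2) wc]) (use lim rd int in auto)
qed

section \<open>Existence of a measure of orthogonality\<close>

lemma jpoly_expansion:
  fixes p :: "'a::real_normed_field poly"
  assumes "degree p \<le> n"
  shows "\<exists>c. p = (\<Sum>j\<le>n. smult (c j) (jpoly b l j))"
  using assms
proof (induction n arbitrary: p)
  case 0
  then obtain a where "p = [:a:]" by (auto elim: degree_eq_zeroE)
  then show ?case by (intro exI[of _ "\<lambda>_. a"]) simp
next
  case (Suc n)
  let ?q = "p - smult (coeff p (Suc n)) (jpoly b l (Suc n))"
  have "degree ?q \<le> n"
  proof (rule degree_le, intro allI impI)
    fix i assume "n < i"
    then consider "i = Suc n" | "Suc n < i" by linarith
    then show "coeff ?q i = 0"
      using Suc.prems by cases (simp_all add: lead_coeff_jpoly coeff_eq_0 degree_jpoly del: jpoly.simps)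
  qed
  from Suc.IH[OF this] obtain c where c: "?q = (\<Sum>j\<le>n. smult (c j) (jpoly b l j))" by blast
  show ?case
  proof (intro exI)
    have "p = ?q + smult (coeff p (Suc n)) (jpoly b l (Suc n))" by simp
    also have "\<dots> = (\<Sum>j\<le>Suc n. smult ((c(Suc n := coeff p (Suc n))) j) (jpoly b l j))"
      unfolding c by (simp del: jpoly.simps)
    finally show "p = (\<Sum>j\<le>Suc n. smult ((c(Suc n := coeff p (Suc n))) j) (jpoly b l j))" .
  qed
qed

lemma integral_jpoly_expansion:
  assumes "real_distribution \<nu>" "\<And>k. integrable \<nu> (\<lambda>y::real. y ^ k)"
    and "\<And>k. 0 < k \<Longrightarrow> k \<le> n \<Longrightarrow> (\<integral>y. poly (jpoly b l k) y \<partial>\<nu>) = 0"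
  shows "(\<integral>y. poly (\<Sum>j\<le>n. smult (c j) (jpoly b l j)) y \<partial>\<nu>) = c 0"
proof -
  interpret real_distribution \<nu> by fact
  have "(\<integral>y. poly (\<Sum>j\<le>n. smult (c j) (jpoly b l j)) y \<partial>\<nu>) = (\<Sum>j\<le>n. c j * (\<integral>y. poly (jpoly b l j) y \<partial>\<nu>))"
    unfolding poly_sum poly_smult
    by (subst Bochner_Integration.integral_sum) (auto intro!: integrable_mult_right integrable_poly assms(2))
  also have "\<dots> = (\<Sum>j\<le>n. if j = 0 then c 0 else 0)"
    using assms(3) prob_space by (intro sum.cong refl) (auto simp del: jpoly.simps(2,3))
  finally show ?thesis by simp
qed

lemma jacobi_measure_moments_unique:
  assumes "jacobi_measure b l \<nu>1" "jacobi_measure b l \<nu>2"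
  shows "(\<integral>y. poly p y \<partial>\<nu>1) = (\<integral>y. poly p y \<partial>\<nu>2)"
proof -
  obtain c where c: "p = (\<Sum>j\<le>degree p. smult (c j) (jpoly b l j))"
    using jpoly_expansion by blast
  have "(\<integral>y. poly p y \<partial>\<nu>) = c 0" if "jacobi_measure b l \<nu>" for \<nu>
    using that by (subst c, intro integral_jpoly_expansion) (auto simp: jacobi_measure_def)
  then show ?thesis using assms by simp
qed

text \<open>A vanishing recurrence coefficient cuts the recurrence: all later polynomials are multiples of
\<^term>\<open>jpoly b l n\<close>. Hence Gauss quadrature at level \<open>n\<close> is then exact for every polynomial.\<close>

lemma jpoly_common_root:
  assumes "l n = 0" "poly (jpoly b l n) y = 0" "0 < n" "n \<le> k"
  shows "poly (jpoly b l k) y = 0"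
proof -
  have "poly (jpoly b l (n + j)) y = 0 \<and> poly (jpoly b l (Suc (n + j))) y = 0" for j
  proof (induction j)
    case 0
    obtain m where "n = Suc m" using assms(3) by (cases n) auto
    then show ?case using assms(1,2) poly_jpoly_Suc_Suc[of b l m y] by (simp del: jpoly.simps)
  next
    case (Suc j)
    then show ?case using poly_jpoly_Suc_Suc[of b l "n + j" y] by (simp del: jpoly.simps)
  qed
  then show ?thesis using assms(4) le_Suc_ex by blast
qed

text \<open>If some squared norm vanishes, the first such level carries an exact quadrature; otherwise the
measure is a weak limit of quadratures. In both cases it integrates to zero every bounded continuous function that
vanishes at all the nodes, which localises its support.\<close>

theorem Favard:
  assumes nonneg: "\<And>n. 0 \<le> jnorm l n"
  obtains \<nu> where "jacobi_measure b l \<nu>"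
    "\<And>f B. continuous_on UNIV f \<Longrightarrow> (\<And>y. \<bar>f y\<bar> \<le> B) \<Longrightarrow>
       (\<And>n y. 0 < n \<Longrightarrow> (\<And>k. k < n \<Longrightarrow> 0 < jnorm l k) \<Longrightarrow> poly (jpoly b l n) y = 0 \<Longrightarrow> f y = 0) \<Longrightarrow>
       (\<integral>y. f y \<partial>\<nu>) = (0::real)"
proof (cases "\<exists>N. jnorm l N = 0")
  case True
  define N where "N = (LEAST N. jnorm l N = 0)"
  have N: "jnorm l N = 0" unfolding N_def by (rule LeastI_ex[OF True])
  have pos: "0 < jnorm l k" if "k < N" for k
    using not_less_Least[of k "\<lambda>N. jnorm l N = 0"] that nonneg[of k] unfolding N_def by fastforce
  have N0: "0 < N" using N by (cases N) auto
  have lN: "l N = 0"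
  proof -
    obtain m where m: "N = Suc m" using N0 by (cases N) auto
    then show ?thesis using N pos[of m] by simp
  qed
  obtain \<nu> where \<nu>: "real_distribution \<nu>"
    and int: "\<And>f :: real \<Rightarrow> real. f \<in> borel_measurable borel \<Longrightarrow> integrable \<nu> f"
    and vanish: "\<And>f :: real \<Rightarrow> real. f \<in> borel_measurable borel \<Longrightarrow> (\<And>y. poly (jpoly b l N) y = 0 \<Longrightarrow> f y = 0) \<Longrightarrow> (\<integral>y. f y \<partial>\<nu>) = 0"
    and mean: "\<And>k. 0 < k \<Longrightarrow> k < N \<Longrightarrow> (\<integral>y. poly (jpoly b l k) y \<partial>\<nu>) = 0"
    using Gauss_quadrature[of N l b, OF pos N0] by blast
  have "(\<integral>y. poly (jpoly b l k) y \<partial>\<nu>) = 0" if "0 < k" for k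
  proof (cases "k < N")
    case False
    then show ?thesis
      using jpoly_common_root[of l N b _ k] lN N0
      by (intro vanish) (auto intro!: borel_measurable_continuous_onI continuous_on_poly)
  qed (use mean that in blast)
  moreover have "integrable \<nu> (\<lambda>y. y ^ k)" for k by (rule int) measurable
  ultimately have "jacobi_measure b l \<nu>" unfolding jacobi_measure_def using \<nu> by blast
  then show ?thesis
  proof (rule that)
    fix f :: "real \<Rightarrow> real" and B
    assume "continuous_on UNIV f" and "\<And>n y. 0 < n \<Longrightarrow> (\<And>k. k < n \<Longrightarrow> 0 < jnorm l k) \<Longrightarrow> poly (jpoly b l n) y = 0 \<Longrightarrow> f y = 0"
    then show "(\<integral>y. f y \<partial>\<nu>) = 0"
      using N0 pos by (intro vanish borel_measurable_continuous_onI) blast+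
  qed
next
  case False
  then have pos: "0 < jnorm l k" for k using nonneg[of k] by (metis less_eq_real_def)
  have "\<exists>\<nu>. real_distribution \<nu> \<and>
    (\<forall>f :: real \<Rightarrow> real. f \<in> borel_measurable borel \<longrightarrow> integrable \<nu> f \<and>
      ((\<forall>y. poly (jpoly b l (Suc n)) y = 0 \<longrightarrow> f y = 0) \<longrightarrow> (\<integral>y. f y \<partial>\<nu>) = 0)) \<and>
    (\<forall>k. 0 < k \<longrightarrow> k < Suc n \<longrightarrow> (\<integral>y. poly (jpoly b l k) y \<partial>\<nu>) = 0)" for n
    by (rule Gauss_quadrature) (simp_all add: pos)
  from choice[OF allI[OF this]] obtain G where G': "\<forall>n. real_distribution (G n) \<and>
    (\<forall>f :: real \<Rightarrow> real. f \<in> borel_measurable borel \<longrightarrow> integrable (G n) f \<and>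
      ((\<forall>y. poly (jpoly b l (Suc n)) y = 0 \<longrightarrow> f y = 0) \<longrightarrow> (\<integral>y. f y \<partial>G n) = 0)) \<and>
    (\<forall>k. 0 < k \<longrightarrow> k < Suc n \<longrightarrow> (\<integral>y. poly (jpoly b l k) y \<partial>G n) = 0)" ..
  have G: "real_distribution (G n)"
    "(f :: real \<Rightarrow> real) \<in> borel_measurable borel \<Longrightarrow> integrable (G n) f"
    "(f :: real \<Rightarrow> real) \<in> borel_measurable borel \<Longrightarrow> (\<And>y. poly (jpoly b l (Suc n)) y = 0 \<Longrightarrow> f y = 0) \<Longrightarrow> (\<integral>y. f y \<partial>G n) = 0"
    "0 < k \<Longrightarrow> k < Suc n \<Longrightarrow> (\<integral>y. poly (jpoly b l k) y \<partial>G n) = 0" for n f k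
    using G'[rule_format, of n] by blast+
  have powm: "(\<lambda>y::real. y ^ k) \<in> borel_measurable borel" for k by measurable
  have "\<exists>c. monom 1 k = (\<Sum>j\<le>k. smult (c j) (jpoly b l j :: real poly))" for k
    by (intro jpoly_expansion degree_monom_le)
  then obtain c where c: "\<And>k. monom 1 k = (\<Sum>j\<le>k. smult (c k j) (jpoly b l j :: real poly))" by metis
  have mom: "(\<integral>y. y ^ k \<partial>G n) = c k 0" if "k \<le> n" for n k
  proof -
    have "(\<integral>y. y ^ k \<partial>G n) = (\<integral>y. poly (monom 1 k) y \<partial>G n)" by (simp add: poly_monom)
    also have "\<dots> = c k 0"
      unfolding c by (intro integral_jpoly_expansion G(1,4) G(2)[OF powm]) (use that in auto)
    finally show ?thesis .
  qed
  obtain r \<nu> where r: "strict_mono r" "real_distribution \<nu>" "weak_conv_m (G \<circ> r) \<nu>"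
    and int: "\<And>k. integrable \<nu> (\<lambda>y. y ^ k)" and m: "\<And>k. (\<integral>y. y ^ k \<partial>\<nu>) = c k 0"
    using moment_compactness[of G "\<lambda>k. c k 0", OF G(1) G(2)[OF powm] mom] by blast
  have "(\<integral>y. poly (jpoly b l k) y \<partial>\<nu>) = 0" if "0 < k" for k
  proof -
    have "(\<integral>y. poly (jpoly b l k) y \<partial>\<nu>) = (\<Sum>i\<le>k. coeff (jpoly b l k) i * c i 0)"
      unfolding poly_altdef degree_jpoly using int m by simp
    also have "\<dots> = (\<Sum>i\<le>k. coeff (jpoly b l k) i * (\<integral>y. y ^ i \<partial>G k))"
      by (intro sum.cong) (simp_all add: mom)
    also have "\<dots> = (\<integral>y. poly (jpoly b l k) y \<partial>G k)"
      unfolding poly_altdef degree_jpoly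
      using G(2)[OF powm] by simp
    also have "\<dots> = 0" using G(4) that by blast
    finally show ?thesis .
  qed
  then have "jacobi_measure b l \<nu>" unfolding jacobi_measure_def using r int by auto
  then show ?thesis
  proof (rule that)
    fix f :: "real \<Rightarrow> real" and B
    assume f: "continuous_on UNIV f" "\<And>y. \<bar>f y\<bar> \<le> B"
      and z: "\<And>n y. 0 < n \<Longrightarrow> (\<And>k. k < n \<Longrightarrow> 0 < jnorm l k) \<Longrightarrow> poly (jpoly b l n) y = 0 \<Longrightarrow> f y = 0"
    have "(\<lambda>n. \<integral>y. f y \<partial>(G \<circ> r) n) \<longlonglongrightarrow> (\<integral>y. f y \<partial>\<nu>)"
      using weak_conv_imp_integral_bdd_continuous_conv[OF _ r(2,3), of f B] f G(1)
      by (auto simp: continuous_on_eq_continuous_at)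
    moreover have "(\<integral>y. f y \<partial>(G \<circ> r) n) = 0" for n
      unfolding comp_def using z pos f(1) by (intro G(3) borel_measurable_continuous_onI) (auto simp del: jpoly.simps)
    ultimately show "(\<integral>y. f y \<partial>\<nu>) = 0" by (simp add: LIMSEQ_const_iff)
  qed
qed

section \<open>Quadratic mean closure of the polynomials\<close>

text \<open>One polynomial has to approximate for all measures of the class at once, because the aim is to
compare two measures with the same moments.\<close>

definition polynomial_L2_limit :: "real measure set \<Rightarrow> (real \<Rightarrow> real) \<Rightarrow> bool" where
  "polynomial_L2_limit \<M> F \<longleftrightarrow> F \<in> borel_measurable borel \<and> (\<forall>\<nu>\<in>\<M>. integrable \<nu> (\<lambda>y. (F y)\<^sup>2)) \<and>
     (\<forall>e>0. \<exists>p. \<forall>\<nu>\<in>\<M>. (\<integral>y. (F y - poly p y)\<^sup>2 \<partial>\<nu>) < e)"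

locale moment_class =
  fixes \<M> :: "real measure set"
  assumes distribution: "\<nu> \<in> \<M> \<Longrightarrow> real_distribution \<nu>"
    and moments: "\<nu> \<in> \<M> \<Longrightarrow> integrable \<nu> (\<lambda>y. y ^ n)"
begin

lemma measurable_class: "\<nu> \<in> \<M> \<Longrightarrow> F \<in> borel_measurable borel \<Longrightarrow> F \<in> borel_measurable \<nu>"
  using distribution real_distribution.measurable_finite_borel by blast

lemma poly_borel: "poly p \<in> borel_measurable (borel :: real measure)"
  by (intro borel_measurable_continuous_onI continuous_on_poly continuous_on_id)

lemma poly_integrable: "\<nu> \<in> \<M> \<Longrightarrow> integrable \<nu> (poly p)"
  using integrable_poly[of \<nu> p] moments by simp

lemma poly_sq_integrable: "\<nu> \<in> \<M> \<Longrightarrow> integrable \<nu> (\<lambda>y. (poly p y)\<^sup>2)"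
proof -
  assume "\<nu> \<in> \<M>"
  moreover have "poly (p\<^sup>2) = (\<lambda>y. (poly p y)\<^sup>2)" by (rule ext) (simp add: poly_power)
  ultimately show ?thesis using poly_integrable[of \<nu> "p\<^sup>2"] by simp
qed

lemma sq_add_le: "(a + b :: real)\<^sup>2 \<le> 2 * a\<^sup>2 + 2 * b\<^sup>2"
  using zero_le_power2[of "a - b"] by (simp add: power2_eq_square algebra_simps)

lemma sq_integrable_add:
  fixes F G :: "real \<Rightarrow> real"
  assumes "\<nu> \<in> \<M>" "F \<in> borel_measurable borel" "G \<in> borel_measurable borel"
    "integrable \<nu> (\<lambda>y. (F y)\<^sup>2)" "integrable \<nu> (\<lambda>y. (G y)\<^sup>2)"
  shows "integrable \<nu> (\<lambda>y. (F y + G y)\<^sup>2)"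
    "(\<integral>y. (F y + G y)\<^sup>2 \<partial>\<nu>) \<le> 2 * (\<integral>y. (F y)\<^sup>2 \<partial>\<nu>) + 2 * (\<integral>y. (G y)\<^sup>2 \<partial>\<nu>)"
proof -
  note [measurable] = assms(2,3)
  have m: "(\<lambda>y. (F y + G y)\<^sup>2) \<in> borel_measurable \<nu>"
    by (intro measurable_class[OF assms(1)]) measurable
  show i: "integrable \<nu> (\<lambda>y. (F y + G y)\<^sup>2)"
    by (rule Bochner_Integration.integrable_bound[of _ "\<lambda>y. 2 * (F y)\<^sup>2 + 2 * (G y)\<^sup>2"])
      (use assms m sq_add_le in auto)
  have "(\<integral>y. (F y + G y)\<^sup>2 \<partial>\<nu>) \<le> (\<integral>y. 2 * (F y)\<^sup>2 + 2 * (G y)\<^sup>2 \<partial>\<nu>)"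
    by (intro integral_mono i sq_add_le) (use assms in auto)
  then show "(\<integral>y. (F y + G y)\<^sup>2 \<partial>\<nu>) \<le> 2 * (\<integral>y. (F y)\<^sup>2 \<partial>\<nu>) + 2 * (\<integral>y. (G y)\<^sup>2 \<partial>\<nu>)"
    using assms by simp
qed

lemma sq_integrable_diff_poly:
  assumes "polynomial_L2_limit \<M> F" "\<nu> \<in> \<M>"
  shows "integrable \<nu> (\<lambda>y. (F y - poly p y)\<^sup>2)"
  using sq_integrable_add(1)[OF assms(2), of F "poly (- p)"] assms poly_borel poly_sq_integrable[OF assms(2), of p]
  unfolding polynomial_L2_limit_def by simp

lemma limitD:
  "polynomial_L2_limit \<M> F \<Longrightarrow> e > 0 \<Longrightarrow> \<exists>p. \<forall>\<nu>\<in>\<M>. (\<integral>y. (F y - poly p y)\<^sup>2 \<partial>\<nu>) < e"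
  by (simp add: polynomial_L2_limit_def)

lemma limit_poly: "polynomial_L2_limit \<M> (poly p)"
  unfolding polynomial_L2_limit_def using poly_borel poly_sq_integrable by (auto intro!: exI[of _ p])

lemma limit_closed:
  assumes F: "F \<in> borel_measurable borel" "\<And>\<nu>. \<nu> \<in> \<M> \<Longrightarrow> integrable \<nu> (\<lambda>y. (F y)\<^sup>2)"
    and G: "\<And>e. e > 0 \<Longrightarrow> \<exists>G. polynomial_L2_limit \<M> G \<and> (\<forall>\<nu>\<in>\<M>. (\<integral>y. (F y - G y)\<^sup>2 \<partial>\<nu>) < e)"
  shows "polynomial_L2_limit \<M> F"
  unfolding polynomial_L2_limit_def
proof (intro conjI ballI allI impI F)
  fix e :: real assume "e > 0"
  then obtain G where G: "polynomial_L2_limit \<M> G" "\<And>\<nu>. \<nu> \<in> \<M> \<Longrightarrow> (\<integral>y. (F y - G y)\<^sup>2 \<partial>\<nu>) < e / 4"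
    using G[of "e / 4"] by auto
  then obtain p where p: "\<And>\<nu>. \<nu> \<in> \<M> \<Longrightarrow> (\<integral>y. (G y - poly p y)\<^sup>2 \<partial>\<nu>) < e / 4"
    using limitD[OF G(1), of "e / 4"] \<open>e > 0\<close> by auto
  show "\<exists>p. \<forall>\<nu>\<in>\<M>. (\<integral>y. (F y - poly p y)\<^sup>2 \<partial>\<nu>) < e"
  proof (intro exI ballI)
    fix \<nu> assume \<nu>: "\<nu> \<in> \<M>"
    have Gm: "G \<in> borel_measurable borel" "integrable \<nu> (\<lambda>y. (G y)\<^sup>2)"
      using G(1) \<nu> by (auto simp: polynomial_L2_limit_def)
    have "integrable \<nu> (\<lambda>y. (F y - G y)\<^sup>2)"
      using sq_integrable_add(1)[OF \<nu> F(1) _ F(2)[OF \<nu>], of "\<lambda>y. - G y"] Gm by simp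
    from sq_integrable_add(2)[OF \<nu> _ _ this sq_integrable_diff_poly[OF G(1) \<nu>, of p]]
    have "(\<integral>y. (F y - poly p y)\<^sup>2 \<partial>\<nu>) \<le> 2 * (\<integral>y. (F y - G y)\<^sup>2 \<partial>\<nu>) + 2 * (\<integral>y. (G y - poly p y)\<^sup>2 \<partial>\<nu>)"
      using F(1) Gm poly_borel[of p] by simp
    also have "\<dots> < e" using G(2)[OF \<nu>] p[OF \<nu>] by simp
    finally show "(\<integral>y. (F y - poly p y)\<^sup>2 \<partial>\<nu>) < e" .
  qed
qed

lemma limit_add:
  assumes F: "polynomial_L2_limit \<M> F" and G: "polynomial_L2_limit \<M> G"
  shows "polynomial_L2_limit \<M> (\<lambda>y. F y + G y)"
  unfolding polynomial_L2_limit_def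
proof (intro conjI ballI allI impI)
  have m: "F \<in> borel_measurable borel" "G \<in> borel_measurable borel"
    using assms by (auto simp: polynomial_L2_limit_def)
  then show "(\<lambda>y. F y + G y) \<in> borel_measurable borel" by (rule borel_measurable_add)
  show "integrable \<nu> (\<lambda>y. (F y + G y)\<^sup>2)" if "\<nu> \<in> \<M>" for \<nu>
    using sq_integrable_add(1)[OF that m] assms that by (auto simp: polynomial_L2_limit_def)
  fix e :: real assume "e > 0"
  then have "e / 4 > 0" by simp
  then obtain p r where p: "\<And>\<nu>. \<nu> \<in> \<M> \<Longrightarrow> (\<integral>y. (F y - poly p y)\<^sup>2 \<partial>\<nu>) < e / 4"
    and r: "\<And>\<nu>. \<nu> \<in> \<M> \<Longrightarrow> (\<integral>y. (G y - poly r y)\<^sup>2 \<partial>\<nu>) < e / 4"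
    using limitD[OF F] limitD[OF G] by meson
  show "\<exists>p. \<forall>\<nu>\<in>\<M>. (\<integral>y. (F y + G y - poly p y)\<^sup>2 \<partial>\<nu>) < e"
  proof (intro exI[of _ "p + r"] ballI)
    fix \<nu> assume \<nu>: "\<nu> \<in> \<M>"
    have "(\<lambda>y. F y - poly p y) \<in> borel_measurable borel" "(\<lambda>y. G y - poly r y) \<in> borel_measurable borel"
      using m poly_borel by (auto intro!: borel_measurable_diff)
    from sq_integrable_add(2)[OF \<nu> this sq_integrable_diff_poly[OF F \<nu>] sq_integrable_diff_poly[OF G \<nu>]]
    have "(\<integral>y. (F y + G y - poly (p + r) y)\<^sup>2 \<partial>\<nu>) \<le> 2 * (\<integral>y. (F y - poly p y)\<^sup>2 \<partial>\<nu>) + 2 * (\<integral>y. (G y - poly r y)\<^sup>2 \<partial>\<nu>)"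
      by (simp add: algebra_simps)
    also have "\<dots> < e" using p[OF \<nu>] r[OF \<nu>] by simp
    finally show "(\<integral>y. (F y + G y - poly (p + r) y)\<^sup>2 \<partial>\<nu>) < e" .
  qed
qed

text \<open>Multiplication by a bounded function is continuous for the quadratic mean, so it suffices to
multiply polynomials.\<close>

lemma limit_mult_bounded_poly:
  assumes F: "polynomial_L2_limit \<M> F" and k: "k \<in> borel_measurable borel" "\<And>y. \<bar>k y\<bar> \<le> B"
    and kp: "\<And>p. polynomial_L2_limit \<M> (\<lambda>y. k y * poly p y)"
  shows "polynomial_L2_limit \<M> (\<lambda>y. k y * F y)"
proof (rule limit_closed)
  have Fm [measurable]: "F \<in> borel_measurable borel" using F by (simp add: polynomial_L2_limit_def)
  note [measurable] = k(1) poly_borel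
  show km: "(\<lambda>y. k y * F y) \<in> borel_measurable borel" by measurable
  have bd: "(k y * a)\<^sup>2 \<le> B\<^sup>2 * a\<^sup>2" for y a
    unfolding power_mult_distrib using k(2)[of y]
    by (intro mult_right_mono) (auto simp: abs_le_square_iff[symmetric])
  show "integrable \<nu> (\<lambda>y. (k y * F y)\<^sup>2)" if "\<nu> \<in> \<M>" for \<nu>
  proof (rule Bochner_Integration.integrable_bound[of _ "\<lambda>y. B\<^sup>2 * (F y)\<^sup>2"])
    show "(\<lambda>y. (k y * F y)\<^sup>2) \<in> borel_measurable \<nu>"
      by (intro measurable_class[OF that]) measurable
  qed (use F that bd in \<open>auto simp: polynomial_L2_limit_def\<close>)
  fix e :: real assume e: "e > 0"
  define d where "d = e / (B\<^sup>2 + 1)"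
  have d: "d > 0" unfolding d_def using e by (auto intro!: divide_pos_pos add_nonneg_pos)
  from limitD[OF F this] obtain p where p: "\<And>\<nu>. \<nu> \<in> \<M> \<Longrightarrow> (\<integral>y. (F y - poly p y)\<^sup>2 \<partial>\<nu>) < d"
    by blast
  show "\<exists>G. polynomial_L2_limit \<M> G \<and> (\<forall>\<nu>\<in>\<M>. (\<integral>y. (k y * F y - G y)\<^sup>2 \<partial>\<nu>) < e)"
  proof (intro exI conjI ballI, rule kp)
    fix \<nu> assume \<nu>: "\<nu> \<in> \<M>"
    have i: "integrable \<nu> (\<lambda>y. (F y - poly p y)\<^sup>2)" by (rule sq_integrable_diff_poly[OF F \<nu>])
    have "(\<integral>y. (k y * F y - k y * poly p y)\<^sup>2 \<partial>\<nu>) \<le> (\<integral>y. B\<^sup>2 * (F y - poly p y)\<^sup>2 \<partial>\<nu>)"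
    proof (rule integral_mono)
      have m: "(\<lambda>y. (k y * F y - k y * poly p y)\<^sup>2) \<in> borel_measurable \<nu>"
        by (intro measurable_class[OF \<nu>]) measurable
      show le: "(k y * F y - k y * poly p y)\<^sup>2 \<le> B\<^sup>2 * (F y - poly p y)\<^sup>2" for y
        using bd[of y "F y - poly p y"] by (simp add: right_diff_distrib)
      show "integrable \<nu> (\<lambda>y. (k y * F y - k y * poly p y)\<^sup>2)"
      proof (rule Bochner_Integration.integrable_bound[OF _ m])
        show "integrable \<nu> (\<lambda>y. B\<^sup>2 * (F y - poly p y)\<^sup>2)" using i by simp
        show "AE y in \<nu>. norm ((k y * F y - k y * poly p y)\<^sup>2) \<le> norm (B\<^sup>2 * (F y - poly p y)\<^sup>2)"
          by (intro AE_I2) (simp add: le)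
      qed
    qed (use i in simp)
    also have "\<dots> = B\<^sup>2 * (\<integral>y. (F y - poly p y)\<^sup>2 \<partial>\<nu>)" by simp
    also have "\<dots> \<le> B\<^sup>2 * d" using p[OF \<nu>] by (intro mult_left_mono) auto
    also have "\<dots> < e"
    proof -
      have "B\<^sup>2 + 1 > 0" by (intro add_nonneg_pos) auto
      then show ?thesis using e unfolding d_def by (simp add: pos_divide_less_eq algebra_simps)
    qed
    finally show "(\<integral>y. (k y * F y - k y * poly p y)\<^sup>2 \<partial>\<nu>) < e" .
  qed
qed

lemma limit_cmult:
  assumes F: "polynomial_L2_limit \<M> F"
  shows "polynomial_L2_limit \<M> (\<lambda>y. c * F y)"
proof (rule limit_mult_bounded_poly[OF F, of _ "\<bar>c\<bar>"])
  show "polynomial_L2_limit \<M> (\<lambda>y. c * poly p y)" for p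
  proof -
    have "poly (smult c p) = (\<lambda>y. c * poly p y)" by (rule ext) simp
    then show ?thesis using limit_poly[of "smult c p"] by simp
  qed
qed auto

text \<open>Quadratic closeness implies closeness of integrals because
\<open>|a| \<le> d/2 + a\<^sup>2/(2 d)\<close>.\<close>

lemma limit_integral_eq:
  assumes F: "polynomial_L2_limit \<M> F" and mem: "\<nu>1 \<in> \<M>" "\<nu>2 \<in> \<M>"
    and eq: "\<And>p. (\<integral>y. poly p y \<partial>\<nu>1) = (\<integral>y. poly p y \<partial>\<nu>2)"
  shows "(\<integral>y. F y \<partial>\<nu>1) = (\<integral>y. F y \<partial>\<nu>2)"
proof -
  have close: "\<exists>p. \<bar>(\<integral>y. F y \<partial>\<nu>1) - (\<integral>y. poly p y \<partial>\<nu>1)\<bar> \<le> d \<and> \<bar>(\<integral>y. F y \<partial>\<nu>2) - (\<integral>y. poly p y \<partial>\<nu>2)\<bar> \<le> d"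
    if d: "d > 0" for d
  proof -
    have "d\<^sup>2 > 0" using d by simp
    from limitD[OF F this] obtain p where p: "\<And>\<nu>. \<nu> \<in> \<M> \<Longrightarrow> (\<integral>y. (F y - poly p y)\<^sup>2 \<partial>\<nu>) < d\<^sup>2"
      by blast
    have "\<bar>(\<integral>y. F y \<partial>\<nu>) - (\<integral>y. poly p y \<partial>\<nu>)\<bar> \<le> d" if \<nu>: "\<nu> \<in> \<M>" for \<nu>
    proof -
      interpret real_distribution \<nu> by (rule distribution[OF \<nu>])
      have Fm: "F \<in> borel_measurable \<nu>" using F \<nu> by (auto simp: polynomial_L2_limit_def intro: measurable_class)
      have F1: "integrable \<nu> F"
      proof (rule Bochner_Integration.integrable_bound[of _ "\<lambda>y. 1 + (F y)\<^sup>2"])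
        have "\<bar>a\<bar> \<le> 1 + a\<^sup>2" for a :: real
          using zero_le_power2[of "\<bar>a\<bar> - 1"] by (simp add: power2_eq_square algebra_simps)
        then show "AE y in \<nu>. norm (F y) \<le> norm (1 + (F y)\<^sup>2)"
          by (auto intro!: AE_I2 order.trans[OF _ abs_ge_self])
      qed (use F \<nu> Fm in \<open>auto simp: polynomial_L2_limit_def\<close>)
      have i: "integrable \<nu> (\<lambda>y. (F y - poly p y)\<^sup>2)" by (rule sq_integrable_diff_poly[OF F \<nu>])
      have "\<bar>(\<integral>y. F y \<partial>\<nu>) - (\<integral>y. poly p y \<partial>\<nu>)\<bar> = \<bar>\<integral>y. F y - poly p y \<partial>\<nu>\<bar>"
        using F1 poly_integrable[OF \<nu>, of p] by simp
      also have "\<dots> \<le> (\<integral>y. \<bar>F y - poly p y\<bar> \<partial>\<nu>)" by (rule integral_abs_bound)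
      also have "\<dots> \<le> (\<integral>y. d / 2 + (F y - poly p y)\<^sup>2 / (2 * d) \<partial>\<nu>)"
      proof (rule integral_mono)
        fix y
        have "0 \<le> (\<bar>F y - poly p y\<bar> - d)\<^sup>2 / (2 * d)" using d by simp
        then show "\<bar>F y - poly p y\<bar> \<le> d / 2 + (F y - poly p y)\<^sup>2 / (2 * d)"
          using d by (simp add: field_simps power2_eq_square)
      qed (use F1 i poly_integrable[OF \<nu>, of p] in auto)
      also have "\<dots> = d / 2 + (\<integral>y. (F y - poly p y)\<^sup>2 \<partial>\<nu>) / (2 * d)" using i prob_space by simp
      also have "\<dots> \<le> d / 2 + d\<^sup>2 / (2 * d)"
        using p[OF \<nu>] d by (intro add_left_mono divide_right_mono) auto
      also have "\<dots> = d" using d by (simp add: power2_eq_square)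
      finally show ?thesis .
    qed
    then show ?thesis using mem by blast
  qed
  show ?thesis
  proof (rule ccontr)
    assume ne: "(\<integral>y. F y \<partial>\<nu>1) \<noteq> (\<integral>y. F y \<partial>\<nu>2)"
    define d where "d = \<bar>(\<integral>y. F y \<partial>\<nu>1) - (\<integral>y. F y \<partial>\<nu>2)\<bar> / 3"
    have "d > 0" using ne by (simp add: d_def)
    from close[OF this] obtain p where "\<bar>(\<integral>y. F y \<partial>\<nu>1) - (\<integral>y. poly p y \<partial>\<nu>1)\<bar> \<le> d"
      "\<bar>(\<integral>y. F y \<partial>\<nu>2) - (\<integral>y. poly p y \<partial>\<nu>2)\<bar> \<le> d" by blast
    then have "\<bar>(\<integral>y. F y \<partial>\<nu>1) - (\<integral>y. F y \<partial>\<nu>2)\<bar> \<le> d + d" using eq[of p] by linarith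
    then show False using \<open>d > 0\<close> d_def by simp
  qed
qed

end

section \<open>Resolvents in the closure\<close>

lemma complex_poly_parts:
  fixes s :: "complex poly"
  shows "\<exists>a c :: real poly. \<forall>y. poly s (of_real y) = Complex (poly a y) (poly c y)"
proof (induction s)
  case 0
  show ?case by (intro exI[of _ 0]) (simp add: complex_eq_iff)
next
  case (pCons x s)
  then obtain a c where ac: "\<And>y. poly s (of_real y) = Complex (poly a y) (poly c y)" by blast
  show ?case
    by (intro exI[of _ "pCons (Re x) a"] exI[of _ "pCons (Im x) c"]) (simp add: ac complex_eq_iff)
qed

lemma poly_map_of_real: "poly (map_poly complex_of_real p) (of_real y) = of_real (poly p y)"
  by (induction p) (simp_all add: map_poly_pCons)

lemma cmod_resolvent_le:
  assumes "Im w \<noteq> 0"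
  shows "cmod (1 / (of_real y - w)) \<le> 1 / \<bar>Im w\<bar>"
proof -
  have "\<bar>Im w\<bar> \<le> cmod (of_real y - w)"
    using abs_Im_le_cmod[of "of_real y - w"] by simp
  then show ?thesis using assms by (simp add: norm_divide frac_le)
qed

lemma nonreal_neq: "Im w \<noteq> 0 \<Longrightarrow> complex_of_real y - w \<noteq> 0"
  by (auto simp: complex_eq_iff)

lemma continuous_resolvent:
  assumes "Im w \<noteq> 0"
  shows "continuous_on UNIV (\<lambda>y::real. 1 / (complex_of_real y - w))"
  by (intro continuous_intros) (use nonreal_neq[OF assms] in auto)

context moment_class
begin

text \<open>If \<open>f(w) = 1\<close>, then \<open>(1 - f(y))/(y - w)\<close> is a polynomial in \<open>y\<close>, and it differs from the
resolvent \<open>1/(y - w)\<close> by \<open>f(y)/(y - w)\<close>, which is at most \<open>|f(y)|/|Im w|\<close>.\<close>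

lemma limit_resolvent:
  assumes w: "Im w \<noteq> 0"
    and appr: "\<And>e. e > 0 \<Longrightarrow> \<exists>f :: complex poly. poly f w = 1 \<and>
      (\<forall>\<nu>\<in>\<M>. (\<integral>y. (cmod (poly f (of_real y)))\<^sup>2 \<partial>\<nu>) < e)"
    and P: "P = Re \<or> P = Im"
  shows "polynomial_L2_limit \<M> (\<lambda>y. P (1 / (of_real y - w)))"
proof (rule limit_closed)
  have Pc: "continuous_on UNIV (\<lambda>y::real. P (1 / (of_real y - w)))"
    using P by (auto intro!: continuous_on_Re continuous_on_Im continuous_resolvent[OF w])
  have P_le: "\<bar>P z\<bar> \<le> cmod z" for z using P abs_Re_le_cmod abs_Im_le_cmod by auto
  have P_diff: "P (a - b) = P a - P b" for a b using P by auto
  show Pm [measurable]: "(\<lambda>y. P (1 / (of_real y - w))) \<in> borel_measurable borel"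
    by (rule borel_measurable_continuous_onI[OF Pc])
  show "integrable \<nu> (\<lambda>y. (P (1 / (of_real y - w)))\<^sup>2)" if \<nu>: "\<nu> \<in> \<M>" for \<nu>
  proof -
    interpret real_distribution \<nu> by (rule distribution[OF \<nu>])
    show ?thesis
    proof (rule integrable_const_bound)
      show "AE y in \<nu>. norm ((P (1 / (of_real y - w)))\<^sup>2) \<le> (1 / \<bar>Im w\<bar>)\<^sup>2"
      proof (rule AE_I2)
        fix y
        have "\<bar>P (1 / (of_real y - w))\<bar> \<le> 1 / \<bar>Im w\<bar>"
          using P_le cmod_resolvent_le[OF w] order.trans by blast
        then have "\<bar>P (1 / (of_real y - w))\<bar>\<^sup>2 \<le> (1 / \<bar>Im w\<bar>)\<^sup>2" by (rule power_mono) simp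
        then show "norm ((P (1 / (of_real y - w)))\<^sup>2) \<le> (1 / \<bar>Im w\<bar>)\<^sup>2" by simp
      qed
      show "(\<lambda>y. (P (1 / (of_real y - w)))\<^sup>2) \<in> borel_measurable \<nu>"
        by (intro measurable_class[OF \<nu>]) measurable
    qed
  qed
  fix e :: real assume e: "e > 0"
  then obtain f where f: "poly f w = 1"
    "\<And>\<nu>. \<nu> \<in> \<M> \<Longrightarrow> (\<integral>y. (cmod (poly f (of_real y)))\<^sup>2 \<partial>\<nu>) < e * (Im w)\<^sup>2"
    using appr[of "e * (Im w)\<^sup>2"] w by auto
  have "poly (1 - f) w = 0" using f by simp
  then obtain s where s: "1 - f = [:- w, 1:] * s" by (metis poly_eq_0_iff_dvd dvdE)
  obtain a c where ac: "\<And>y. poly s (of_real y) = Complex (poly a y) (poly c y)"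
    using complex_poly_parts by metis
  obtain d where d: "\<And>y. poly d y = P (poly s (of_real y))" using P ac by auto
  obtain fa fc where fac: "\<And>y. poly f (of_real y) = Complex (poly fa y) (poly fc y)"
    using complex_poly_parts by metis
  have res: "1 / (of_real y - w) - poly s (of_real y) = poly f (of_real y) * (1 / (of_real y - w))" for y
  proof -
    have "1 - poly f (of_real y) = (of_real y - w) * poly s (of_real y)"
      using arg_cong[OF s, of "\<lambda>p. poly p (of_real y)"] by (simp add: algebra_simps)
    then show ?thesis using nonreal_neq[OF w, of y] by (simp add: divide_simps) (simp add: algebra_simps)
  qed
  show "\<exists>G. polynomial_L2_limit \<M> G \<and> (\<forall>\<nu>\<in>\<M>. (\<integral>y. (P (1 / (of_real y - w)) - G y)\<^sup>2 \<partial>\<nu>) < e)"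
  proof (intro exI conjI ballI, rule limit_poly[of d])
    fix \<nu> assume \<nu>: "\<nu> \<in> \<M>"
    have cm: "(cmod (poly f (of_real y)))\<^sup>2 = poly (fa\<^sup>2 + fc\<^sup>2) y" for y
      unfolding fac by (simp add: cmod_power2)
    have i: "integrable \<nu> (\<lambda>y. (cmod (poly f (of_real y)))\<^sup>2 / (Im w)\<^sup>2)"
      unfolding cm by (intro integrable_divide poly_integrable[OF \<nu>])
    have le: "(P (1 / (of_real y - w)) - poly d y)\<^sup>2 \<le> (cmod (poly f (of_real y)))\<^sup>2 / (Im w)\<^sup>2" for y
    proof -
      have "\<bar>P (1 / (of_real y - w)) - poly d y\<bar> \<le> cmod (poly f (of_real y) * (1 / (of_real y - w)))"
        unfolding d P_diff[symmetric] res by (rule P_le)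
      also have "\<dots> \<le> cmod (poly f (of_real y)) * (1 / \<bar>Im w\<bar>)"
        unfolding norm_mult by (intro mult_left_mono cmod_resolvent_le w) simp
      finally have "\<bar>P (1 / (of_real y - w)) - poly d y\<bar>\<^sup>2 \<le> (cmod (poly f (of_real y)) * (1 / \<bar>Im w\<bar>))\<^sup>2"
        by (rule power_mono) simp
      then show ?thesis by (simp add: power_mult_distrib power_divide)
    qed
    have "(\<integral>y. (P (1 / (of_real y - w)) - poly d y)\<^sup>2 \<partial>\<nu>) \<le> (\<integral>y. (cmod (poly f (of_real y)))\<^sup>2 / (Im w)\<^sup>2 \<partial>\<nu>)"
    proof (rule integral_mono[OF _ i le])
      note [measurable] = poly_borel
      have m: "(\<lambda>y. (P (1 / (of_real y - w)) - poly d y)\<^sup>2) \<in> borel_measurable \<nu>"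
        by (intro measurable_class[OF \<nu>]) measurable
      show "integrable \<nu> (\<lambda>y. (P (1 / (of_real y - w)) - poly d y)\<^sup>2)"
        by (rule Bochner_Integration.integrable_bound[OF i m], rule AE_I2) (simp add: le)
    qed
    also have "\<dots> < e" using f(2)[OF \<nu>] w by (simp add: divide_less_eq)
    finally show "(\<integral>y. (P (1 / (of_real y - w)) - poly d y)\<^sup>2 \<partial>\<nu>) < e" .
  qed
qed

text \<open>For a polynomial \<open>p\<close>, the product \<open>p(y)/(y - w)\<close> is a polynomial plus a multiple of the
resolvent.\<close>

lemma limit_mult_resolvent:
  assumes w: "Im w \<noteq> 0"
    and res: "polynomial_L2_limit \<M> (\<lambda>y. Re (1 / (of_real y - w)))" "polynomial_L2_limit \<M> (\<lambda>y. Im (1 / (of_real y - w)))"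
    and F: "polynomial_L2_limit \<M> F" and P: "P = Re \<or> P = Im"
  shows "polynomial_L2_limit \<M> (\<lambda>y. P (1 / (of_real y - w)) * F y)"
proof (rule limit_mult_bounded_poly[OF F])
  have P_le: "\<bar>P z\<bar> \<le> cmod z" for z using P abs_Re_le_cmod abs_Im_le_cmod by auto
  show "(\<lambda>y. P (1 / (of_real y - w))) \<in> borel_measurable borel"
    using P by (auto intro!: borel_measurable_continuous_onI continuous_on_Re continuous_on_Im continuous_resolvent[OF w])
  show "\<bar>P (1 / (of_real y - w))\<bar> \<le> 1 / \<bar>Im w\<bar>" for y
    using P_le cmod_resolvent_le[OF w] order.trans by blast
  fix p
  define k where "k = poly (map_poly complex_of_real p) w"
  have "poly (map_poly complex_of_real p - [:k:]) w = 0" by (simp add: k_def)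
  then obtain s where s: "map_poly complex_of_real p - [:k:] = [:- w, 1:] * s" by (metis poly_eq_0_iff_dvd dvdE)
  obtain a c where ac: "\<And>y. poly s (of_real y) = Complex (poly a y) (poly c y)"
    using complex_poly_parts by metis
  have eq: "1 / (of_real y - w) * of_real (poly p y) = poly s (of_real y) + k * (1 / (of_real y - w))" for y
  proof -
    have "of_real (poly p y) - k = (of_real y - w) * poly s (of_real y)"
      using arg_cong[OF s, of "\<lambda>p. poly p (of_real y)"] by (simp add: algebra_simps poly_map_of_real)
    then show ?thesis using nonreal_neq[OF w, of y] by (simp add: divide_simps) (simp add: algebra_simps)
  qed
  have Pr: "P z * r = P (z * of_real r)" for z r
    using P by auto
  have eqP: "P (1 / (of_real y - w)) * poly p y = P (poly s (of_real y) + k * (1 / (of_real y - w)))" for y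
    unfolding Pr eq ..
  show "polynomial_L2_limit \<M> (\<lambda>y. P (1 / (of_real y - w)) * poly p y)"
    using P
  proof
    assume Re: "P = Re"
    have "(\<lambda>y. P (1 / (of_real y - w)) * poly p y)
      = (\<lambda>y. poly a y + (Re k * Re (1 / (of_real y - w)) + (- Im k) * Im (1 / (of_real y - w))))"
      by (rule ext, subst eqP, simp only: Re ac plus_complex.simps times_complex.simps complex.sel mult_minus_left diff_conv_add_uminus)
    then show ?thesis by (simp only:) (intro limit_add limit_poly limit_cmult res)
  next
    assume Im: "P = Im"
    have "(\<lambda>y. P (1 / (of_real y - w)) * poly p y)
      = (\<lambda>y. poly c y + (Re k * Im (1 / (of_real y - w)) + Im k * Re (1 / (of_real y - w))))"
      by (rule ext, subst eqP, simp only: Im ac plus_complex.simps times_complex.simps complex.sel mult_minus_left diff_conv_add_uminus)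
    then show ?thesis by (simp only:) (intro limit_add limit_poly limit_cmult res)
  qed
qed

text \<open>Starting from one nonreal point \<open>w\<close>, the closure of the polynomials contains all
polynomials in the real and imaginary part of the resolvent at \<open>w\<close>. This avoids any appeal to analyticity of
the Stieltjes transform.\<close>

lemma limit_polynomial_of_resolvent:
  assumes w: "Im w \<noteq> 0"
    and res: "polynomial_L2_limit \<M> (\<lambda>y. Re (1 / (of_real y - w)))" "polynomial_L2_limit \<M> (\<lambda>y. Im (1 / (of_real y - w)))"
    and Q: "real_polynomial_function Q" and F: "polynomial_L2_limit \<M> F"
  shows "polynomial_L2_limit \<M> (\<lambda>y. Q (1 / (complex_of_real y - w)) * F y)"
  using Q F
proof (induction Q arbitrary: F rule: real_polynomial_function.induct)
  case (linear f)
  interpret f: bounded_linear f by fact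
  have f: "f z = f 1 * Re z + f \<i> * Im z" for z
  proof -
    have "z = Re z *\<^sub>R 1 + Im z *\<^sub>R \<i>" by (simp add: complex_eq_iff)
    then have "f z = f (Re z *\<^sub>R 1 + Im z *\<^sub>R \<i>)" by simp
    then show ?thesis by (simp only: f.add f.scaleR) simp
  qed
  have "(\<lambda>y. f (1 / (complex_of_real y - w)) * F y)
    = (\<lambda>y. f 1 * (Re (1 / (of_real y - w)) * F y) + f \<i> * (Im (1 / (of_real y - w)) * F y))"
    by (rule ext, subst f) (simp add: algebra_simps)
  then show ?case
    by (simp only:) (intro limit_add limit_cmult limit_mult_resolvent[OF w res linear.prems]; simp)
next
  case (const c)
  then show ?case by (rule limit_cmult)
next
  case (add f g)
  then show ?case using limit_add by (simp add: distrib_right)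
next
  case (mult f g)
  show ?case using mult.IH(1)[OF mult.IH(2)[OF mult.prems]] by (simp add: mult.assoc)
qed

end

section \<open>Determinacy\<close>

lemma resolvent_circle:
  assumes "v \<noteq> 0"
  shows "cmod (1 / Complex x (- v) - Complex 0 (1 / (2 * v))) = 1 / (2 * \<bar>v\<bar>)"
proof -
  have D: "x\<^sup>2 + v\<^sup>2 > 0" using assms by (simp add: add_nonneg_pos)
  have "(cmod (1 / Complex x (- v) - Complex 0 (1 / (2 * v))))\<^sup>2
      = (x / (x\<^sup>2 + v\<^sup>2))\<^sup>2 + (v / (x\<^sup>2 + v\<^sup>2) - 1 / (2 * v))\<^sup>2"
    unfolding cmod_power2 by (simp add: Re_divide Im_divide)
  also have "\<dots> = (x\<^sup>2 + v\<^sup>2) / (x\<^sup>2 + v\<^sup>2)\<^sup>2 - 1 / (x\<^sup>2 + v\<^sup>2) + (1 / (2 * v))\<^sup>2"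
    using assms by (simp add: power2_diff power_divide add_divide_distrib)
  also have "\<dots> = (1 / (2 * \<bar>v\<bar>))\<^sup>2"
    using D by (simp add: power2_eq_square power_divide)
  finally show ?thesis by (simp add: power2_eq_iff_nonneg)
qed

text \<open>The resolvent maps the real line onto a circle without the origin, and the origin stands for
infinity. A continuous function of compact support therefore becomes continuous on the whole circle when it is
given the value zero at the origin.\<close>

lemma compact_support_through_resolvent:
  fixes T :: "real \<Rightarrow> real"
  assumes w: "Im w \<noteq> 0" and T: "continuous_on UNIV T" and supp: "\<And>y. \<bar>y\<bar> > K \<Longrightarrow> T y = 0"
  obtains S G where "compact S" "continuous_on S G" "\<And>y. 1 / (complex_of_real y - w) \<in> S"
    "\<And>y. G (1 / (complex_of_real y - w)) = T y"
proof -
  define S where "S = sphere (Complex 0 (1 / (2 * Im w))) (1 / (2 * \<bar>Im w\<bar>))"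
  define G where "G u = (if u = 0 then 0 else T (Re (w + 1 / u)))" for u
  have mem: "1 / (complex_of_real y - w) \<in> S" for y
  proof -
    have "complex_of_real y - w = Complex (y - Re w) (- Im w)" by (simp add: complex_eq_iff)
    then show ?thesis
      unfolding S_def mem_sphere dist_norm
      using resolvent_circle[OF w, of "y - Re w"] by (simp add: norm_minus_commute)
  qed
  have inv: "w + 1 / u = of_real (Re (w + 1 / u))" if u: "u \<in> S" "u \<noteq> 0" for u
  proof -
    have "(cmod (u - Complex 0 (1 / (2 * Im w))))\<^sup>2 = (1 / (2 * \<bar>Im w\<bar>))\<^sup>2"
      using u(1) unfolding S_def by (simp add: dist_norm norm_minus_commute)
    then have "(Re u)\<^sup>2 + (Im u - 1 / (2 * Im w))\<^sup>2 = (1 / (2 * Im w))\<^sup>2"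
      unfolding cmod_power2 by (simp add: power_divide)
    then have "(Re u)\<^sup>2 + (Im u)\<^sup>2 = Im u / Im w"
      by (simp add: power2_diff)
    moreover have "(Re u)\<^sup>2 + (Im u)\<^sup>2 \<noteq> 0" using u(2) by (simp add: complex_eq_iff sum_power2_eq_zero_iff)
    ultimately have "Im (1 / u) = - Im w"
      using w by (simp add: Im_divide)
    then show ?thesis by (simp add: complex_eq_iff)
  qed
  have "continuous (at u within S) G" if u: "u \<in> S" for u
  proof (cases "u = 0")
    case False
    have "continuous (at u) (\<lambda>u. T (Re (w + 1 / u)))"
      using False T by (intro continuous_at_compose[unfolded o_def, of u "\<lambda>u. Re (w + 1 / u)" T] continuous_intros)
        (auto simp: continuous_on_eq_continuous_at)
    then have "(G \<longlongrightarrow> T (Re (w + 1 / u))) (at u)"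
      unfolding continuous_at using False
      by (rule_tac Lim_transform_within_open[where s = "- {0}"]) (auto simp: G_def)
    then show ?thesis using False
      by (auto simp: continuous_within G_def intro: tendsto_within_subset)
  next
    case True
    \<comment> \<open>On the circle, points this close to the origin come from real numbers outside the support.\<close>
    define r where "r = 1 / (\<bar>K\<bar> + cmod w + 1)"
    have pos: "\<bar>K\<bar> + cmod w + 1 > 0" by (simp add: add_nonneg_pos)
    then have r: "r > 0" by (simp add: r_def)
    have "G x = 0" if x: "x \<in> S" "dist x 0 < r" for x
    proof (cases "x = 0")
      case False
      then have "cmod x * (\<bar>K\<bar> + cmod w + 1) < 1" using x pos by (simp add: r_def pos_less_divide_eq)
      then have "\<bar>K\<bar> + cmod w + 1 < cmod (1 / x)" using False by (simp add: norm_divide field_simps)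
      moreover have "cmod (1 / x) \<le> cmod (w + 1 / x) + cmod w"
        using norm_triangle_ineq4[of "w + 1 / x" w] by simp
      moreover have "cmod (w + 1 / x) = \<bar>Re (w + 1 / x)\<bar>" by (subst inv[OF x(1) False]) (simp only: norm_of_real)
      ultimately have "K < \<bar>Re (w + 1 / x)\<bar>" by linarith
      then show ?thesis using supp False by (simp add: G_def)
    qed (simp add: G_def)
    then have "\<forall>\<^sub>F x in at 0 within S. G x = 0"
      unfolding eventually_at using r by blast
    then have "(G \<longlongrightarrow> 0) (at 0 within S)" by (rule tendsto_eventually)
    then show ?thesis unfolding continuous_within True by (simp add: G_def)
  qed
  then have "continuous_on S G" by (simp add: continuous_on_eq_continuous_within)
  moreover have "G (1 / (complex_of_real y - w)) = T y" for y
    using nonreal_neq[OF w, of y] by (simp add: G_def)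
  ultimately show ?thesis using that[of S G] mem by (simp add: S_def)
qed

lemma cdf_from_trapezoids:
  assumes rd: "real_distribution \<nu>"
  shows "(\<lambda>n. \<integral>y. cts_step x (x + 1 / real (Suc n)) y - cts_step (- real (Suc n)) (- real n) y \<partial>\<nu>) \<longlonglongrightarrow> cdf \<nu> x"
proof -
  interpret real_distribution \<nu> by fact
  have "(\<lambda>n. \<integral>y. cts_step x (x + 1 / real (Suc n)) y - cts_step (- real (Suc n)) (- real n) y \<partial>\<nu>)
     \<longlonglongrightarrow> (\<integral>y. indicator {..x} y \<partial>\<nu>)"
  proof (rule integral_dominated_convergence[where w = "\<lambda>_. 2"])
    show "AE y in \<nu>. (\<lambda>n. cts_step x (x + 1 / real (Suc n)) y - cts_step (- real (Suc n)) (- real n) y) \<longlonglongrightarrow> indicator {..x} y"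
    proof (rule AE_I2)
      fix y
      have 1: "\<forall>\<^sub>F n in sequentially. cts_step x (x + 1 / real (Suc n)) y = indicator {..x} y"
      proof (cases "y \<le> x")
        case False
        then obtain N where "1 / real (Suc N) < y - x" using nat_approx_posE[of "y - x"] by auto
        then have "cts_step x (x + 1 / real (Suc n)) y = 0" if "n \<ge> N" for n
        proof -
          have "1 / real (Suc n) \<le> 1 / real (Suc N)" using that by (simp add: frac_le)
          then have "x + 1 / real (Suc n) \<le> y" using \<open>1 / real (Suc N) < y - x\<close> by linarith
          then show ?thesis using False by (simp add: cts_step_def)
        qed
        then show ?thesis using False eventually_sequentially by (auto simp: indicator_def)
      qed (simp add: cts_step_def)
      obtain N where N: "- y < real N" using reals_Archimedean2 by blast
      have 2: "\<forall>\<^sub>F n in sequentially. cts_step (- real (Suc n)) (- real n) y = 0"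
        using eventually_ge_at_top[of N] by eventually_elim (use N in \<open>auto simp: cts_step_def\<close>)
      show "(\<lambda>n. cts_step x (x + 1 / real (Suc n)) y - cts_step (- real (Suc n)) (- real n) y) \<longlonglongrightarrow> indicator {..x} y"
        by (rule tendsto_eventually) (use 1 2 in eventually_elim, simp)
    qed
    show "AE y in \<nu>. norm (cts_step x (x + 1 / real (Suc n)) y - cts_step (- real (Suc n)) (- real n) y) \<le> 2" for n
    proof (rule AE_I2)
      fix y
      have "0 \<le> cts_step a b y \<and> cts_step a b y \<le> 1" if "a < b" for a b
        using that by (auto simp: cts_step_def divide_simps)
      from this[of x "x + 1 / real (Suc n)"] this[of "- real (Suc n)" "- real n"]
      show "norm (cts_step x (x + 1 / real (Suc n)) y - cts_step (- real (Suc n)) (- real n) y) \<le> 2"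
        unfolding real_norm_def by (smt (verit) of_nat_0_less_iff zero_less_Suc zero_less_divide_1_iff of_nat_Suc)
    qed
  qed (auto intro!: measurable_finite_borel borel_measurable_diff simp: cts_step_def[abs_def])
  also have "(\<integral>y. indicator {..x} y \<partial>\<nu>) = cdf \<nu> x" by (simp add: cdf_def)
  finally show ?thesis .
qed

text \<open>By the Stone-Weierstrass theorem on the circle, continuous functions of compact support are
uniform limits of polynomials in the resolvent. Those have equal integrals, and the distribution functions are
limits of integrals of trapezoids.\<close>

theorem (in moment_class) determinate:
  assumes mem: "\<nu>1 \<in> \<M>" "\<nu>2 \<in> \<M>"
    and eq: "\<And>p. (\<integral>y. poly p y \<partial>\<nu>1) = (\<integral>y. poly p y \<partial>\<nu>2)"
    and w: "Im w \<noteq> 0"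
    and appr: "\<And>e. e > 0 \<Longrightarrow> \<exists>f :: complex poly. poly f w = 1 \<and>
      (\<forall>\<nu>\<in>\<M>. (\<integral>y. (cmod (poly f (of_real y)))\<^sup>2 \<partial>\<nu>) < e)"
  shows "\<nu>1 = \<nu>2"
proof -
  interpret N1: real_distribution \<nu>1 by (rule distribution[OF mem(1)])
  interpret N2: real_distribution \<nu>2 by (rule distribution[OF mem(2)])
  note res = limit_resolvent[OF w appr]
  have Q: "(\<integral>y. Q (1 / (complex_of_real y - w)) \<partial>\<nu>1) = (\<integral>y. Q (1 / (complex_of_real y - w)) \<partial>\<nu>2)"
    if "real_polynomial_function Q" for Q
  proof (rule limit_integral_eq[OF _ mem eq])
    have "poly 1 = (\<lambda>y::real. 1)" by (rule ext) simp
    then show "polynomial_L2_limit \<M> (\<lambda>y. Q (1 / (complex_of_real y - w)))"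
      using limit_polynomial_of_resolvent[OF w res res that, of "\<lambda>y. 1"] limit_poly[of 1] by simp
  qed
  have trap: "(\<integral>y. T y \<partial>\<nu>1) = (\<integral>y. T y \<partial>\<nu>2)"
    if T: "continuous_on UNIV T" and supp: "\<And>y. \<bar>y\<bar> > K \<Longrightarrow> T y = 0" for T :: "real \<Rightarrow> real" and K
  proof -
    obtain S G where S: "compact S" "continuous_on S G" "\<And>y. 1 / (complex_of_real y - w) \<in> S"
      "\<And>y. G (1 / (complex_of_real y - w)) = T y"
      using compact_support_through_resolvent[OF w T supp] by metis
    obtain B where B: "\<And>y. \<bar>T y\<bar> \<le> B"
    proof -
      have "bounded (G ` S)" using compact_continuous_image[OF S(2,1)] by (rule compact_imp_bounded)
      then obtain B where "\<And>u. u \<in> S \<Longrightarrow> \<bar>G u\<bar> \<le> B" unfolding bounded_iff by auto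
      then show ?thesis using that[of B] S(3,4) by metis
    qed
    have Tm: "T \<in> borel_measurable borel" by (rule borel_measurable_continuous_onI[OF T])
    have intT: "integrable \<nu> T" if "\<nu> \<in> \<M>" for \<nu>
    proof -
      interpret real_distribution \<nu> by (rule distribution[OF that])
      show ?thesis using B Tm by (intro integrable_const_bound[of _ B]) auto
    qed
    have le: "\<bar>(\<integral>y. T y \<partial>\<nu>1) - (\<integral>y. T y \<partial>\<nu>2)\<bar> \<le> 2 * e" if e: "e > 0" for e
    proof -
      obtain Q where Q': "real_polynomial_function Q" "\<And>u. u \<in> S \<Longrightarrow> \<bar>G u - Q u\<bar> < e"
        using Stone_Weierstrass_real_polynomial_function[OF S(1,2) e] by blast
      have qc: "continuous_on UNIV (\<lambda>y. Q (1 / (complex_of_real y - w)))"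
        using continuous_on_compose2[of UNIV Q UNIV "\<lambda>y. 1 / (complex_of_real y - w)"] continuous_resolvent[OF w]
          Q'(1) by (auto simp: real_polynomial_function_eq intro: continuous_on_polymonial_function)
      have d: "\<bar>T y - Q (1 / (complex_of_real y - w))\<bar> \<le> e" for y
        using Q'(2)[OF S(3)[of y]] S(4)[of y] by simp
      have intQ: "integrable \<nu> (\<lambda>y. Q (1 / (complex_of_real y - w)))" if "\<nu> \<in> \<M>" for \<nu>
      proof -
        interpret real_distribution \<nu> by (rule distribution[OF that])
        have "\<bar>Q (1 / (complex_of_real y - w))\<bar> \<le> B + e" for y using B[of y] d[of y] by linarith
        then show ?thesis using borel_measurable_continuous_onI[OF qc]
          by (intro integrable_const_bound[of _ "B + e"]) auto
      qed
      have "\<bar>(\<integral>y. T y \<partial>\<nu>) - (\<integral>y. Q (1 / (complex_of_real y - w)) \<partial>\<nu>)\<bar> \<le> e" if \<nu>: "\<nu> \<in> \<M>" for \<nu>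
      proof -
        interpret real_distribution \<nu> by (rule distribution[OF \<nu>])
        have "\<bar>(\<integral>y. T y \<partial>\<nu>) - (\<integral>y. Q (1 / (complex_of_real y - w)) \<partial>\<nu>)\<bar>
            = \<bar>\<integral>y. T y - Q (1 / (complex_of_real y - w)) \<partial>\<nu>\<bar>"
          using intT[OF \<nu>] intQ[OF \<nu>] by simp
        also have "\<dots> \<le> (\<integral>y. \<bar>T y - Q (1 / (complex_of_real y - w))\<bar> \<partial>\<nu>)" by (rule integral_abs_bound)
        also have "\<dots> \<le> (\<integral>y. e \<partial>\<nu>)"
          by (rule integral_mono) (use intT[OF \<nu>] intQ[OF \<nu>] d in auto)
        also have "\<dots> = e" using prob_space by simp
        finally show ?thesis .
      qed
      from this[OF mem(1)] this[OF mem(2)] show ?thesis using Q[OF Q'(1)] by linarith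
    qed
    show ?thesis
    proof (rule ccontr)
      assume "(\<integral>y. T y \<partial>\<nu>1) \<noteq> (\<integral>y. T y \<partial>\<nu>2)"
      then show False using le[of "\<bar>(\<integral>y. T y \<partial>\<nu>1) - (\<integral>y. T y \<partial>\<nu>2)\<bar> / 3"] by simp
    qed
  qed
  have "cdf \<nu>1 x = cdf \<nu>2 x" for x
  proof -
    have "(\<integral>y. cts_step x (x + 1 / real (Suc n)) y - cts_step (- real (Suc n)) (- real n) y \<partial>\<nu>1)
        = (\<integral>y. cts_step x (x + 1 / real (Suc n)) y - cts_step (- real (Suc n)) (- real n) y \<partial>\<nu>2)" for n
    proof (rule trap[of _ "\<bar>x\<bar> + 1 + real (Suc n)"])
      show "continuous_on UNIV (\<lambda>y. cts_step x (x + 1 / real (Suc n)) y - cts_step (- real (Suc n)) (- real n) y)"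
        by (intro continuous_on_diff uniformly_continuous_imp_continuous cts_step_uniformly_continuous) auto
      fix y assume y: "\<bar>y\<bar> > \<bar>x\<bar> + 1 + real (Suc n)"
      define z where "z = 1 / real (Suc n)"
      have z: "0 < z" "z \<le> 1" by (simp_all add: z_def)
      consider "x + z \<le> y" "- real n \<le> y" "\<not> y \<le> x" | "y \<le> x" "y \<le> - real (Suc n)"
        using y z by (cases "y \<ge> 0") auto
      then show "cts_step x (x + 1 / real (Suc n)) y - cts_step (- real (Suc n)) (- real n) y = 0"
        unfolding z_def[symmetric] using z by cases (auto simp: cts_step_def)
    qed
    then have "(\<lambda>n. \<integral>y. cts_step x (x + 1 / real (Suc n)) y - cts_step (- real (Suc n)) (- real n) y \<partial>\<nu>1) \<longlonglongrightarrow> cdf \<nu>2 x"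
      using cdf_from_trapezoids[OF N2.real_distribution_axioms, of x] by (simp only:)
    with cdf_from_trapezoids[OF N1.real_distribution_axioms] show ?thesis by (rule LIMSEQ_unique)
  qed
  then show ?thesis
    by (intro cdf_unique N1.real_distribution_axioms N2.real_distribution_axioms ext)
qed

lemma integral_jpoly_sum_sq:
  assumes \<nu>: "jacobi_measure b l \<nu>"
  shows "(\<integral>y. (\<Sum>k\<le>n. d k * poly (jpoly b l k) y)\<^sup>2 \<partial>\<nu>) = (\<Sum>k\<le>n. (d k)\<^sup>2 * jnorm l k)"
proof -
  have i: "integrable \<nu> (\<lambda>y. poly (jpoly b l j) y * poly (jpoly b l k) y)" for j k
    using jacobi_measure_integrable[OF \<nu>, of "jpoly b l j * jpoly b l k"] by (simp only: poly_mult)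
  have "(\<Sum>k\<le>n. d k * poly (jpoly b l k) y)\<^sup>2
     = (\<Sum>j\<le>n. \<Sum>k\<le>n. d j * d k * (poly (jpoly b l j) y * poly (jpoly b l k) y))" for y
    unfolding power2_eq_square sum_product by (simp only: mult_ac)
  then have "(\<integral>y. (\<Sum>k\<le>n. d k * poly (jpoly b l k) y)\<^sup>2 \<partial>\<nu>)
     = (\<Sum>j\<le>n. \<Sum>k\<le>n. d j * d k * (\<integral>y. poly (jpoly b l j) y * poly (jpoly b l k) y \<partial>\<nu>))"
    using i by (simp add: Bochner_Integration.integral_sum Bochner_Integration.integrable_sum)
  also have "\<dots> = (\<Sum>j\<le>n. \<Sum>k\<le>n. if k = j then (d j)\<^sup>2 * jnorm l j else 0)"
    unfolding jacobi_measure_orthogonal[OF \<nu>]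
    by (intro sum.cong refl) (auto simp: power2_eq_square)
  also have "\<dots> = (\<Sum>k\<le>n. (d k)\<^sup>2 * jnorm l k)" by simp
  finally show ?thesis .
qed

lemma integral_cmod_jpoly_sum_sq:
  fixes c :: "nat \<Rightarrow> complex"
  assumes \<nu>: "jacobi_measure b l \<nu>"
  shows "(\<integral>y. (cmod (poly (\<Sum>k\<le>n. smult (c k) (jpoly b l k)) (of_real y)))\<^sup>2 \<partial>\<nu>) = (\<Sum>k\<le>n. (cmod (c k))\<^sup>2 * jnorm l k)"
proof -
  have i: "integrable \<nu> (\<lambda>y. (\<Sum>k\<le>n. d k * poly (jpoly b l k) y)\<^sup>2)" for d
    using jacobi_measure_integrable[OF \<nu>, of "(\<Sum>k\<le>n. smult (d k) (jpoly b l k))\<^sup>2"]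
    by (simp only: poly_power poly_sum poly_smult)
  have "(cmod (poly (\<Sum>k\<le>n. smult (c k) (jpoly b l k)) (of_real y)))\<^sup>2
     = (\<Sum>k\<le>n. Re (c k) * poly (jpoly b l k) y)\<^sup>2 + (\<Sum>k\<le>n. Im (c k) * poly (jpoly b l k) y)\<^sup>2" for y
    unfolding cmod_power2 poly_sum poly_smult poly_jpoly_of_real by (simp only: Re_sum Im_sum) simp
  then have "(\<integral>y. (cmod (poly (\<Sum>k\<le>n. smult (c k) (jpoly b l k)) (of_real y)))\<^sup>2 \<partial>\<nu>)
      = (\<Sum>k\<le>n. (Re (c k))\<^sup>2 * jnorm l k) + (\<Sum>k\<le>n. (Im (c k))\<^sup>2 * jnorm l k)"
    using i by (simp only: Bochner_Integration.integral_add integral_jpoly_sum_sq[OF \<nu>])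
  also have "\<dots> = (\<Sum>k\<le>n. (cmod (c k))\<^sup>2 * jnorm l k)"
    unfolding sum.distrib[symmetric] by (simp only: cmod_power2 distrib_right)
  finally show ?thesis .
qed

text \<open>The normalised reproducing kernel at \<open>w\<close> takes the value \<open>1\<close> there and has squared norm
the reciprocal of \<^const>\<open>jkernel\<close>. If a squared norm vanishes, the corresponding polynomial divided by its value
at \<open>w\<close> has norm zero and serves instead.\<close>

theorem jacobi_measure_unique:
  assumes nonneg: "\<And>n. 0 \<le> jnorm l n" and w: "Im w \<noteq> 0"
    and unbounded: "\<And>B. (\<And>n. 0 < jnorm l n) \<Longrightarrow> \<exists>n. B < jkernel b l n w"
    and \<nu>: "jacobi_measure b l \<nu>1" "jacobi_measure b l \<nu>2"
  shows "\<nu>1 = \<nu>2"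
proof -
  have jm: "jacobi_measure b l \<nu>" if "\<nu> \<in> {\<nu>1, \<nu>2}" for \<nu> using that \<nu> by auto
  have "real_distribution \<nu>" "integrable \<nu> (\<lambda>y. y ^ n)" if "\<nu> \<in> {\<nu>1, \<nu>2}" for \<nu> n
    using jm[OF that] by (simp_all add: jacobi_measure_def)
  then interpret moment_class "{\<nu>1, \<nu>2}" by (rule moment_class.intro)
  have "\<exists>f :: complex poly. poly f w = 1 \<and> (\<forall>\<nu>\<in>{\<nu>1, \<nu>2}. (\<integral>y. (cmod (poly f (of_real y)))\<^sup>2 \<partial>\<nu>) < e)"
    if e: "e > 0" for e
  proof -
    have "\<exists>n c. poly (\<Sum>k\<le>n. smult (c k) (jpoly b l k)) w = (1::complex) \<and> (\<Sum>k\<le>n. (cmod (c k))\<^sup>2 * jnorm l k) < e"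
    proof (cases "\<exists>N. jnorm l N = 0")
      case True
      define N where "N = (LEAST N. jnorm l N = 0)"
      have N: "jnorm l N = 0" unfolding N_def by (rule LeastI_ex[OF True])
      have pos: "0 < jnorm l k" if "k < N" for k
        using not_less_Least[of k "\<lambda>N. jnorm l N = 0"] that nonneg[of k] unfolding N_def by fastforce
      define z where "z = poly (jpoly b l N) w"
      have z: "z \<noteq> 0" unfolding z_def by (rule jpoly_nonreal_nonzero[OF pos w])
      let ?c = "\<lambda>k. if k = N then 1 / z else 0"
      have "poly (\<Sum>k\<le>N. smult (?c k) (jpoly b l k)) w = (\<Sum>k\<le>N. if k = N then 1 else 0)"
        unfolding poly_sum poly_smult by (intro sum.cong refl) (use z in \<open>auto simp: z_def\<close>)
      moreover have "(\<Sum>k\<le>N. (cmod (?c k))\<^sup>2 * jnorm l k) = (\<Sum>k\<le>N. 0)"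
        by (intro sum.cong refl) (use N in auto)
      ultimately show ?thesis using e by (intro exI[of _ N] exI[of _ ?c]) simp
    next
      case False
      then have pos: "0 < jnorm l k" for k using nonneg[of k] by (metis less_eq_real_def)
      from unbounded[OF this, of "1 / e"] obtain n where n: "1 / e < jkernel b l n w" by blast
      define K where "K = jkernel b l n w"
      have K: "K > 0" using n e unfolding K_def by (smt (verit) zero_less_divide_1_iff)
      define c where "c k = cnj (poly (jpoly b l k) w) / of_real (jnorm l k * K)" for k
      have "poly (\<Sum>k\<le>n. smult (c k) (jpoly b l k)) w = (\<Sum>k\<le>n. of_real ((cmod (poly (jpoly b l k) w))\<^sup>2 / jnorm l k / K))"
        unfolding poly_sum poly_smult c_def
        by (intro sum.cong refl) (simp add: complex_norm_square mult.commute del: of_real_power)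
      also have "\<dots> = of_real (K / K)"
        unfolding K_def jkernel_def sum_divide_distrib of_real_sum ..
      finally have 1: "poly (\<Sum>k\<le>n. smult (c k) (jpoly b l k)) w = 1" using K by simp
      have "(\<Sum>k\<le>n. (cmod (c k))\<^sup>2 * jnorm l k) = (\<Sum>k\<le>n. (cmod (poly (jpoly b l k) w))\<^sup>2 / jnorm l k / K\<^sup>2)"
      proof (intro sum.cong refl)
        fix k
        show "(cmod (c k))\<^sup>2 * jnorm l k = (cmod (poly (jpoly b l k) w))\<^sup>2 / jnorm l k / K\<^sup>2"
          using pos[of k] K unfolding c_def
          by (simp add: norm_divide norm_mult power_divide power_mult_distrib power2_eq_square)
      qed
      also have "\<dots> = K / K\<^sup>2" unfolding K_def jkernel_def sum_divide_distrib ..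
      also have "\<dots> < e" using n e K unfolding K_def[symmetric] by (simp add: power2_eq_square divide_simps mult.commute)
      finally show ?thesis using 1 by blast
    qed
    then obtain n c where "poly (\<Sum>k\<le>n. smult (c k) (jpoly b l k)) w = (1::complex)"
      "(\<Sum>k\<le>n. (cmod (c k))\<^sup>2 * jnorm l k) < e" by blast
    then show ?thesis
      by (intro exI[of _ "\<Sum>k\<le>n. smult (c k) (jpoly b l k)"] conjI ballI)
        (simp_all only: integral_cmod_jpoly_sum_sq[OF jm])
  qed
  then show ?thesis
    using determinate[OF _ _ jacobi_measure_moments_unique[OF \<nu>] w] by blast
qed

text \<open>Since the kernel is at least \<open>1\<close>, the imaginary part in the Christoffel-Darboux identity
bounds the product of the normalised values at \<open>n\<close> and \<open>n + 1\<close> from below by \<open>1/sqrt (l (n + 1))\<close>.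
Quadratic growth of \<open>l\<close> makes this at least a multiple of \<open>1/(n + 1)\<close>, and the harmonic series diverges.\<close>

lemma jkernel_unbounded_Carleman:
  assumes pos: "\<And>n. 0 < jnorm l n" and growth: "\<And>n. l (Suc n) \<le> C * (real (Suc n))\<^sup>2"
  shows "\<exists>n. B < jkernel b l n \<i>"
proof (rule ccontr)
  assume "\<not> ?thesis"
  then have bound: "jkernel b l n \<i> \<le> B" for n by (auto simp: not_less)
  define s where "s n = (cmod (poly (jpoly b l n) \<i>))\<^sup>2 / jnorm l n" for n
  have s0: "0 \<le> s n" for n using pos[of n] by (simp add: s_def)
  have lpos: "0 < l (Suc n)" for n
    using pos[of "Suc n"] pos[of n] by (simp add: zero_less_mult_iff)
  have C: "C > 0" using growth[of 0] lpos[of 0] by simp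
  \<comment> \<open>Arithmetic-geometric mean inequality applied to the product of consecutive normalised values.\<close>
  have step: "2 / sqrt C * (1 / real (Suc n)) \<le> s n + s (Suc n)" for n
  proof -
    let ?p = "cmod (poly (jpoly b l n) \<i>)" and ?q = "cmod (poly (jpoly b l (Suc n)) \<i>)"
    have "jnorm l n * 1 \<le> jnorm l n * jkernel b l n \<i>"
      using jkernel_ge_1[of n l b \<i>] pos by (intro mult_left_mono) (auto intro: less_imp_le)
    also have "\<dots> = Im (poly (jpoly b l (Suc n)) \<i> * cnj (poly (jpoly b l n) \<i>))"
      using Christoffel_Darboux_Im[of n l b \<i>] pos by simp
    also have "\<dots> \<le> cmod (poly (jpoly b l (Suc n)) \<i> * cnj (poly (jpoly b l n) \<i>))"
      using abs_Im_le_cmod[of "poly (jpoly b l (Suc n)) \<i> * cnj (poly (jpoly b l n) \<i>)"] by linarith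
    also have "\<dots> = ?q * ?p" by (simp add: norm_mult del: jpoly.simps)
    finally have "(jnorm l n)\<^sup>2 \<le> (?q * ?p)\<^sup>2" using pos[of n] by (intro power_mono) auto
    also have "\<dots> = s (Suc n) * s n * l (Suc n) * (jnorm l n)\<^sup>2"
      using pos[of n] lpos[of n] by (simp add: s_def power_mult_distrib power2_eq_square)
    finally have "1 * (jnorm l n)\<^sup>2 \<le> s (Suc n) * s n * l (Suc n) * (jnorm l n)\<^sup>2" by simp
    then have "1 \<le> s (Suc n) * s n * l (Suc n)"
      using pos[of n] by (subst (asm) mult_le_cancel_right) auto
    also have "\<dots> \<le> s (Suc n) * s n * (C * (real (Suc n))\<^sup>2)"
      using s0 by (intro mult_left_mono growth) auto
    also have "4 * \<dots> \<le> (s n + s (Suc n))\<^sup>2 * (C * (real (Suc n))\<^sup>2)"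
    proof -
      have "4 * (s (Suc n) * s n) \<le> (s n + s (Suc n))\<^sup>2"
        using zero_le_power2[of "s n - s (Suc n)"] by (simp add: power2_eq_square algebra_simps)
      then have "4 * (s (Suc n) * s n) * (C * (real (Suc n))\<^sup>2) \<le> (s n + s (Suc n))\<^sup>2 * (C * (real (Suc n))\<^sup>2)"
        using C by (intro mult_right_mono) auto
      then show ?thesis by (simp add: mult.assoc)
    qed
    finally have "2\<^sup>2 \<le> ((s n + s (Suc n)) * (sqrt C * real (Suc n)))\<^sup>2"
      using C by (simp add: power_mult_distrib)
    then have "2 \<le> (s n + s (Suc n)) * (sqrt C * real (Suc n))"
      by (rule power2_le_imp_le) (use s0 C in auto)
    moreover have "0 < sqrt C * real (Suc n)" using C by simp
    ultimately have "2 / (sqrt C * real (Suc n)) \<le> s n + s (Suc n)"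
      by (simp only: pos_divide_le_eq)
    then show ?thesis by simp
  qed
  have "2 / sqrt C * (\<Sum>n<N. 1 / real (Suc n)) \<le> 2 * B" for N
  proof -
    have "2 / sqrt C * (\<Sum>n<N. 1 / real (Suc n)) \<le> (\<Sum>n<N. s n + s (Suc n))"
      unfolding sum_distrib_left by (intro sum_mono step)
    also have "\<dots> = (\<Sum>n<N. s n) + (\<Sum>n<N. s (Suc n))" by (rule sum.distrib)
    also have "(\<Sum>n<N. s n) \<le> (\<Sum>n\<le>N. s n)" using s0 by (intro sum_mono2) auto
    also have "(\<Sum>n<N. s (Suc n)) \<le> (\<Sum>n\<le>N. s n)"
      using s0[of 0] by (simp add: lessThan_Suc_atMost[symmetric] sum.lessThan_Suc_shift del: sum.lessThan_Suc)
    also have "(\<Sum>n\<le>N. s n) = jkernel b l N \<i>" by (simp add: jkernel_def s_def)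
    finally show ?thesis using bound[of N] by simp
  qed
  then have "(\<Sum>n<N. 1 / real (Suc n)) \<le> B * sqrt C" for N
    using C by (simp add: field_simps)
  then have "summable (\<lambda>n. 1 / real (Suc n))"
    by (intro summableI_nonneg_bounded) auto
  then have "summable (\<lambda>n. 1 / real n)" by (subst (asm) summable_Suc_iff)
  then show False using not_summable_harmonic[where 'a = real] by (simp add: inverse_eq_divide)
qed

section \<open>LU factorisations: location of zeros and determinacy\<close>

text \<open>All zeros are real, and moving vertically away from the axis increases the distance to each of
them.\<close>

lemma cmod_jpoly_ge_real:
  assumes pos: "\<And>n. 0 < jnorm l n"
  shows "\<bar>poly (jpoly b l n) y\<bar> \<le> cmod (poly (jpoly b l n) (Complex y v))"
proof -
  obtain R where R: "\<And>z::complex. poly (jpoly b l n) z = (\<Prod>r\<in>R. z - of_real r)"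
    using jpoly_real_rooted[of n l b] pos by metis
  have "\<bar>poly (jpoly b l n) y\<bar> = cmod (poly (jpoly b l n) (of_real y))"
    unfolding poly_jpoly_of_real by simp
  also have "\<dots> = (\<Prod>r\<in>R. cmod (of_real y - of_real r))" unfolding R by (rule prod_norm[symmetric])
  also have "\<dots> \<le> (\<Prod>r\<in>R. cmod (Complex y v - of_real r))"
  proof (rule prod_mono, intro conjI norm_ge_zero)
    fix r
    have "cmod (of_real y - of_real r) = \<bar>Re (Complex y v - of_real r)\<bar>"
      unfolding of_real_diff[symmetric] norm_of_real by simp
    also have "\<dots> \<le> cmod (Complex y v - of_real r)" by (rule abs_Re_le_cmod)
    finally show "cmod (of_real y - of_real r) \<le> cmod (Complex y v - of_real r)" .
  qed
  also have "\<dots> = cmod (poly (jpoly b l n) (Complex y v))" unfolding R by (rule prod_norm)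
  finally show ?thesis .
qed

text \<open>The Jacobi matrix, rescaled by \<open>\<eta>\<close> and shifted by \<open>\<gamma>\<close>, factors into a lower and an upper
bidiagonal matrix with entries \<open>v\<close> and \<open>u\<close>. Multiplying by \<open>\<eta>\<close> instead of dividing by it covers both
signs of \<open>\<eta>\<close> at once.\<close>

definition LU_factors :: "(nat \<Rightarrow> real) \<Rightarrow> (nat \<Rightarrow> real) \<Rightarrow> real \<Rightarrow> real \<Rightarrow> (nat \<Rightarrow> real) \<Rightarrow> (nat \<Rightarrow> real) \<Rightarrow> bool" where
  "LU_factors b l \<eta> \<gamma> u v \<longleftrightarrow> v 0 = 0 \<and> (\<forall>n. \<eta> * b n = u n + v n - \<gamma>) \<and> (\<forall>n. \<eta>\<^sup>2 * l (Suc n) = u n * v (Suc n))"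

text \<open>Dividing the polynomials by their values at the base point \<open>\<gamma> + \<eta> y = 0\<close>, which up to scaling are
products of the \<open>u\<close>, turns the recurrence into one for the increments.\<close>

lemma LU_ratio:
  fixes y :: real
  assumes LU: "LU_factors b l \<eta> \<gamma> u v" and u: "\<And>n. u n \<noteq> 0"
    and r_def: "\<And>n. r n = (- \<eta>) ^ n * poly (jpoly b l n) y / (\<Prod>j<n. u j)"
  shows "r 0 = 1" "u 0 * (r (Suc 0) - r 0) = - (\<gamma> + \<eta> * y) * r 0"
    "u (Suc n) * (r (Suc (Suc n)) - r (Suc n)) = - (\<gamma> + \<eta> * y) * r (Suc n) + v (Suc n) * (r (Suc n) - r n)"
proof -
  have b: "\<eta> * b n = u n + v n - \<gamma>" and l: "\<eta>\<^sup>2 * l (Suc n) = u n * v (Suc n)" and v0: "v 0 = 0" for n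
    using LU by (auto simp: LU_factors_def)
  show "r 0 = 1" by (simp add: r_def)
  show "u 0 * (r (Suc 0) - r 0) = - (\<gamma> + \<eta> * y) * r 0"
  proof -
    have "u 0 * r (Suc 0) = \<eta> * b 0 - \<eta> * y" using u[of 0] by (simp add: r_def field_simps)
    moreover have "r 0 = 1" by (simp add: r_def)
    ultimately show ?thesis using b[of 0] v0 by (simp add: right_diff_distrib)
  qed
  define U where "U = (\<Prod>j<n. u j)"
  have U: "U \<noteq> 0" using u by (simp add: U_def)
  define P where "P = (- \<eta>) ^ n * poly (jpoly b l n) y"
  define P1 where "P1 = (- \<eta>) ^ Suc n * poly (jpoly b l (Suc n)) y"
  have P2: "(- \<eta>) ^ Suc (Suc n) * poly (jpoly b l (Suc (Suc n))) y
     = (- (\<gamma> + \<eta> * y) + u (Suc n) + v (Suc n)) * P1 - u n * v (Suc n) * P"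
  proof -
    have "(- \<eta>) ^ Suc (Suc n) * poly (jpoly b l (Suc (Suc n))) y
       = (\<eta> * b (Suc n) - \<eta> * y) * P1 - \<eta>\<^sup>2 * l (Suc n) * P"
      unfolding poly_jpoly_Suc_Suc P_def P1_def by (simp add: algebra_simps power2_eq_square del: jpoly.simps)
    then show ?thesis unfolding b l by (simp add: algebra_simps)
  qed
  have r: "r n = P / U" "r (Suc n) = P1 / (U * u n)"
    "r (Suc (Suc n)) = ((- (\<gamma> + \<eta> * y) + u (Suc n) + v (Suc n)) * P1 - u n * v (Suc n) * P) / (U * u n * u (Suc n))"
    unfolding r_def P2 by (simp_all add: P_def P1_def U_def del: jpoly.simps power_Suc)
  show "u (Suc n) * (r (Suc (Suc n)) - r (Suc n)) = - (\<gamma> + \<eta> * y) * r (Suc n) + v (Suc n) * (r (Suc n) - r n)"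
    unfolding r using U u[of n] u[of "Suc n"] by (simp add: field_simps)
qed

text \<open>Beyond the base point the normalised values increase from \<open>1\<close>.\<close>

lemma LU_root_location:
  assumes LU: "LU_factors b l \<eta> \<gamma> u v" and u: "\<And>n. 0 < u n" and v: "\<And>n. 0 \<le> v n"
    and y: "\<gamma> + \<eta> * y < 0"
  shows "poly (jpoly b l n) y \<noteq> (0::real)"
proof -
  define r where "r n = (- \<eta>) ^ n * poly (jpoly b l n) y / (\<Prod>j<n. u j)" for n
  have u0: "u n \<noteq> 0" for n using u[of n] by simp
  note R = LU_ratio[OF LU u0 r_def]
  have "0 < r n \<and> r n \<le> r (Suc n)"
  proof (induction n)
    case 0
    have "0 \<le> u 0 * (r (Suc 0) - r 0)" unfolding R(2) using y R(1) by simp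
    then show ?case using u[of 0] R(1) by (simp add: zero_le_mult_iff)
  next
    case (Suc n)
    have "0 \<le> - (\<gamma> + \<eta> * y) * r (Suc n) + v (Suc n) * (r (Suc n) - r n)"
      using Suc y v[of "Suc n"] by (intro add_nonneg_nonneg mult_nonneg_nonneg) auto
    then have "0 \<le> u (Suc n) * (r (Suc (Suc n)) - r (Suc n))" unfolding R(3) .
    then show ?case using u[of "Suc n"] Suc by (simp add: zero_le_mult_iff)
  qed
  then show ?thesis unfolding r_def by (metis divide_eq_0_iff less_irrefl mult_eq_0_iff)
qed

text \<open>This covers coefficients of order \<open>n\<^sup>4\<close>, for which the Carleman series converges. Far beyond the base
point the normalised values \<open>r n\<close> grow at least like \<open>n\<^sup>p\<close>, with \<open>p\<close> as large as desired.
The squared normalised values at the base point itself decay at most like a fixed power of \<open>n\<close>, because \<open>u\<close>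
and \<open>v\<close> have the same leading coefficient. Hence the terms of the kernel are eventually increasing.\<close>

lemma jkernel_unbounded_LU:
  assumes pos: "\<And>n. 0 < jnorm l n" and LU: "LU_factors b l \<eta> \<gamma> u v" and u: "\<And>n. 0 < u n"
    and \<eta>: "\<eta> \<noteq> 0" and \<kappa>: "0 < \<kappa>"
    and uq: "\<And>n. u n = \<kappa> * (real n)\<^sup>2 + \<beta> * real n + \<delta>"
    and vq: "\<And>n. v n = \<kappa> * (real n)\<^sup>2 + \<beta>' * real n"
  shows "\<exists>w. Im w \<noteq> 0 \<and> (\<forall>B. \<exists>n. B < jkernel b l n w)"
proof -
  define C where "C = \<bar>\<beta>\<bar> + \<bar>\<beta>'\<bar> + \<bar>\<delta>\<bar>"
  \<comment> \<open>p makes the quadratic comparison at the end have a positive leading coefficient a.\<close>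
  define p where "p = 2 + (\<bar>\<beta>\<bar> + \<bar>\<beta>'\<bar>) / \<kappa>"
  \<comment> \<open>t is the distance from the base point that the growth exponent p requires.\<close>
  define t where "t = p\<^sup>2 * \<kappa> + 2 * p * C"
  define y where "y = - (t + \<gamma>) / \<eta>"
  have C0: "0 \<le> C" by (simp add: C_def)
  have p: "2 \<le> p" unfolding p_def using \<kappa> by simp
  have t: "- (\<gamma> + \<eta> * y) = t" using \<eta> by (simp add: y_def)
  have u_le: "u n \<le> \<kappa> * (real n)\<^sup>2 + C * (real n + 1)" for n
  proof -
    have "\<beta> * real n \<le> \<bar>\<beta>\<bar> * real n" by (intro mult_right_mono) auto
    moreover have "C * (real n + 1) = \<bar>\<beta>\<bar> * real n + \<bar>\<beta>'\<bar> * real n + \<bar>\<delta>\<bar> * real n + \<bar>\<beta>\<bar> + \<bar>\<beta>'\<bar> + \<bar>\<delta>\<bar>"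
      by (simp add: C_def algebra_simps)
    moreover have "0 \<le> \<bar>\<beta>'\<bar> * real n" "0 \<le> \<bar>\<delta>\<bar> * real n" by auto
    ultimately show ?thesis unfolding uq by linarith
  qed
  have v_ge: "\<kappa> * (real n)\<^sup>2 - C * real n \<le> v n" for n
  proof -
    have "- (\<beta>' * real n) \<le> \<bar>\<beta>'\<bar> * real n" using mult_right_mono[of "- \<beta>'" "\<bar>\<beta>'\<bar>" "real n"] by simp
    moreover have "C * real n = \<bar>\<beta>\<bar> * real n + \<bar>\<beta>'\<bar> * real n + \<bar>\<delta>\<bar> * real n"
      by (simp add: C_def algebra_simps)
    moreover have "0 \<le> \<bar>\<beta>\<bar> * real n" "0 \<le> \<bar>\<delta>\<bar> * real n" by auto
    ultimately show ?thesis unfolding vq by linarith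
  qed
  have vpos: "0 < v (Suc n)" for n
  proof -
    have "0 < l (Suc n)" using pos[of n] pos[of "Suc n"] by (simp add: zero_less_mult_iff)
    then have "0 < u n * v (Suc n)" using LU \<eta> unfolding LU_factors_def by (metis mult_pos_pos zero_less_power2)
    then show ?thesis using u[of n] by (simp add: zero_less_mult_iff)
  qed
  have u0: "u n \<noteq> 0" for n using u[of n] by simp
  define r where "r n = (- \<eta>) ^ n * poly (jpoly b l n) y / (\<Prod>j<n. u j)" for n
  note R = LU_ratio[OF LU u0 r_def, unfolded t]
  have growth: "0 < r n \<and> r n * (1 + p / real (Suc n)) \<le> r (Suc n)" for n
  proof (induction n)
    case 0
    have "p * u 0 \<le> p * C" using u_le[of 0] p by (intro mult_left_mono) auto
    also have "\<dots> \<le> t" unfolding t_def using \<kappa> p C0 by simp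
    finally have "p * u 0 \<le> u 0 * (r (Suc 0) - r 0)" unfolding R(2) using R(1) by simp
    then have "p \<le> r (Suc 0) - 1" using u[of 0] R(1) by (simp add: mult.commute)
    then show ?case using R(1) by simp
  next
    case (Suc n)
    define N where "N = real (Suc n)"
    have N: "1 \<le> N" by (simp add: N_def)
    have IH: "0 < r n" "r n * (1 + p / N) \<le> r (Suc n)" using Suc by (simp_all add: N_def)
    have rS: "0 < r (Suc n)" using IH p N by (smt (verit) divide_nonneg_pos mult_pos_pos)
    have Np: "0 < N + p" using N p by simp
    \<comment> \<open>The growth of the previous step bounds the increment relative to the newer value.\<close>
    have d: "r (Suc n) * (p / (N + p)) \<le> r (Suc n) - r n"
    proof -
      have "r n * (N + p) \<le> r (Suc n) * N" using IH(2) N by (simp add: field_simps)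
      then have "r (Suc n) * p \<le> (r (Suc n) - r n) * (N + p)" by (simp add: algebra_simps)
      then show ?thesis using Np by (simp add: pos_divide_le_eq)
    qed
    have key: "p * u (Suc n) * (N + p) \<le> t * ((N + p) * (N + 1)) + v (Suc n) * p * (N + 1)"
    proof -
      have "p * u (Suc n) * (N + p) \<le> p * (\<kappa> * N\<^sup>2 + C * (N + 1)) * (N + p)"
        using u_le[of "Suc n"] p Np unfolding N_def[symmetric] by (intro mult_right_mono mult_left_mono) auto
      moreover have "(\<kappa> * N\<^sup>2 - C * N) * (p * (N + 1)) \<le> v (Suc n) * (p * (N + 1))"
        using v_ge[of "Suc n"] p N unfolding N_def[symmetric] by (intro mult_right_mono) auto
      moreover have "t * ((N + p) * (N + 1)) + (\<kappa> * N\<^sup>2 - C * N) * (p * (N + 1)) - p * (\<kappa> * N\<^sup>2 + C * (N + 1)) * (N + p)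
        = p\<^sup>2 * \<kappa> * (N * p + N + p) + p * \<kappa> * N\<^sup>2 + p\<^sup>2 * C * (N + 1)"
        unfolding t_def by (simp add: algebra_simps power2_eq_square)
      moreover have "0 \<le> p\<^sup>2 * \<kappa> * (N * p + N + p) + p * \<kappa> * N\<^sup>2 + p\<^sup>2 * C * (N + 1)"
        using p N \<kappa> C0 by (intro add_nonneg_nonneg mult_nonneg_nonneg) auto
      ultimately show ?thesis by (simp add: mult.assoc)
    qed
    have "r (Suc n) * (p / (N + 1)) * u (Suc n) \<le> r (Suc n) * (t + v (Suc n) * (p / (N + p)))"
    proof -
      have "p / (N + 1) * u (Suc n) \<le> t + v (Suc n) * (p / (N + p))"
        using key N Np by (simp add: field_simps)
      then show ?thesis
        using mult_left_mono[OF _ less_imp_le[OF rS]] by (simp only: mult.assoc)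
    qed
    also have "\<dots> \<le> t * r (Suc n) + v (Suc n) * (r (Suc n) - r n)"
      using mult_left_mono[OF d less_imp_le[OF vpos[of n]]] by (simp add: algebra_simps)
    also have "\<dots> = (r (Suc (Suc n)) - r (Suc n)) * u (Suc n)" using R(3)[of n] by (simp add: mult.commute)
    finally have "r (Suc n) * (p / (N + 1)) \<le> r (Suc (Suc n)) - r (Suc n)"
      using u[of "Suc n"] by (simp only: mult_le_cancel_right_pos)
    then show ?case using rS by (simp add: N_def algebra_simps)
  qed
  define m where "m n = (poly (jpoly b l n) y)\<^sup>2 / jnorm l n" for n
  have mpos: "0 < m n" for n
  proof -
    have "poly (jpoly b l n) y \<noteq> 0" using growth[of n] unfolding r_def by auto
    then show ?thesis unfolding m_def using pos[of n] by simp
  qed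
  have m_Suc: "m (Suc n) = m n * ((r (Suc n) / r n)\<^sup>2 * u n / v (Suc n))" for n
  proof -
    define U where "U = (\<Prod>j<n. u j)"
    have U: "U \<noteq> 0" using u0 by (simp add: U_def)
    have rn: "r n \<noteq> 0" using growth[of n] by auto
    have Q: "poly (jpoly b l n) y = r n * U / (- \<eta>) ^ n"
      using U \<eta> by (simp add: r_def U_def)
    have Q1: "poly (jpoly b l (Suc n)) y = r (Suc n) * (U * u n) / ((- \<eta>) ^ n * (- \<eta>))"
      using U \<eta> u0 by (simp add: r_def U_def del: jpoly.simps)
    have lS: "l (Suc n) = u n * v (Suc n) / \<eta>\<^sup>2" using LU \<eta> by (simp add: LU_factors_def field_simps)
    show ?thesis
      unfolding m_def Q Q1 jnorm_Suc lS
      using U \<eta> u0[of n] rn pos[of n] vpos[of n]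
      by (simp add: power_mult_distrib power_divide power2_eq_square divide_simps)
  qed
  define a where "a = \<kappa> * (2 * p - 2) + \<beta> - \<beta>'"
  define e1 where "e1 = \<beta> * (1 + 2 * p) + \<delta> - 3 * \<kappa> - 2 * \<beta>'"
  define e0 where "e0 = \<delta> * (1 + 2 * p) - \<kappa> - \<beta>'"
  have a: "0 < a"
  proof -
    have "\<kappa> * (2 * p - 2) = 2 * \<kappa> + 2 * (\<bar>\<beta>\<bar> + \<bar>\<beta>'\<bar>)" unfolding p_def using \<kappa> by (simp add: field_simps)
    then have "a = 2 * \<kappa> + (2 * \<bar>\<beta>\<bar> + \<beta>) + (2 * \<bar>\<beta>'\<bar> - \<beta>')" by (simp add: a_def)
    then show ?thesis using \<kappa> by linarith
  qed
  obtain n0 :: nat where n0: "(\<bar>e1\<bar> + \<bar>e0\<bar>) / a + 1 \<le> real n0" using real_arch_simple by blast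
  have m_mono: "m n \<le> m (Suc n)" if "n0 \<le> n" for n
  proof -
    define x where "x = real n"
    have x: "(\<bar>e1\<bar> + \<bar>e0\<bar>) / a + 1 \<le> x" using n0 that by (simp add: x_def)
    have x1: "1 \<le> x" using x a by (smt (verit) divide_nonneg_pos abs_ge_zero)
    have "(\<bar>e1\<bar> + \<bar>e0\<bar>) / a \<le> x" using x by linarith
    then have ax: "\<bar>e1\<bar> + \<bar>e0\<bar> \<le> a * x" using a by (simp add: pos_divide_le_eq mult.commute)
    have "v (Suc n) * (x + 1) \<le> u n * (x + 1 + 2 * p)"
    proof -
      have "u n * (x + 1 + 2 * p) - v (Suc n) * (x + 1) = a * x * x + e1 * x + e0"
        unfolding uq vq x_def a_def e1_def e0_def by (simp add: algebra_simps power2_eq_square)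
      moreover have "(\<bar>e1\<bar> + \<bar>e0\<bar>) * x \<le> a * x * x" using ax x1 by (intro mult_right_mono) auto
      moreover have "- (e1 * x) \<le> \<bar>e1\<bar> * x" using mult_right_mono[of "- e1" "\<bar>e1\<bar>" x] x1 by simp
      moreover have "\<bar>e0\<bar> * 1 \<le> \<bar>e0\<bar> * x" using x1 by (intro mult_left_mono) auto
      ultimately show ?thesis by (simp add: distrib_right)
    qed
    then have "1 \<le> (1 + 2 * (p / (x + 1))) * u n / v (Suc n)"
    proof -
      assume le: "v (Suc n) * (x + 1) \<le> u n * (x + 1 + 2 * p)"
      have "0 < v (Suc n) * (x + 1)" using vpos[of n] x1 by simp
      then have "1 \<le> u n * (x + 1 + 2 * p) / (v (Suc n) * (x + 1))"
        using le by (simp only: pos_le_divide_eq mult_1)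
      also have "\<dots> = (1 + 2 * (p / (x + 1))) * u n / v (Suc n)"
        using vpos[of n] x1 by (simp add: divide_simps)
      finally show ?thesis .
    qed
    also have "\<dots> \<le> (r (Suc n) / r n)\<^sup>2 * u n / v (Suc n)"
    proof -
      have g: "1 + p / (x + 1) \<le> r (Suc n) / r n"
        using growth[of n] by (simp add: x_def pos_le_divide_eq mult.commute add.commute)
      have "1 + 2 * (p / (x + 1)) \<le> (1 + p / (x + 1))\<^sup>2" by (simp add: power2_sum)
      also have "\<dots> \<le> (r (Suc n) / r n)\<^sup>2"
        using p x1 by (intro power_mono g) auto
      finally show ?thesis
        using u[of n] vpos[of n] by (intro divide_right_mono mult_right_mono) auto
    qed
    finally have "m n * 1 \<le> m n * ((r (Suc n) / r n)\<^sup>2 * u n / v (Suc n))"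
      using mpos[of n] by (intro mult_left_mono) auto
    then show ?thesis using m_Suc[of n] by simp
  qed
  have m_ge: "m n0 \<le> m n" if "n0 \<le> n" for n
    using that by (induction n rule: dec_induct) (use m_mono order.trans in blast)+
  show ?thesis
  proof (intro exI[of _ "Complex y 1"] conjI allI)
    fix B
    obtain M :: nat where M: "B / m n0 < real M" using reals_Archimedean2 by blast
    have "B < real M * m n0" using M mpos[of n0] by (simp add: pos_divide_less_eq)
    also have "\<dots> = (\<Sum>k\<in>{n0..<n0 + M}. m n0)" by simp
    also have "\<dots> \<le> (\<Sum>k\<in>{n0..<n0 + M}. m k)" by (intro sum_mono m_ge) simp
    also have "\<dots> \<le> (\<Sum>k\<le>n0 + M. m k)"
      using mpos by (intro sum_mono2) (auto intro: less_imp_le)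
    also have "\<dots> \<le> jkernel b l (n0 + M) (Complex y 1)"
      unfolding jkernel_def m_def
    proof (intro sum_mono divide_right_mono)
      fix k
      show "(poly (jpoly b l k) y)\<^sup>2 \<le> (cmod (poly (jpoly b l k) (Complex y 1)))\<^sup>2"
        using cmod_jpoly_ge_real[OF pos, of b k y 1] by (simp add: abs_le_square_iff[symmetric])
      show "0 \<le> jnorm l k" using pos[of k] by simp
    qed
    finally show "\<exists>n. B < jkernel b l n (Complex y 1)" by blast
  qed simp
qed

section \<open>Christoffel transforms\<close>

text \<open>If the Jacobi matrix is \<open>L U\<close> up to scaling and shift, then multiplying the measure by the
affine function \<open>\<gamma> + e x\<close> replaces it by \<open>U L\<close>. The first identity is the action of \<open>L\<close> and the
second that of \<open>U\<close>.\<close>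

lemma Christoffel_transform:
  fixes x :: real
  assumes c0: "c 0 = 0"
    and b: "\<And>n. e * b n = u n + e\<^sup>2 * c n - \<gamma>" and l: "\<And>n. l (Suc n) = u n * c (Suc n)"
    and b': "\<And>n. b' n = b n + e * (c (Suc n) - c n)" and l': "\<And>n. l' (Suc n) = u (Suc n) * c (Suc n)"
  shows "poly (jpoly b l (Suc n)) x = poly (jpoly b' l' (Suc n)) x + e * c (Suc n) * poly (jpoly b' l' n) x"
    and "(\<gamma> + e * x) * poly (jpoly b' l' n) x = e * poly (jpoly b l (Suc n)) x + u n * poly (jpoly b l n) x"
proof -
  let ?P = "\<lambda>n. poly (jpoly b l n) x" and ?R = "\<lambda>n. poly (jpoly b' l' n) x"
  have "?P (Suc n) = ?R (Suc n) + e * c (Suc n) * ?R n \<and>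
     (\<gamma> + e * x) * ?R n = e * ?P (Suc n) + u n * ?P n"
  proof (induction n)
    case 0
    have "?P (Suc 0) = ?R (Suc 0) + e * c (Suc 0) * ?R 0" by (simp add: b' c0)
    moreover have "(\<gamma> + e * x) * ?R 0 = e * ?P (Suc 0) + u 0 * ?P 0"
      using b[of 0] by (simp add: c0 right_diff_distrib)
    ultimately show ?case by blast
  next
    case (Suc n)
    have IH: "?P (Suc n) = ?R (Suc n) + e * c (Suc n) * ?R n" "(\<gamma> + e * x) * ?R n = e * ?P (Suc n) + u n * ?P n"
      using Suc by blast+
    define p0 where "p0 = ?P n"
    define p1 where "p1 = ?P (Suc n)"
    define r0 where "r0 = ?R n"
    define r1 where "r1 = ?R (Suc n)"
    have r1: "r1 = p1 - e * c (Suc n) * r0" using IH(1) by (simp add: p1_def r1_def r0_def)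
    have ar: "(\<gamma> + e * x) * r0 = e * p1 + u n * p0" using IH(2) by (simp add: p1_def p0_def r0_def)
    have P2: "?P (Suc (Suc n)) = (x - b (Suc n)) * p1 - u n * c (Suc n) * p0"
      unfolding poly_jpoly_Suc_Suc l by (simp add: p1_def p0_def)
    have R2: "?R (Suc (Suc n)) = (x - b (Suc n) - e * (c (Suc (Suc n)) - c (Suc n))) * r1 - u (Suc n) * c (Suc n) * r0"
      unfolding poly_jpoly_Suc_Suc l'[of n] b'[of "Suc n"] by (simp add: r1_def r0_def)
    have eb: "e * b (Suc n) = u (Suc n) + e\<^sup>2 * c (Suc n) - \<gamma>" by (rule b)
    have "(\<gamma> + e * x) * r1 = e * ((x - b (Suc n)) * p1 - u n * c (Suc n) * p0) + u (Suc n) * p1"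
    proof -
      have "(\<gamma> + e * x) * r1 = (\<gamma> + e * x) * p1 - e * c (Suc n) * ((\<gamma> + e * x) * r0)"
        unfolding r1 by (simp add: algebra_simps)
      also have "\<dots> = (\<gamma> + e * x - e\<^sup>2 * c (Suc n)) * p1 - e * c (Suc n) * u n * p0"
        unfolding ar by (simp add: algebra_simps power2_eq_square)
      also have "\<gamma> + e * x - e\<^sup>2 * c (Suc n) = u (Suc n) + e * x - e * b (Suc n)" unfolding eb by simp
      finally show ?thesis by (simp add: algebra_simps)
    qed
    then have B: "(\<gamma> + e * x) * ?R (Suc n) = e * ?P (Suc (Suc n)) + u (Suc n) * ?P (Suc n)"
      unfolding P2 by (simp add: r1_def p1_def)
    have "(x - b (Suc n)) * p1 - u n * c (Suc n) * p0
       - ((x - b (Suc n) - e * (c (Suc (Suc n)) - c (Suc n))) * r1 - u (Suc n) * c (Suc n) * r0 + e * c (Suc (Suc n)) * r1)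
       = c (Suc n) * (e * x * r0 - e * b (Suc n) * r0 - u n * p0 - e * r1 + u (Suc n) * r0)"
      unfolding r1 by (simp add: algebra_simps)
    also have "e * x * r0 - e * b (Suc n) * r0 - u n * p0 - e * r1 + u (Suc n) * r0 = (\<gamma> + e * x) * r0 - u n * p0 - e * p1"
      unfolding eb r1 by (simp add: algebra_simps power2_eq_square)
    also have "\<dots> = 0" unfolding ar by simp
    finally have A: "?P (Suc (Suc n)) = ?R (Suc (Suc n)) + e * c (Suc (Suc n)) * ?R (Suc n)"
      unfolding P2 R2 r1_def[symmetric] by simp
    show ?case using A B by blast
  qed
  then show "?P (Suc n) = ?R (Suc n) + e * c (Suc n) * ?R n"
    "(\<gamma> + e * x) * ?R n = e * ?P (Suc n) + u n * ?P n" by blast+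
qed

section \<open>Arithmetic of q-numbers\<close>

lemma qnum_0 [simp]: "qnum q 0 = 0" by (simp add: qnum_def)

lemma qnum_Suc: "qnum q (Suc n) = qnum q n + q ^ n" by (simp add: qnum_def)

lemma qnum_Suc': "qnum q (Suc n) = 1 + q * qnum q n"
  unfolding qnum_def by (simp add: sum.lessThan_Suc_shift sum_distrib_left del: sum.lessThan_Suc)

lemma qnum_power: "q ^ n = 1 - (1 - q) * qnum q n"
  using qnum_Suc[of q n] qnum_Suc'[of q n] by (simp add: algebra_simps)

lemma qnum_add: "qnum q (m + n) = qnum q m + q ^ m * qnum q n"
  by (induction n) (simp_all add: qnum_Suc power_add algebra_simps)

lemma qnum_nonneg: "0 \<le> q \<Longrightarrow> 0 \<le> qnum q n"
  unfolding qnum_def by (intro sum_nonneg) simp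

lemma qnum_pos: "0 \<le> q \<Longrightarrow> 0 < qnum q (Suc n)"
  using qnum_nonneg[of q n] by (simp add: qnum_Suc' add_pos_nonneg)

lemma qnum_le: "0 \<le> q \<Longrightarrow> q \<le> 1 \<Longrightarrow> qnum q n \<le> real n"
  unfolding qnum_def using sum_mono[of "{..<n}" "\<lambda>k. q ^ k" "\<lambda>_. 1"] by (simp add: power_le_one)

lemma qnum_le_geometric: "0 \<le> q \<Longrightarrow> q < 1 \<Longrightarrow> qnum q n \<le> 1 / (1 - q)"
  using qnum_power[of q n] by (simp add: pos_le_divide_eq mult.commute) (metis diff_ge_0_iff_ge zero_le_power le_diff_eq add.commute add_0)

lemma qnum_1 [simp]: "qnum 1 n = real n" by (simp add: qnum_def)

definition qfactorial :: "real \<Rightarrow> nat \<Rightarrow> real" where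
  "qfactorial q n = (\<Prod>j<n. qnum q (Suc j))"

lemma qfactorial_0 [simp]: "qfactorial q 0 = 1" by (simp add: qfactorial_def)

lemma qfactorial_Suc: "qfactorial q (Suc n) = qfactorial q n * qnum q (Suc n)" by (simp add: qfactorial_def)

lemma qfactorial_pos: "0 \<le> q \<Longrightarrow> 0 < qfactorial q n"
  unfolding qfactorial_def by (intro prod_pos) (simp add: qnum_pos)

section \<open>The levels of the family\<close>

text \<open>The fixed data of the family: the parameters and the earlier time \<open>s\<close>. The later time and the
starting point are arguments.\<close>

locale harness =
  fixes \<eta> \<theta> \<tau> q s :: real
  assumes q: "0 \<le> q" "q \<le> 1" and \<eta>\<theta>: "0 \<le> \<eta> * \<theta>" and \<tau>: "0 \<le> \<tau>" and s: "0 \<le> s"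
begin

text \<open>For \<open>\<eta> \<noteq> 0\<close> this is \<open>\<eta> a\<^sub>n\<close>. Unlike \<open>a\<^sub>n\<close> it makes sense for \<open>\<eta> = 0\<close>,
and it is at least \<open>1\<close>.\<close>

definition A :: "nat \<Rightarrow> real" where
  "A n = 1 + \<eta> * \<theta> * qnum q n + \<eta>\<^sup>2 * \<tau> * (qnum q n)\<^sup>2"

text \<open>For \<open>\<eta> \<noteq> 0\<close> this is \<open>c\<^sub>n(s)/\<eta>\<close>.\<close>

definition c :: "nat \<Rightarrow> real" where
  "c n = (s + \<tau> * qnum q (n - 1)) * qnum q n"

text \<open>For \<open>\<eta> q\<^sup>k \<noteq> 0\<close> the zero of this affine function is the base point of the LU factorisation at level
\<open>k\<close>; it is also the only factor of the off-diagonal recurrence coefficients of \<open>\<nu>\<^sub>x\<close> that depends on \<open>x\<close>.\<close>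

definition \<alpha> :: "nat \<Rightarrow> real \<Rightarrow> real" where
  "\<alpha> k x = 1 + \<eta> * x * q ^ k + qnum q k * \<eta> * (\<theta> + qnum q k * \<eta> * \<tau> - s * \<eta> * q ^ k)"

text \<open>Recurrence coefficients after \<open>k\<close> Christoffel transforms, that is, for the measure
\<open>\<alpha>\<^sub>0 \<dots> \<alpha>\<^sub>k\<^sub>-\<^sub>1 \<mu>\<^sub>s\<close>. Level \<open>0\<close> is the original family.\<close>

definition b_level :: "nat \<Rightarrow> nat \<Rightarrow> real" where
  "b_level k n = \<theta> * qnum q n + \<eta> * \<tau> * (2 * qnum q k * qnum q n + q ^ k * (qnum q n)\<^sup>2)
     + q ^ k * \<eta> * c n + s * \<eta> * qnum q k"

definition l_level :: "nat \<Rightarrow> nat \<Rightarrow> real" where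
  "l_level k n = A (n + k - 1) * c n"

abbreviation P :: "nat \<Rightarrow> nat \<Rightarrow> real poly" where
  "P k n \<equiv> jpoly (b_level k) (l_level k) n"

lemma A_ge_1: "1 \<le> A n"
  unfolding A_def using q \<eta>\<theta> \<tau> qnum_nonneg[of q n] by simp

lemma c_0 [simp]: "c 0 = 0" by (simp add: c_def)

lemma c_nonneg: "0 \<le> c n"
  unfolding c_def using q \<tau> s qnum_nonneg by (intro mult_nonneg_nonneg add_nonneg_nonneg) auto

text \<open>Every level again has an LU factorisation, with upper factor \<open>A\<close> shifted by \<open>k\<close> and lower
factor \<open>c\<close> rescaled by a power of \<open>q\<close>. This stability under the Christoffel transform makes the iteration
possible.\<close>

lemma b_level_LU: "\<eta> * q ^ k * b_level k n = A (n + k) + (\<eta> * q ^ k)\<^sup>2 * c n - \<alpha> k 0"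
proof -
  have nk: "qnum q (n + k) = qnum q k + q ^ k * qnum q n" by (subst add.commute) (rule qnum_add)
  show ?thesis unfolding b_level_def A_def \<alpha>_def nk by (simp add: algebra_simps power2_eq_square)
qed

lemma b_level_Suc: "b_level (Suc k) n = b_level k n + \<eta> * q ^ k * (c (Suc n) - c n)"
proof (cases n)
  case 0
  then show ?thesis by (simp add: b_level_def c_def qnum_Suc algebra_simps)
next
  case (Suc m)
  define M where "M = qnum q m"
  have N: "qnum q (Suc m) = 1 + q * M" "qnum q (Suc (Suc m)) = 1 + q * (1 + q * M)" by (simp_all add: qnum_Suc' M_def)
  show ?thesis
    unfolding Suc b_level_def c_def diff_Suc_1 M_def[symmetric] N qnum_Suc[of q k] power_Suc
    by (simp add: algebra_simps power2_eq_square)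
qed

lemma \<alpha>_affine: "\<alpha> k x = \<alpha> k 0 + \<eta> * q ^ k * x"
  by (simp add: \<alpha>_def)

lemma P_Suc_level: "poly (P k (Suc n)) x = poly (P (Suc k) (Suc n)) x + \<eta> * q ^ k * c (Suc n) * poly (P (Suc k) n) x"
  and \<alpha>_times_P: "\<alpha> k x * poly (P (Suc k) n) x = \<eta> * q ^ k * poly (P k (Suc n)) x + A (n + k) * poly (P k n) x"
proof -
  have l: "l_level k (Suc n) = A (n + k) * c (Suc n)" "l_level (Suc k) (Suc n) = A (Suc n + k) * c (Suc n)" for n
    by (simp_all add: l_level_def)
  note C = Christoffel_transform[of c "\<eta> * q ^ k" "b_level k" "\<lambda>n. A (n + k)" "\<alpha> k 0" "l_level k" "b_level (Suc k)" "l_level (Suc k)",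
      OF c_0 b_level_LU l(1) b_level_Suc l(2)]
  show "poly (P k (Suc n)) x = poly (P (Suc k) (Suc n)) x + \<eta> * q ^ k * c (Suc n) * poly (P (Suc k) n) x"
    by (rule C(1))
  show "\<alpha> k x * poly (P (Suc k) n) x = \<eta> * q ^ k * poly (P k (Suc n)) x + A (n + k) * poly (P k n) x"
    unfolding \<alpha>_affine[of k x] by (rule C(2))
qed

end

section \<open>The connection formula\<close>

lemma pbar_eq_jpoly: "pbar \<eta> \<theta> \<tau> q t n = jpoly (b_coeff \<eta> \<theta> \<tau> q t) (ac_coeff \<eta> \<theta> \<tau> q t) n"
  by (induction n rule: induct_nat_012) simp_all

lemma jpoly_cong:
  assumes "\<And>n. b n = b' n" "\<And>n. l (Suc n) = l' (Suc n)"
  shows "jpoly b l n = jpoly b' l' n"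
  by (induction n rule: induct_nat_012) (simp_all add: assms)

context harness
begin

lemma ac_coeff_eq: "ac_coeff \<eta> \<theta> \<tau> q t n = A (n - 1) * ((t + \<tau> * qnum q (n - 1)) * qnum q n)"
  unfolding ac_coeff_def a_coeff_def c_coeff_def A_def
  by (auto simp: field_simps power2_eq_square)

lemma pbar_eq_P: "pbar \<eta> \<theta> \<tau> q s n = P 0 n"
  unfolding pbar_eq_jpoly
proof (rule jpoly_cong)
  show "b_coeff \<eta> \<theta> \<tau> q s n = b_level 0 n" for n
    by (simp add: b_coeff_def b_level_def c_def algebra_simps power2_eq_square)
  show "ac_coeff \<eta> \<theta> \<tau> q s (Suc n) = l_level 0 (Suc n)" for n
    unfolding ac_coeff_eq l_level_def c_def by simp
qed

text \<open>\<open>B\<close> and \<open>\<Lambda>\<close> are the recurrence coefficients of the orthogonal polynomials of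
\<open>\<nu>\<^sub>x\<close>.\<close>

definition B :: "real \<Rightarrow> real \<Rightarrow> nat \<Rightarrow> real" where
  "B t x n = q ^ n * x + qnum q n * (t * \<eta> + \<theta> + (qnum q n + qnum q (n - 1)) * \<eta> * \<tau> - (q ^ n + q ^ (n - 1)) * s * \<eta>)"

definition C :: "real \<Rightarrow> nat \<Rightarrow> real" where
  "C t n = (t - s * q ^ (n - 1) + \<tau> * qnum q (n - 1)) * qnum q n"

definition \<Lambda> :: "real \<Rightarrow> real \<Rightarrow> nat \<Rightarrow> real" where
  "\<Lambda> t x n = C t n * \<alpha> (n - 1) x"

text \<open>A \<open>q\<close>-binomial coefficient times a polynomial of the Christoffel-transformed family at level
\<open>k\<close>; these are the coefficients of \<^term>\<open>pbar \<eta> \<theta> \<tau> q t n\<close> in the orthogonal polynomials of \<open>\<nu>\<^sub>x\<close>.\<close>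

definition connection :: "real \<Rightarrow> nat \<Rightarrow> nat \<Rightarrow> real" where
  "connection x n k = (if k \<le> n then qfactorial q n / (qfactorial q k * qfactorial q (n - k)) * poly (P k (n - k)) x else 0)"

lemma connection_0: "connection x n 0 = poly (pbar \<eta> \<theta> \<tau> q s n) x"
  using qfactorial_pos[OF q(1), of n] by (simp add: connection_def pbar_eq_P)

lemma connection_diag: "connection x n n = 1"
  using qfactorial_pos[OF q(1), of n] by (simp add: connection_def)

text \<open>The coefficient of \<open>P k m\<close> in the connection recurrence. After \<open>q ^ (k - 1)\<close> is expressed
by \<open>qnum q (k - 1)\<close>, it is a polynomial identity.\<close>

lemma B_identity:
  "\<eta> * q ^ (k - 1) * qnum q k * (s + \<tau> * qnum q m) + (B t x k - b_coeff \<eta> \<theta> \<tau> q t (m + k))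
     + qnum q m * (t - s * q ^ k + \<tau> * qnum q k) * \<eta> * q ^ k = q ^ k * (x - b_level k m)"
proof (cases k)
  case 0
  then show ?thesis
    by (simp add: B_def b_coeff_def b_level_def c_def algebra_simps power2_eq_square)
next
  case (Suc k')
  define X where "X = qnum q k'"
  have k: "qnum q (Suc k') = 1 + q * X" and a: "q ^ k' = 1 - (1 - q) * X"
    using qnum_power[of q k'] by (simp_all add: qnum_Suc' X_def)
  have nk: "qnum q (m + Suc k') = 1 + q * X + q * (1 - (1 - q) * X) * qnum q m"
    using qnum_add[of q "Suc k'" m] by (simp add: k a add.commute)
  have nk': "qnum q (m + Suc k' - 1) = X + (1 - (1 - q) * X) * qnum q m"
    using qnum_add[of q "k'" m] by (simp add: a X_def add.commute)
  show ?thesis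
  proof (cases m)
    case 0
    show ?thesis
      using nk nk'
      unfolding Suc B_def b_coeff_def b_level_def c_def power_Suc diff_Suc_1 X_def[symmetric] k a 0
      by (simp add: k a X_def[symmetric] algebra_simps power2_eq_square)
  next
    case m: (Suc m')
    define M where "M = qnum q m'"
    have M: "qnum q (Suc m') = 1 + q * M" by (simp add: qnum_Suc' M_def)
    show ?thesis
      unfolding Suc B_def b_coeff_def b_level_def c_def nk nk' power_Suc diff_Suc_1 X_def[symmetric] k a
      unfolding m M diff_Suc_1 M_def[symmetric]
      by (simp add: algebra_simps power2_eq_square)
  qed
qed

text \<open>Write \<open>n = m + k\<close>. The two identities between consecutive levels move the neighbours at levels
\<open>k - 1\<close> and \<open>k + 1\<close> to level \<open>k\<close>; what remains is the three-term recurrence of level \<open>k\<close> at \<open>x\<close>,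
multiplied by \<open>q ^ k\<close>.\<close>

lemma connection_recurrence:
  assumes "k \<le> Suc n"
  shows "connection x (Suc n) k = (if k = 0 then 0 else connection x n (k - 1))
     + (B t x k - b_coeff \<eta> \<theta> \<tau> q t n) * connection x n k + \<Lambda> t x (Suc k) * connection x n (Suc k)
     - (if n = 0 then 0 else ac_coeff \<eta> \<theta> \<tau> q t n * connection x (n - 1) k)"
proof (cases "k = Suc n")
  case True
  then show ?thesis using connection_diag[of x n] connection_diag[of x "Suc n"]
    by (simp add: connection_def)
next
  case False
  define m where "m = n - k"
  have n: "n = m + k" using assms False by (simp add: m_def)
  have F: "qfactorial q i \<noteq> 0" for i using qfactorial_pos[OF q(1), of i] by simp
  have G: "qnum q (Suc i) \<noteq> 0" for i using qnum_pos[OF q(1), of i] by simp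
  \<comment> \<open>The common q-binomial factor; the neighbours differ from it by quotients of q-numbers.\<close>
  define W where "W = qfactorial q n / (qfactorial q k * qfactorial q m)"
  define p where "p = poly (P k m) x"
  define p1 where "p1 = poly (P k (Suc m)) x"
  \<comment> \<open>The value of the predecessor, zero for m = 0.\<close>
  define p0 where "p0 = (if m = 0 then 0 else poly (P k (m - 1)) x)"
  have rec: "p1 = (x - b_level k m) * p - A (n - 1) * (s + \<tau> * qnum q (m - 1)) * qnum q m * p0"
  proof (cases m)
    case (Suc m')
    then show ?thesis using n unfolding p1_def p_def p0_def Suc poly_jpoly_Suc_Suc
      by (simp add: l_level_def c_def del: jpoly.simps)
  qed (simp add: p1_def p_def)
  have e: "connection x n k = W * p" by (simp add: connection_def W_def p_def n)
  have e1: "connection x (Suc n) k = W * (qnum q (Suc n) / qnum q (Suc m)) * p1"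
    using F G by (simp add: connection_def W_def p1_def n qfactorial_Suc Suc_diff_le)
  have e2: "(if k = 0 then 0 else connection x n (k - 1))
     = W * (qnum q k / qnum q (Suc m)) * (p1 + \<eta> * q ^ (k - 1) * ((s + \<tau> * qnum q m) * qnum q (Suc m)) * p)"
  proof (cases k)
    case (Suc k')
    have "poly (P k' (Suc m)) x = p1 + \<eta> * q ^ k' * ((s + \<tau> * qnum q m) * qnum q (Suc m)) * p"
      using P_Suc_level[of k' m x] by (simp add: p1_def p_def Suc c_def)
    moreover have "connection x n k' = W * (qnum q k / qnum q (Suc m)) * poly (P k' (Suc m)) x"
      using F G by (simp add: connection_def W_def n Suc qfactorial_Suc Suc_diff_le)
    ultimately show ?thesis by (simp add: Suc)
  qed simp
  have e3: "\<Lambda> t x (Suc k) * connection x n (Suc k)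
     = W * qnum q m * (t - s * q ^ k + \<tau> * qnum q k) * (\<eta> * q ^ k * p + A (n - 1) * p0)"
  proof (cases m)
    case 0
    then show ?thesis by (simp add: connection_def n)
  next
    case (Suc m')
    have "\<alpha> k x * poly (P (Suc k) m') x = \<eta> * q ^ k * p + A (n - 1) * p0"
      unfolding \<alpha>_times_P by (simp add: p_def p0_def Suc n)
    moreover have "connection x n (Suc k) = W * (qnum q m / qnum q (Suc k)) * poly (P (Suc k) m') x"
      using F G by (simp add: connection_def W_def n Suc qfactorial_Suc)
    ultimately show ?thesis
      using G[of k] by (simp add: \<Lambda>_def C_def)
  qed
  have e4: "(if n = 0 then 0 else ac_coeff \<eta> \<theta> \<tau> q t n * connection x (n - 1) k)
     = W * qnum q m * A (n - 1) * (t + \<tau> * qnum q (n - 1)) * p0"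
  proof (cases m)
    case 0
    then show ?thesis by (auto simp: connection_def n p0_def)
  next
    case (Suc m')
    have "connection x (n - 1) k = W * (qnum q m / qnum q n) * p0"
      using F G by (simp add: connection_def W_def n Suc qfactorial_Suc p0_def)
    then show ?thesis using G[of "m' + k"] by (simp add: ac_coeff_eq n Suc)
  qed
  have nS: "qnum q (Suc n) = qnum q k + q ^ k * qnum q (Suc m)"
    using qnum_add[of q k "Suc m"] by (simp add: n add.commute)
  have n1: "qnum q m * qnum q (n - 1) = qnum q m * (qnum q k + q ^ k * qnum q (m - 1))"
  proof (cases m)
    case (Suc m')
    then show ?thesis using qnum_add[of q k m'] by (simp add: n add.commute)
  qed simp
  \<comment> \<open>Abstracting this denominator leaves an identity that is linear in p, p1 and p0.\<close>
  define g where "g = qnum q (Suc m)"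
  have g: "g \<noteq> 0" unfolding g_def by (rule G)
  have "W * ((qnum q k + q ^ k * g) / g) * p1 - W * (qnum q k / g) * (p1 + \<eta> * q ^ (k - 1) * ((s + \<tau> * qnum q m) * g) * p)
      = W * (q ^ k * p1 - \<eta> * q ^ (k - 1) * qnum q k * (s + \<tau> * qnum q m) * p)"
    using g by (simp add: field_simps)
  also have "q ^ k * p1 = q ^ k * (x - b_level k m) * p - q ^ k * (A (n - 1) * (s + \<tau> * qnum q (m - 1)) * qnum q m * p0)"
    unfolding rec by (simp add: algebra_simps)
  also have "q ^ k * (x - b_level k m) = \<eta> * q ^ (k - 1) * qnum q k * (s + \<tau> * qnum q m) + (B t x k - b_coeff \<eta> \<theta> \<tau> q t n)
     + qnum q m * (t - s * q ^ k + \<tau> * qnum q k) * \<eta> * q ^ k"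
    using B_identity[of k m t x] by (simp add: n)
  finally have main: "W * ((qnum q k + q ^ k * g) / g) * p1 - W * (qnum q k / g) * (p1 + \<eta> * q ^ (k - 1) * ((s + \<tau> * qnum q m) * g) * p)
    = W * ((B t x k - b_coeff \<eta> \<theta> \<tau> q t n) * p + qnum q m * (t - s * q ^ k + \<tau> * qnum q k) * \<eta> * q ^ k * p
       - q ^ k * (A (n - 1) * (s + \<tau> * qnum q (m - 1)) * qnum q m * p0))"
    by (simp add: algebra_simps)
  have tail: "W * qnum q m * A (n - 1) * (t + \<tau> * qnum q (n - 1)) * p0
     = W * A (n - 1) * p0 * (t * qnum q m + \<tau> * (qnum q m * (qnum q k + q ^ k * qnum q (m - 1))))"
    unfolding n1[symmetric] by (simp add: algebra_simps)
  show ?thesis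
    unfolding e e1 e2 e3 e4 nS g_def[symmetric] tail using main by (simp add: algebra_simps)
qed

text \<open>The coefficient recurrence says that the right side satisfies the recurrence of the left side.\<close>

lemma pbar_connection:
  "pbar \<eta> \<theta> \<tau> q t n = (\<Sum>k\<le>n. smult (connection x n k) (jpoly (B t x) (\<Lambda> t x) k))"
proof -
  let ?b = "b_coeff \<eta> \<theta> \<tau> q t" and ?l = "ac_coeff \<eta> \<theta> \<tau> q t"
  let ?J = "\<lambda>k y. poly (jpoly (B t x) (\<Lambda> t x) k) y" and ?p = "\<lambda>n y. poly (pbar \<eta> \<theta> \<tau> q t n) y"
  have step: "(\<Sum>k\<le>Suc n. connection x (Suc n) k * ?J k y)
     = (y - ?b n) * (\<Sum>k\<le>n. connection x n k * ?J k y) - (if n = 0 then 0 else ?l n * (\<Sum>k\<le>n - 1. connection x (n - 1) k * ?J k y))" for n y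
  proof -
    let ?e = "connection x n"
    have z: "?e (Suc n) = 0" "?e (Suc (Suc n)) = 0" by (simp_all add: connection_def)
    have "(y - ?b n) * (\<Sum>k\<le>n. ?e k * ?J k y)
       = (\<Sum>k\<le>n. ?e k * ?J (Suc k) y) + (\<Sum>k\<le>n. (B t x k - ?b n) * ?e k * ?J k y)
         + (\<Sum>k\<le>n. if k = 0 then 0 else \<Lambda> t x k * ?e k * ?J (k - 1) y)"
    proof -
      have "(y - ?b n) * (?e k * ?J k y) = ?e k * ?J (Suc k) y + (B t x k - ?b n) * ?e k * ?J k y
          + (if k = 0 then 0 else \<Lambda> t x k * ?e k * ?J (k - 1) y)" for k
      proof -
        have "(y - ?b n) * (?e k * ?J k y) = ?e k * (y * ?J k y) - ?b n * ?e k * ?J k y" by (simp add: algebra_simps)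
        then show ?thesis unfolding times_jpoly by (simp add: algebra_simps del: jpoly.simps)
      qed
      then show ?thesis unfolding sum_distrib_left by (simp only: sum.distrib)
    qed
    also have "(\<Sum>k\<le>n. ?e k * ?J (Suc k) y) = (\<Sum>k\<le>Suc n. (if k = 0 then 0 else ?e (k - 1)) * ?J k y)"
      unfolding sum.atMost_Suc_shift by (simp del: jpoly.simps)
    also have "(\<Sum>k\<le>n. (B t x k - ?b n) * ?e k * ?J k y) = (\<Sum>k\<le>Suc n. (B t x k - ?b n) * ?e k * ?J k y)"
      using z by simp
    also have "(\<Sum>k\<le>n. if k = 0 then 0 else \<Lambda> t x k * ?e k * ?J (k - 1) y)
       = (\<Sum>k\<le>Suc (Suc n). if k = 0 then 0 else \<Lambda> t x k * ?e k * ?J (k - 1) y)"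
      using z by simp
    also have "\<dots> = (\<Sum>k\<le>Suc n. \<Lambda> t x (Suc k) * ?e (Suc k) * ?J k y)"
      by (subst sum.atMost_Suc_shift) simp
    finally have 1: "(y - ?b n) * (\<Sum>k\<le>n. ?e k * ?J k y)
       = (\<Sum>k\<le>Suc n. ((if k = 0 then 0 else ?e (k - 1)) + (B t x k - ?b n) * ?e k + \<Lambda> t x (Suc k) * ?e (Suc k)) * ?J k y)"
      by (simp only: sum.distrib[symmetric] distrib_right)
    have 2: "(if n = 0 then 0 else ?l n * (\<Sum>k\<le>n - 1. connection x (n - 1) k * ?J k y))
       = (\<Sum>k\<le>Suc n. (if n = 0 then 0 else ?l n * connection x (n - 1) k) * ?J k y)"
    proof (cases n)
      case (Suc m)
      have "connection x m (Suc m) = 0" "connection x m (Suc (Suc m)) = 0" by (simp_all add: connection_def)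
      then show ?thesis by (simp add: Suc sum_distrib_left algebra_simps del: jpoly.simps)
    qed simp
    show ?thesis
      unfolding 1 2 sum_subtractf[symmetric] left_diff_distrib[symmetric]
      by (intro sum.cong refl) (subst connection_recurrence[of _ n x t], simp, simp only:)
  qed
  have "?p n y = (\<Sum>k\<le>n. connection x n k * ?J k y)" for y
  proof (induction n rule: induct_nat_012)
    case 0
    then show ?case using connection_diag[of x 0] by simp
  next
    case 1
    show ?case unfolding step using connection_diag[of x 0] by simp
  next
    case (ge2 n)
    have "?p (Suc (Suc n)) y = (y - ?b (Suc n)) * ?p (Suc n) y - ?l (Suc n) * ?p n y"
      by (simp add: algebra_simps)
    then show ?case unfolding step ge2 by (simp del: jpoly.simps sum.atMost_Suc)
  qed
  then have "poly (pbar \<eta> \<theta> \<tau> q t n) = poly (\<Sum>k\<le>n. smult (connection x n k) (jpoly (B t x) (\<Lambda> t x) k))"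
    by (intro ext) (simp add: poly_sum)
  then show ?thesis by (simp only: poly_eq_poly_eq_iff)
qed

section \<open>Growth of the coefficients and positivity on the support\<close>

lemma qnum_bounds: "0 \<le> qnum q n" "qnum q n \<le> real n" "0 \<le> q ^ n" "q ^ n \<le> 1"
  using qnum_nonneg[of q n] qnum_le[of q n] q by (auto simp: power_le_one)

text \<open>Common shape of \<open>A\<close> and \<open>\<alpha>\<close>, so that one growth estimate serves the
recurrence coefficients of \<open>\<mu>\<^sub>s\<close> and of \<open>\<nu>\<^sub>x\<close>.\<close>

definition qquad :: "real \<Rightarrow> real \<Rightarrow> nat \<Rightarrow> real" where
  "qquad a d n = 1 + a * q ^ n + qnum q n * \<eta> * (\<theta> + qnum q n * \<eta> * \<tau> - d * q ^ n)"

lemma A_eq_qquad: "A n = qquad 0 0 n"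
  by (simp add: A_def qquad_def algebra_simps power2_eq_square)

lemma \<alpha>_eq_qquad: "\<alpha> n x = qquad (\<eta> * x) (s * \<eta>) n"
  by (simp add: \<alpha>_def qquad_def)

lemma qquad_le:
  assumes X: "qnum q n \<le> X"
  shows "qquad a d n \<le> 1 + \<bar>a\<bar> + X * \<bar>\<eta>\<bar> * (\<bar>\<theta>\<bar> + X * \<bar>\<eta>\<bar> * \<tau> + \<bar>d\<bar>)"
proof -
  note Q = qnum_bounds[of n]
  have X0: "0 \<le> X" using X Q(1) by linarith
  have abs_pow: "\<bar>z * q ^ n\<bar> \<le> \<bar>z\<bar>" for z
    unfolding abs_mult using Q by (simp add: mult_left_le)
  have "\<bar>\<theta> + qnum q n * \<eta> * \<tau> - d * q ^ n\<bar> \<le> \<bar>\<theta>\<bar> + \<bar>qnum q n * \<eta> * \<tau>\<bar> + \<bar>d\<bar>"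
    using abs_pow[of d] by linarith
  also have "\<bar>qnum q n * \<eta> * \<tau>\<bar> = qnum q n * (\<bar>\<eta>\<bar> * \<tau>)" using Q \<tau> by (simp add: abs_mult)
  also have "\<dots> \<le> X * (\<bar>\<eta>\<bar> * \<tau>)" using X \<tau> by (intro mult_right_mono) auto
  finally have in': "\<bar>\<theta> + qnum q n * \<eta> * \<tau> - d * q ^ n\<bar> \<le> \<bar>\<theta>\<bar> + X * \<bar>\<eta>\<bar> * \<tau> + \<bar>d\<bar>" by (simp add: mult.assoc)
  have "qnum q n * \<eta> * (\<theta> + qnum q n * \<eta> * \<tau> - d * q ^ n)
      \<le> \<bar>qnum q n * \<eta> * (\<theta> + qnum q n * \<eta> * \<tau> - d * q ^ n)\<bar>" by (rule abs_ge_self)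
  also have "\<dots> = qnum q n * \<bar>\<eta>\<bar> * \<bar>\<theta> + qnum q n * \<eta> * \<tau> - d * q ^ n\<bar>"
    using Q by (simp add: abs_mult)
  also have "\<dots> \<le> X * \<bar>\<eta>\<bar> * (\<bar>\<theta>\<bar> + X * \<bar>\<eta>\<bar> * \<tau> + \<bar>d\<bar>)"
    using in' X X0 by (intro mult_mono) auto
  finally show ?thesis unfolding qquad_def using abs_pow[of a] by linarith
qed

text \<open>For \<open>q < 1\<close> both factors are bounded. Otherwise one of \<open>\<eta>\<close> and \<open>\<tau>\<close> is zero, and then either
the first factor is bounded while the second grows quadratically, or both grow linearly.\<close>

lemma quadratic_growth:
  assumes case_asm: "q < 1 \<or> \<eta> * \<tau> = 0" and T: "0 \<le> T"
  shows "\<exists>K. \<forall>n w. 0 \<le> w \<longrightarrow> w \<le> (T + \<tau> * qnum q n) * qnum q (Suc n) \<longrightarrow>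
    qquad a d (n + k) * w \<le> K * (real (Suc n))\<^sup>2"
proof -
  consider "q < 1" | "\<eta> = 0" | "\<tau> = 0" using case_asm by auto
  then show ?thesis
  proof cases
    case 1
    define R where "R = 1 / (1 - q)"
    have R: "qnum q n \<le> R" for n using qnum_le_geometric[OF q(1) 1] by (simp add: R_def)
    have R0: "0 \<le> R" using 1 by (simp add: R_def)
    define U where "U = 1 + \<bar>a\<bar> + R * \<bar>\<eta>\<bar> * (\<bar>\<theta>\<bar> + R * \<bar>\<eta>\<bar> * \<tau> + \<bar>d\<bar>)"
    define V where "V = (T + \<tau> * R) * R"
    have U0: "0 \<le> U" unfolding U_def using R0 \<tau> by (intro add_nonneg_nonneg mult_nonneg_nonneg) auto
    have V0: "0 \<le> V" unfolding V_def using R0 T \<tau> by simp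
    show ?thesis
    proof (intro exI allI impI)
      fix n w assume w: "0 \<le> w" "w \<le> (T + \<tau> * qnum q n) * qnum q (Suc n)"
      have "w \<le> V" unfolding V_def
        by (rule order.trans[OF w(2)], intro mult_mono add_left_mono mult_left_mono R)
          (use T \<tau> R0 qnum_bounds in auto)
      moreover have "qquad a d (n + k) \<le> U" unfolding U_def by (rule qquad_le[OF R])
      ultimately have "qquad a d (n + k) * w \<le> U * V" using w U0 by (intro mult_mono) auto
      also have "\<dots> = U * V * 1" by simp
      also have "\<dots> \<le> U * V * (real (Suc n))\<^sup>2"
        using U0 V0 by (intro mult_left_mono one_le_power) auto
      finally show "qquad a d (n + k) * w \<le> U * V * (real (Suc n))\<^sup>2" .
    qed
  next
    case 2
    show ?thesis
    proof (intro exI allI impI)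
      fix n w assume w: "0 \<le> w" "w \<le> (T + \<tau> * qnum q n) * qnum q (Suc n)"
      have "T + \<tau> * qnum q n \<le> T * real (Suc n) + \<tau> * real (Suc n)"
        using T \<tau> qnum_bounds(2)[of n] by (intro add_mono mult_left_mono) (auto simp: mult_le_cancel_left1)
      then have "T + \<tau> * qnum q n \<le> (T + \<tau>) * real (Suc n)" by (simp add: distrib_right)
      then have "(T + \<tau> * qnum q n) * qnum q (Suc n) \<le> (T + \<tau>) * real (Suc n) * real (Suc n)"
        using T \<tau> qnum_bounds[of "Suc n"] by (intro mult_mono) auto
      then have w': "w \<le> (T + \<tau>) * (real (Suc n))\<^sup>2" using w(2) by (simp add: power2_eq_square mult.assoc)
      have "qquad a d (n + k) \<le> 1 + \<bar>a\<bar>" using qquad_le[OF order.refl, of a d "n + k"] 2 by simp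
      then have "qquad a d (n + k) * w \<le> (1 + \<bar>a\<bar>) * ((T + \<tau>) * (real (Suc n))\<^sup>2)"
        using w w' by (intro mult_mono) auto
      then show "qquad a d (n + k) * w \<le> ((1 + \<bar>a\<bar>) * (T + \<tau>)) * (real (Suc n))\<^sup>2" by (simp add: mult.assoc)
    qed
  next
    case 3
    define U where "U = 1 + \<bar>a\<bar> + \<bar>\<eta>\<bar> * (\<bar>\<theta>\<bar> + \<bar>d\<bar>)"
    have U0: "0 \<le> U" unfolding U_def by (intro add_nonneg_nonneg mult_nonneg_nonneg) auto
    show ?thesis
    proof (intro exI allI impI)
      fix n w assume w: "0 \<le> w" "w \<le> (T + \<tau> * qnum q n) * qnum q (Suc n)"
      have "T * qnum q (Suc n) \<le> T * real (Suc n)" using T qnum_bounds(2)[of "Suc n"] by (intro mult_left_mono) auto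
      then have w': "w \<le> T * real (Suc n)" using w(2) 3 by simp
      have "qquad a d (n + k) \<le> 1 + \<bar>a\<bar> + real (n + k) * \<bar>\<eta>\<bar> * (\<bar>\<theta>\<bar> + \<bar>d\<bar>)"
        using qquad_le[OF qnum_bounds(2), of a d "n + k"] 3 by simp
      also have "\<dots> \<le> U * real (Suc (n + k))"
        unfolding U_def by (simp add: algebra_simps)
      also have "\<dots> \<le> U * (real (Suc k) * real (Suc n))"
        using U0 by (intro mult_left_mono) (auto simp: algebra_simps)
      finally have "qquad a d (n + k) * w \<le> U * (real (Suc k) * real (Suc n)) * (T * real (Suc n))"
        using w w' U0 by (intro mult_mono) auto
      then show "qquad a d (n + k) * w \<le> (U * real (Suc k) * T) * (real (Suc n))\<^sup>2"
        by (simp add: power2_eq_square algebra_simps)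
    qed
  qed
qed

lemma l_level_nonneg: "0 \<le> l_level k i"
  unfolding l_level_def using order.trans[OF zero_le_one A_ge_1] c_nonneg by (rule mult_nonneg_nonneg)

lemma jnorm_l_level_nonneg: "0 \<le> jnorm (l_level k) n"
  unfolding jnorm_def by (intro prod_nonneg) (simp add: l_level_nonneg)

lemma LU_b_level: "LU_factors (b_level k) (l_level k) (\<eta> * q ^ k) (\<alpha> k 0) (\<lambda>n. A (n + k)) (\<lambda>n. (\<eta> * q ^ k)\<^sup>2 * c n)"
  unfolding LU_factors_def by (simp add: b_level_LU) (simp add: l_level_def)

text \<open>Only for \<open>q = 1\<close> with \<open>\<eta>\<close> and \<open>\<tau>\<close> both nonzero do the coefficients exceed quadratic growth; there the
LU factors are quadratic polynomials with the same leading coefficient.\<close>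

lemma b_level_determinate:
  "\<exists>w. Im w \<noteq> 0 \<and> ((\<forall>n. 0 < jnorm (l_level k) n) \<longrightarrow> (\<forall>B. \<exists>n. B < jkernel (b_level k) (l_level k) n w))"
proof (cases "q < 1 \<or> \<eta> * \<tau> = 0")
  case True
  obtain K where K: "\<And>n w. 0 \<le> w \<Longrightarrow> w \<le> (s + \<tau> * qnum q n) * qnum q (Suc n) \<Longrightarrow>
    qquad 0 0 (n + k) * w \<le> K * (real (Suc n))\<^sup>2"
    using quadratic_growth[OF True s, of 0 0 k] by blast
  have "l_level k (Suc n) \<le> K * (real (Suc n))\<^sup>2" for n
    using K[OF c_nonneg[of "Suc n"]] by (simp add: l_level_def A_eq_qquad c_def)
  then show ?thesis using jkernel_unbounded_Carleman[where l = "l_level k" and C = K and b = "b_level k"] by (intro exI[of _ \<i>]) auto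
next
  case False
  then have "q = 1" and \<eta>\<tau>: "\<eta> \<noteq> 0" "\<tau> > 0" using q \<tau> by auto
  then have q1: "qnum q n = real n" "q ^ n = 1" for n by simp_all
  show ?thesis
  proof (cases "\<forall>n. 0 < jnorm (l_level k) n")
    case pos: True
    have "\<exists>w. Im w \<noteq> 0 \<and> (\<forall>B. \<exists>n. B < jkernel (b_level k) (l_level k) n w)"
    proof (rule jkernel_unbounded_LU[OF _ LU_b_level])
      show "0 < A (n + k)" for n using A_ge_1[of "n + k"] by simp
      show "A (n + k) = \<eta>\<^sup>2 * \<tau> * (real n)\<^sup>2 + (\<eta> * \<theta> + 2 * real k * \<eta>\<^sup>2 * \<tau>) * real n
         + (1 + \<eta> * \<theta> * real k + \<eta>\<^sup>2 * \<tau> * (real k)\<^sup>2)" for n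
        unfolding A_def q1 of_nat_add by (simp add: algebra_simps power2_eq_square)
      show "(\<eta> * q ^ k)\<^sup>2 * c n = \<eta>\<^sup>2 * \<tau> * (real n)\<^sup>2 + \<eta>\<^sup>2 * (s - \<tau>) * real n" for n
        unfolding c_def q1 by (cases n) (auto simp: algebra_simps power2_eq_square)
    qed (use pos \<eta>\<tau> q1 in auto)
    then show ?thesis by blast
  qed (auto intro!: exI[of _ \<i>])
qed

lemma jacobi_measure_b_level_unique:
  assumes "jacobi_measure (b_level k) (l_level k) \<mu>1" "jacobi_measure (b_level k) (l_level k) \<mu>2"
  shows "\<mu>1 = \<mu>2"
proof -
  obtain w where "Im w \<noteq> 0" "(\<And>n. 0 < jnorm (l_level k) n) \<Longrightarrow> \<exists>n. B < jkernel (b_level k) (l_level k) n w" for B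
    using b_level_determinate[of k] by blast
  then show ?thesis using jacobi_measure_unique[OF jnorm_l_level_nonneg _ _ assms] by blast
qed

text \<open>The zeros of all orthogonal polynomials lie where \<open>\<alpha> k\<close> is nonnegative. The measure of Favard's
theorem is therefore concentrated there, and by determinacy it is the given one.\<close>

lemma AE_\<alpha>_nonneg:
  assumes \<mu>: "jacobi_measure (b_level k) (l_level k) \<mu>"
  shows "AE x in \<mu>. 0 \<le> \<alpha> k x"
proof -
  define f where "f x = min 1 (max 0 (- \<alpha> k x))" for x
  have fc: "continuous_on UNIV f" unfolding f_def \<alpha>_def by (intro continuous_intros)
  have fb: "\<bar>f x\<bar> \<le> 1" for x unfolding f_def by auto
  have root: "f y = 0" if root: "poly (P k n) y = 0" for n y
  proof -
    have u: "0 < A (i + k)" and v: "0 \<le> (\<eta> * q ^ k)\<^sup>2 * c i" for i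
      using A_ge_1[of "i + k"] c_nonneg[of i] by simp_all
    have "\<not> \<alpha> k 0 + \<eta> * q ^ k * y < 0"
      using LU_root_location[OF LU_b_level u v, where y = y and n = n] root by blast
    then show ?thesis using \<alpha>_affine[of k y] by (simp add: f_def)
  qed
  have I: "(\<integral>y. f y \<partial>\<mu>) = 0"
  proof (rule Favard[where b = "b_level k" and l = "l_level k", OF jnorm_l_level_nonneg])
    fix \<nu>
    assume \<nu>: "jacobi_measure (b_level k) (l_level k) \<nu>"
      and van: "\<And>f B. continuous_on UNIV f \<Longrightarrow> (\<And>y. \<bar>f y\<bar> \<le> B) \<Longrightarrow>
       (\<And>n y. 0 < n \<Longrightarrow> (\<And>i. i < n \<Longrightarrow> 0 < jnorm (l_level k) i) \<Longrightarrow> poly (P k n) y = 0 \<Longrightarrow> f y = 0) \<Longrightarrow>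
       (\<integral>y. f y \<partial>\<nu>) = (0::real)"
    have "\<mu> = \<nu>" by (rule jacobi_measure_b_level_unique[OF \<mu> \<nu>])
    then show ?thesis using van[OF fc fb root] by simp
  qed
  interpret real_distribution \<mu> using \<mu> by (simp add: jacobi_measure_def)
  have fm: "f \<in> borel_measurable \<mu>" using borel_measurable_continuous_onI[OF fc] by simp
  have "integrable \<mu> f" using fb fm by (intro integrable_const_bound[of _ 1]) auto
  then have "AE x in \<mu>. f x = 0"
    using integral_nonneg_eq_0_iff_AE[of \<mu> f] I by (auto simp: f_def)
  then show ?thesis by eventually_elim (auto simp: f_def min_def max_def split: if_splits)
qed

lemma \<alpha>_integrable_mult:
  assumes "jacobi_measure (b_level k) (l_level k) \<mu>"
  shows "integrable \<mu> (\<lambda>x. \<alpha> k x * poly p x)"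
proof -
  have "poly ([:\<alpha> k 0, \<eta> * q ^ k:] * p) = (\<lambda>x. \<alpha> k x * poly p x)"
  proof
    show "poly ([:\<alpha> k 0, \<eta> * q ^ k:] * p) x = \<alpha> k x * poly p x" for x
      unfolding \<alpha>_affine[of k x] by (simp add: algebra_simps)
  qed
  then show ?thesis using jacobi_measure_integrable[OF assms, of "[:\<alpha> k 0, \<eta> * q ^ k:] * p"] by simp
qed

lemma jacobi_measure_Christoffel:
  assumes \<mu>: "jacobi_measure (b_level k) (l_level k) \<mu>"
  shows "jacobi_measure (b_level (Suc k)) (l_level (Suc k)) (density \<mu> (\<lambda>x. ennreal (\<alpha> k x / A k)))"
proof -
  interpret M: real_distribution \<mu> using \<mu> by (simp add: jacobi_measure_def)
  let ?g = "\<lambda>x. \<alpha> k x / A k"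
  let ?\<rho> = "density \<mu> (\<lambda>x. ennreal (?g x))"
  have A0: "0 < A i" for i using A_ge_1[of i] by simp
  have g0: "AE x in \<mu>. 0 \<le> ?g x"
    using AE_\<alpha>_nonneg[OF \<mu>] by eventually_elim (simp add: A0 less_imp_le)
  have gm: "?g \<in> borel_measurable \<mu>"
    unfolding \<alpha>_def by (intro M.measurable_finite_borel borel_measurable_continuous_onI continuous_intros) (use A0 in \<open>auto simp: less_imp_neq[symmetric]\<close>)
  have pm: "poly p \<in> borel_measurable \<mu>" for p
    by (intro M.measurable_finite_borel borel_measurable_continuous_onI continuous_on_poly continuous_on_id)
  have ip: "integrable \<mu> (\<lambda>x. ?g x * poly p x)" for p
    using integrable_divide[OF \<alpha>_integrable_mult[OF \<mu>, of p], of "A k"] by (simp add: field_simps)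
  have int: "integrable ?\<rho> (poly p)" for p
    using integrable_density[OF pm gm g0, of p] ip[of p] by simp
  have mean: "(\<integral>x. poly (P (Suc k) n) x \<partial>?\<rho>) = (if n = 0 then 1 else 0)" for n
  proof -
    have "(\<integral>x. poly (P (Suc k) n) x \<partial>?\<rho>) = (\<integral>x. ?g x * poly (P (Suc k) n) x \<partial>\<mu>)"
      using integral_density[OF pm gm g0] by simp
    also have "\<dots> = (\<integral>x. (\<eta> * q ^ k * poly (P k (Suc n)) x + A (n + k) * poly (P k n) x) / A k \<partial>\<mu>)"
      by (intro Bochner_Integration.integral_cong refl) (simp add: \<alpha>_times_P[symmetric])
    also have "\<dots> = (\<eta> * q ^ k * (\<integral>x. poly (P k (Suc n)) x \<partial>\<mu>) + A (n + k) * (\<integral>x. poly (P k n) x \<partial>\<mu>)) / A k"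
      using jacobi_measure_integrable[OF \<mu>] by (simp del: jpoly.simps)
    also have "\<dots> = (if n = 0 then 1 else 0)"
    proof (cases n)
      case 0
      have "(\<integral>x. poly (P k 0) x \<partial>\<mu>) = 1" using M.prob_space by simp
      moreover have "(\<integral>x. poly (P k (Suc 0)) x \<partial>\<mu>) = 0" using \<mu> by (simp add: jacobi_measure_def del: jpoly.simps)
      ultimately show ?thesis using A0[of k] by (simp add: 0 del: jpoly.simps)
    qed (use \<mu> in \<open>simp add: jacobi_measure_def del: jpoly.simps\<close>)
    finally show ?thesis .
  qed
  have "emeasure ?\<rho> (space ?\<rho>) = 1"
  proof -
    have "(\<integral>x. ?g x \<partial>\<mu>) = (\<integral>x. poly (P (Suc k) 0) x \<partial>?\<rho>)"
      unfolding integral_density[OF pm gm g0] by simp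
    also have "\<dots> = 1" unfolding mean by simp
    finally have "(\<integral>x. ?g x \<partial>\<mu>) = 1" .
    moreover have "emeasure ?\<rho> (space ?\<rho>) = (\<integral>\<^sup>+x. ennreal (?g x) \<partial>\<mu>)"
      using gm by (subst emeasure_density) (auto intro!: nn_integral_cong)
    moreover have "(\<integral>\<^sup>+x. ennreal (?g x) \<partial>\<mu>) = ennreal (\<integral>x. ?g x \<partial>\<mu>)"
      using ip[of 1] g0 by (intro nn_integral_eq_integral) simp_all
    ultimately show ?thesis by simp
  qed
  then have "real_distribution ?\<rho>"
    unfolding real_distribution_def real_distribution_axioms_def by (auto intro: prob_spaceI)
  moreover have "integrable ?\<rho> (\<lambda>x. x ^ n)" for n
    using int[of "monom 1 n"] by (simp add: poly_monom[abs_def])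
  ultimately show ?thesis unfolding jacobi_measure_def using mean by simp
qed

text \<open>Where \<open>\<alpha> k\<close> vanishes the product is zero. Where it is positive, a set that is null for the
Christoffel transform is null for \<open>\<mu>\<close>, and the induction hypothesis applies to the transform.\<close>

lemma AE_\<alpha>_prod_nonneg:
  assumes "jacobi_measure (b_level k) (l_level k) \<mu>"
  shows "AE x in \<mu>. 0 \<le> (\<Prod>j<m. \<alpha> (k + j) x)"
  using assms
proof (induction m arbitrary: k \<mu>)
  case (Suc m)
  let ?\<rho> = "density \<mu> (\<lambda>x. ennreal (\<alpha> k x / A k))"
  interpret M: real_distribution \<mu> using Suc.prems by (simp add: jacobi_measure_def)
  have gm: "(\<lambda>x. ennreal (\<alpha> k x / A k)) \<in> borel_measurable \<mu>"
    unfolding \<alpha>_def by (intro measurable_compose[OF _ measurable_ennreal] M.measurable_finite_borel) measurable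
  have "AE x in ?\<rho>. 0 \<le> (\<Prod>j<m. \<alpha> (Suc k + j) x)"
    by (rule Suc.IH[OF jacobi_measure_Christoffel[OF Suc.prems]])
  then have "AE x in \<mu>. 0 < ennreal (\<alpha> k x / A k) \<longrightarrow> 0 \<le> (\<Prod>j<m. \<alpha> (Suc k + j) x)"
    unfolding AE_density[OF gm] .
  with AE_\<alpha>_nonneg[OF Suc.prems] show ?case
  proof eventually_elim
    case (elim x)
    have split: "(\<Prod>j<Suc m. \<alpha> (k + j) x) = \<alpha> k x * (\<Prod>j<m. \<alpha> (Suc k + j) x)"
      by (simp add: prod.lessThan_Suc_shift del: prod.lessThan_Suc)
    have "0 < ennreal (\<alpha> k x / A k)" if "\<alpha> k x \<noteq> 0"
      using elim(1) that A_ge_1[of k] by simp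
    then show ?case unfolding split using elim by (cases "\<alpha> k x = 0") simp_all
  qed
qed simp

lemma orthogonality_measure_jacobi:
  assumes "orthogonality_measure \<eta> \<theta> \<tau> q s \<mu>"
  shows "jacobi_measure (b_level 0) (l_level 0) \<mu>"
  unfolding jacobi_measure_def pbar_eq_P[symmetric]
proof (intro conjI allI impI)
  fix n :: nat assume "0 < n"
  then have "(\<integral>y. poly (pbar \<eta> \<theta> \<tau> q s n) y * poly (pbar \<eta> \<theta> \<tau> q s 0) y \<partial>\<mu>) = 0"
    using assms unfolding orthogonality_measure_def by blast
  then show "(\<integral>y. poly (pbar \<eta> \<theta> \<tau> q s n) y \<partial>\<mu>) = 0" by simp
qed (use assms in \<open>auto simp: orthogonality_measure_def\<close>)

text \<open>The set where the product is negative is open and null, hence disjoint from the support.\<close>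

lemma \<alpha>_prod_nonneg_on_support:
  assumes \<mu>: "orthogonality_measure \<eta> \<theta> \<tau> q s \<mu>" and x: "x \<in> measure_support \<mu>"
  shows "0 \<le> (\<Prod>j<m. \<alpha> j x)"
proof (rule ccontr)
  assume "\<not> ?thesis"
  then have mem: "x \<in> {y. (\<Prod>j<m. \<alpha> j y) < 0}" (is "x \<in> ?U") by simp
  have "open ?U"
    by (intro open_Collect_less) (auto simp: \<alpha>_def intro!: continuous_intros)
  then have pos: "0 < emeasure \<mu> ?U" using x mem unfolding measure_support_def by blast
  have "AE y in \<mu>. 0 \<le> (\<Prod>j<m. \<alpha> (0 + j) y)"
    by (rule AE_\<alpha>_prod_nonneg[OF orthogonality_measure_jacobi[OF \<mu>]])
  then have "AE y in \<mu>. y \<notin> ?U" by eventually_elim auto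
  moreover have "?U \<in> sets \<mu>"
    using \<mu> \<open>open ?U\<close> unfolding orthogonality_measure_def by (simp add: real_distribution.events_eq_borel)
  ultimately have "emeasure \<mu> ?U = 0" by (simp add: AE_iff_measurable[OF _ refl] AE_iff_null_sets null_setsD1)
  then show False using pos by simp
qed

section \<open>The measure attached to a point of the support\<close>

lemma jnorm_\<Lambda>: "jnorm (\<Lambda> t x) n = (\<Prod>j<n. C t (Suc j)) * (\<Prod>j<n. \<alpha> j x)"
  by (induction n) (simp_all add: \<Lambda>_def)

lemma C_bounds:
  assumes "s \<le> t"
  shows "0 \<le> C t (Suc n)" "C t (Suc n) \<le> (t + \<tau> * qnum q n) * qnum q (Suc n)"
proof -
  note Q = qnum_bounds[of n] qnum_bounds[of "Suc n"]
  have "s * q ^ n \<le> s" using Q s by (simp add: mult_left_le)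
  then have "0 \<le> t - s * q ^ n + \<tau> * qnum q n" using assms \<tau> Q by (simp add: add_nonneg_nonneg)
  then show "0 \<le> C t (Suc n)" using Q unfolding C_def by simp
  show "C t (Suc n) \<le> (t + \<tau> * qnum q n) * qnum q (Suc n)"
    unfolding C_def diff_Suc_1 using Q s by (intro mult_right_mono) auto
qed

text \<open>When no squared norm vanishes, all \<open>\<alpha> n x\<close> are positive, and the two determinacy criteria apply
exactly as for \<open>\<mu>\<^sub>s\<close>.\<close>

lemma kernel_determinate:
  assumes t: "s \<le> t" and x: "\<And>m. 0 \<le> (\<Prod>j<m. \<alpha> j x)"
  shows "\<exists>w. Im w \<noteq> 0 \<and> ((\<forall>n. 0 < jnorm (\<Lambda> t x) n) \<longrightarrow> (\<forall>K. \<exists>n. K < jkernel (B t x) (\<Lambda> t x) n w))"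
proof (cases "\<forall>n. 0 < jnorm (\<Lambda> t x) n")
  case pos: True
  have W: "0 < (\<Prod>j<m. \<alpha> j x)" for m
    using x[of m] pos[rule_format, of m] unfolding jnorm_\<Lambda> by (metis less_eq_real_def mult_zero_right)
  have \<alpha>pos: "0 < \<alpha> n x" for n
    using W[of "Suc n"] W[of n] by (simp add: zero_less_mult_iff)
  have "\<exists>w. Im w \<noteq> 0 \<and> (\<forall>K. \<exists>n. K < jkernel (B t x) (\<Lambda> t x) n w)"
  proof (cases "q < 1 \<or> \<eta> * \<tau> = 0")
    case True
    have "0 \<le> t" using s t by simp
    then obtain K where K: "\<And>n w. 0 \<le> w \<Longrightarrow> w \<le> (t + \<tau> * qnum q n) * qnum q (Suc n) \<Longrightarrow>
      qquad (\<eta> * x) (s * \<eta>) (n + 0) * w \<le> K * (real (Suc n))\<^sup>2"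
      using quadratic_growth[OF True, of t "\<eta> * x" "s * \<eta>" 0] by blast
    have "\<Lambda> t x (Suc n) \<le> K * (real (Suc n))\<^sup>2" for n
      using K[OF C_bounds[OF t]] by (simp add: \<Lambda>_def \<alpha>_eq_qquad mult.commute)
    then show ?thesis using jkernel_unbounded_Carleman[where l = "\<Lambda> t x" and C = K and b = "B t x"] pos by (intro exI[of _ \<i>]) auto
  next
    case False
    then have "q = 1" and \<eta>\<tau>: "\<eta> \<noteq> 0" "\<tau> > 0" using q \<tau> by auto
  then have q1: "qnum q n = real n" "q ^ n = 1" for n by simp_all
    show ?thesis
    proof (rule jkernel_unbounded_LU)
      show "LU_factors (B t x) (\<Lambda> t x) \<eta> 1 (\<lambda>n. \<alpha> n x) (\<lambda>n. \<eta>\<^sup>2 * C t n)"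
        unfolding LU_factors_def
      proof (intro conjI allI)
        show "\<eta> * B t x n = \<alpha> n x + \<eta>\<^sup>2 * C t n - 1" for n
          unfolding B_def C_def \<alpha>_def q1 qnum_1
          by (cases n) (simp_all add: algebra_simps power2_eq_square)
      qed (simp_all add: C_def \<Lambda>_def)
      show "\<alpha> n x = \<eta>\<^sup>2 * \<tau> * (real n)\<^sup>2 + \<eta> * (\<theta> - s * \<eta>) * real n + (1 + \<eta> * x)" for n
        unfolding \<alpha>_def q1 by (simp add: algebra_simps power2_eq_square)
      show "\<eta>\<^sup>2 * C t n = \<eta>\<^sup>2 * \<tau> * (real n)\<^sup>2 + \<eta>\<^sup>2 * (t - s - \<tau>) * real n" for n
        unfolding C_def q1 by (cases n) (simp_all add: algebra_simps power2_eq_square)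
    qed (use pos \<alpha>pos \<eta>\<tau> in auto)
  qed
  then show ?thesis by blast
qed (auto intro!: exI[of _ \<i>])

text \<open>The connection coefficients form a unitriangular matrix whose column \<open>0\<close> is
\<open>pbar \<eta> \<theta> \<tau> q s n\<close> at \<open>x\<close>. So prescribing the integrals of the \<open>pbar \<eta> \<theta> \<tau> q t n\<close> is the same as
letting the integrals of the polynomials of degree at least one with coefficients \<open>B\<close> and \<open>\<Lambda>\<close> vanish.\<close>

lemma pbar_martingale_iff:
  "real_distribution \<nu> \<and> (\<forall>n. integrable \<nu> (\<lambda>y. poly (pbar \<eta> \<theta> \<tau> q t n) y) \<and>
      poly (pbar \<eta> \<theta> \<tau> q s n) x = (\<integral>y. poly (pbar \<eta> \<theta> \<tau> q t n) y \<partial>\<nu>))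
   \<longleftrightarrow> jacobi_measure (B t x) (\<Lambda> t x) \<nu>" (is "?L \<longleftrightarrow> ?R")
proof
  assume R: ?R
  then have rd: "real_distribution \<nu>" and int: "\<And>n. integrable \<nu> (\<lambda>y. y ^ n)"
    and mean: "\<And>k. 0 < k \<Longrightarrow> (\<integral>y. poly (jpoly (B t x) (\<Lambda> t x) k) y \<partial>\<nu>) = 0"
    by (auto simp: jacobi_measure_def)
  have "poly (pbar \<eta> \<theta> \<tau> q s n) x = (\<integral>y. poly (pbar \<eta> \<theta> \<tau> q t n) y \<partial>\<nu>)" for n
    unfolding pbar_connection[of t n x]
    using integral_jpoly_expansion[OF rd int mean, of n "connection x n"] by (simp add: connection_0)
  then show ?L using rd integrable_poly[OF int] by blast
next
  assume L: ?L
  then have rd: "real_distribution \<nu>" and intp: "\<And>n. integrable \<nu> (\<lambda>y. poly (pbar \<eta> \<theta> \<tau> q t n) y)"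
    and mp: "\<And>n. poly (pbar \<eta> \<theta> \<tau> q s n) x = (\<integral>y. poly (pbar \<eta> \<theta> \<tau> q t n) y \<partial>\<nu>)" by auto
  interpret real_distribution \<nu> by (rule rd)
  have int: "integrable \<nu> (\<lambda>y. y ^ n)" for n
  proof -
    obtain c where c: "monom 1 n = (\<Sum>j\<le>n. smult (c j) (pbar \<eta> \<theta> \<tau> q t j))"
      using jpoly_expansion[OF degree_monom_le[of "1::real" n], of "b_coeff \<eta> \<theta> \<tau> q t" "ac_coeff \<eta> \<theta> \<tau> q t"]
      unfolding pbar_eq_jpoly by blast
    have "y ^ n = (\<Sum>j\<le>n. c j * poly (pbar \<eta> \<theta> \<tau> q t j) y)" for y
      using arg_cong[OF c, of "\<lambda>p. poly p y"] by (simp add: poly_monom poly_sum)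
    then show ?thesis using intp by simp
  qed
  let ?J = "jpoly (B t x) (\<Lambda> t x)"
  have "(\<integral>y. poly (?J n) y \<partial>\<nu>) = 0" if "0 < n" for n
    using that
  proof (induction n rule: less_induct)
    case (less n)
    have "connection x n 0 = (\<integral>y. poly (pbar \<eta> \<theta> \<tau> q t n) y \<partial>\<nu>)" using mp connection_0 by simp
    also have "\<dots> = (\<Sum>k\<le>n. connection x n k * (\<integral>y. poly (?J k) y \<partial>\<nu>))"
      unfolding pbar_connection[of t n x] poly_sum poly_smult
      by (subst Bochner_Integration.integral_sum) (auto intro!: integrable_mult_right integrable_poly int)
    also have "\<dots> = (\<Sum>k\<le>n. if k = 0 then connection x n 0 else if k = n then (\<integral>y. poly (?J n) y \<partial>\<nu>) else 0)"
      using less prob_space connection_diag by (intro sum.cong refl) (auto simp del: jpoly.simps(2,3))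
    also have "\<dots> = (\<Sum>k\<le>n. (if k = 0 then connection x n 0 else 0) + (if k = n then (\<integral>y. poly (?J n) y \<partial>\<nu>) else 0))"
      using less.prems by (intro sum.cong refl) auto
    also have "\<dots> = connection x n 0 + (\<integral>y. poly (?J n) y \<partial>\<nu>)" by (simp add: sum.distrib)
    finally show ?case by simp
  qed
  then show ?R unfolding jacobi_measure_def using rd int by blast
qed

lemma unique_kernel:
  assumes t: "s \<le> t" and x: "\<And>m. 0 \<le> (\<Prod>j<m. \<alpha> j x)"
  shows "\<exists>!\<nu>. jacobi_measure (B t x) (\<Lambda> t x) \<nu>"
proof -
  have h: "0 \<le> jnorm (\<Lambda> t x) n" for n
    unfolding jnorm_\<Lambda> using C_bounds(1)[OF t] by (intro mult_nonneg_nonneg[OF _ x] prod_nonneg) simp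
  have "\<exists>\<nu>. jacobi_measure (B t x) (\<Lambda> t x) \<nu>" by (rule Favard[OF h]) (rule exI)
  moreover obtain w where "Im w \<noteq> 0" "(\<And>n. 0 < jnorm (\<Lambda> t x) n) \<Longrightarrow> \<exists>n. K < jkernel (B t x) (\<Lambda> t x) n w" for K
    using kernel_determinate[OF t x] by blast
  ultimately show ?thesis using jacobi_measure_unique[OF h] by blast
qed

end

theorem theorem1p1:
  fixes \<eta> \<theta> \<tau> q s t x :: real and \<mu>\<^sub>s :: "real measure"
  assumes "0 \<le> q" and "q \<le> 1"
    and "\<eta> * \<theta> \<ge> 0" and "\<tau> \<ge> 0"
    and "0 \<le> s" and "s \<le> t"
    and "orthogonality_measure \<eta> \<theta> \<tau> q s \<mu>\<^sub>s"
    and "x \<in> measure_support \<mu>\<^sub>s"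
  shows "\<exists>!\<nu>. real_distribution \<nu> \<and>
           (\<forall>n. integrable \<nu> (\<lambda>y. poly (pbar \<eta> \<theta> \<tau> q t n) y) \<and>
                poly (pbar \<eta> \<theta> \<tau> q s n) x = (\<integral>y. poly (pbar \<eta> \<theta> \<tau> q t n) y \<partial>\<nu>))"
proof -
  interpret harness \<eta> \<theta> \<tau> q s by unfold_locales (use assms in auto)
  show ?thesis
    unfolding pbar_martingale_iff
    by (rule unique_kernel[OF assms(6) \<alpha>_prod_nonneg_on_support[OF assms(7,8)]])
qed

end
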